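(* Let $X$ be the space of all sequences of the form $c=\sum_{k=1}^N a_k\star b_k$ (finite sums) with $a_k,b_k$ finitely supported sequences, normed by $\|c\|_X=\inf\sum_{k=1}^N\|a_k\|_{\ell^2(\mathbb{N})}\|b_k\|_{\ell^2(\mathbb{N})}$, the infimum over all such finite representations of $c$, and let $\mathcal{X}$ be the Banach space completion of $X$. For $c\in X$ define $Lc\in\mathcal{M}_0^*$ by $Lc(m)=(\alpha,c)$ for $m=M(\alpha)\in\mathcal{M}_0$. Then $L$ extends to an isometric isomorphism $L\colon\mathcal{X}\to\mathcal{M}_0^*$, and $L^*U^{-1}=J$, where $U\colon\mathcal{M}_0^{**}\to\mathcal{M}$ is the unique isometric isomorphism with $U\iota_{\mathcal{M}_0}m=m$ for all $m\in\mathcal{M}_0$, and $J\colon\mathcal{M}\to\mathcal{X}^*$ is the isometric isomorphism determined by $Jm(c)=(\alpha,c)$ for $m=M(\alpha)\in\mathcal{M}$, $c\in X$.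
   Context: For a sequence $\alpha\colon\mathbb{N}\to\mathbb{C}$, the multiplicative Hankel operator $M(\alpha)$ is defined by $\langle M(\alpha)a,b\rangle_{\ell^2(\mathbb{N})}=\sum_{n,m}a(n)\overline{b(m)}\alpha(nm)$ for finitely supported $a,b$; $\mathcal{M}$ (resp. $\mathcal{M}_0$) is the space of those $M(\alpha)$ which extend to bounded (resp. compact) operators on $\ell^2(\mathbb{N})$, with the operator norm. The Dirichlet convolution is $(a\star b)(n)=\sum_{k\mid n}a(k)\overline{b(n/k)}$, and $(a,b)=\sum_{n}a(n)b(n)$ is the bilinear pairing. $\iota_{\mathcal{M}_0}\colon\mathcal{M}_0\to\mathcal{M}_0^{**}$ is the canonical embedding. (It is part of the setting that such $U$ exists uniquely and that $J$ extends to an isometric isomorphism of $\mathcal{M}$ onto $\mathcal{X}^*$.) *)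

theory Defs
  imports Complex_Main
begin

text \<open>Sequences on the positive integers are modelled as functions nat \<Rightarrow> complex
  that vanish at 0 (the value at index 0 is a dummy and kept equal to 0).\<close>

type_synonym seq = "nat \<Rightarrow> complex"
type_synonym functional = "seq \<Rightarrow> complex"

definition supp :: "seq \<Rightarrow> nat set" where
  "supp a = {n. a n \<noteq> 0}"

definition fin_supp :: "seq \<Rightarrow> bool" where
  "fin_supp a \<longleftrightarrow> a 0 = 0 \<and> finite (supp a)"

definition fnorm :: "seq \<Rightarrow> real" where
  "fnorm a = sqrt (\<Sum>n\<in>supp a. (cmod (a n))^2)"

definition l2 :: "seq set" where
  "l2 = {a. a 0 = 0 \<and> summable (\<lambda>n. (cmod (a n))^2)}"

definition l2norm :: "seq \<Rightarrow> real" where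
  "l2norm a = sqrt (\<Sum>n. (cmod (a n))^2)"

definition hform :: "seq \<Rightarrow> seq \<Rightarrow> seq \<Rightarrow> complex" where
  "hform \<alpha> a b = (\<Sum>n\<in>supp a. \<Sum>m\<in>supp b. a n * cnj (b m) * \<alpha> (n * m))"

definition hbounded :: "seq \<Rightarrow> bool" where
  "hbounded \<alpha> \<longleftrightarrow> (\<exists>C. \<forall>a b. fin_supp a \<longrightarrow> fin_supp b \<longrightarrow>
      cmod (hform \<alpha> a b) \<le> C * fnorm a * fnorm b)"

definition hnorm :: "seq \<Rightarrow> real" where
  "hnorm \<alpha> = Inf {C. 0 \<le> C \<and> (\<forall>a b. fin_supp a \<longrightarrow> fin_supp b \<longrightarrow>
      cmod (hform \<alpha> a b) \<le> C * fnorm a * fnorm b)}"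

definition Mop :: "seq \<Rightarrow> seq \<Rightarrow> seq" where
  "Mop \<alpha> a = (\<lambda>m. \<Sum>n. \<alpha> (n * m) * a n)"

text \<open>The space M (bounded multiplicative Hankel operators), identified with symbols alpha.\<close>
definition Mb :: "seq set" where
  "Mb = {\<alpha>. \<alpha> 0 = 0 \<and> hbounded \<alpha>}"

text \<open>The space M_0: compact ones (image of the unit ball of l2 is totally bounded).\<close>
definition M0 :: "seq set" where
  "M0 = {\<alpha>. \<alpha> \<in> Mb \<and> (\<forall>e>0. \<exists>F. finite F \<and> F \<subseteq> l2 \<and>
      (\<forall>a\<in>l2. l2norm a \<le> 1 \<longrightarrow> (\<exists>f\<in>F. l2norm (\<lambda>n. Mop \<alpha> a n - f n) < e)))}"

text \<open>The dual M_0^*: bounded linear functionals on M_0 (two functionals are identified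
  when they agree on M_0).\<close>
definition M0dual :: "functional set" where
  "M0dual = {\<phi>. (\<forall>\<alpha>\<in>M0. \<forall>\<beta>\<in>M0. \<phi> (\<lambda>n. \<alpha> n + \<beta> n) = \<phi> \<alpha> + \<phi> \<beta>) \<and>
                (\<forall>\<alpha>\<in>M0. \<forall>k. \<phi> (\<lambda>n. k * \<alpha> n) = k * \<phi> \<alpha>) \<and>
                (\<exists>C. \<forall>\<alpha>\<in>M0. cmod (\<phi> \<alpha>) \<le> C * hnorm \<alpha>)}"

definition dnorm :: "functional \<Rightarrow> real" where
  "dnorm \<phi> = Sup {cmod (\<phi> \<alpha>) | \<alpha>. \<alpha> \<in> M0 \<and> hnorm \<alpha> \<le> 1}"

definition eq_on_M0 :: "functional \<Rightarrow> functional \<Rightarrow> bool" where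
  "eq_on_M0 \<phi> \<psi> \<longleftrightarrow> (\<forall>\<alpha>\<in>M0. \<phi> \<alpha> = \<psi> \<alpha>)"

text \<open>The bidual M_0^**: bounded linear functionals on M_0^*, well defined on the
  identification classes of M_0^*.\<close>
definition M0ddual :: "(functional \<Rightarrow> complex) set" where
  "M0ddual = {\<Phi>. (\<forall>\<phi>\<in>M0dual. \<forall>\<psi>\<in>M0dual. eq_on_M0 \<phi> \<psi> \<longrightarrow> \<Phi> \<phi> = \<Phi> \<psi>) \<and>
                 (\<forall>\<phi>\<in>M0dual. \<forall>\<psi>\<in>M0dual. \<Phi> (\<lambda>\<alpha>. \<phi> \<alpha> + \<psi> \<alpha>) = \<Phi> \<phi> + \<Phi> \<psi>) \<and>
                 (\<forall>\<phi>\<in>M0dual. \<forall>k. \<Phi> (\<lambda>\<alpha>. k * \<phi> \<alpha>) = k * \<Phi> \<phi>) \<and>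
                 (\<exists>C. \<forall>\<phi>\<in>M0dual. cmod (\<Phi> \<phi>) \<le> C * dnorm \<phi>)}"

definition ddnorm :: "(functional \<Rightarrow> complex) \<Rightarrow> real" where
  "ddnorm \<Phi> = Sup {cmod (\<Phi> \<phi>) | \<phi>. \<phi> \<in> M0dual \<and> dnorm \<phi> \<le> 1}"

definition eq_on_M0dual :: "(functional \<Rightarrow> complex) \<Rightarrow> (functional \<Rightarrow> complex) \<Rightarrow> bool" where
  "eq_on_M0dual \<Phi> \<Psi> \<longleftrightarrow> (\<forall>\<phi>\<in>M0dual. \<Phi> \<phi> = \<Psi> \<phi>)"

definition iota :: "seq \<Rightarrow> (functional \<Rightarrow> complex)" where
  "iota \<alpha> = (\<lambda>\<phi>. \<phi> \<alpha>)"

definition dconv :: "seq \<Rightarrow> seq \<Rightarrow> seq" where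
  "dconv a b n = (if n = 0 then 0 else (\<Sum>k\<in>{k. k dvd n}. a k * cnj (b (n div k))))"

definition rep :: "(seq \<times> seq) list \<Rightarrow> seq \<Rightarrow> bool" where
  "rep ps c \<longleftrightarrow> (\<forall>(a, b)\<in>set ps. fin_supp a \<and> fin_supp b) \<and>
                 c = (\<lambda>n. sum_list (map (\<lambda>(a, b). dconv a b n) ps))"

definition Xset :: "seq set" where
  "Xset = {c. \<exists>ps. rep ps c}"

definition Xnorm :: "seq \<Rightarrow> real" where
  "Xnorm c = Inf {sum_list (map (\<lambda>(a, b). fnorm a * fnorm b) ps) | ps. rep ps c}"

definition pair :: "seq \<Rightarrow> seq \<Rightarrow> complex" where
  "pair \<alpha> c = (\<Sum>n\<in>supp c. \<alpha> n * c n)"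

definition Lmap :: "seq \<Rightarrow> functional" where
  "Lmap c = (\<lambda>\<alpha>. pair \<alpha> c)"

text \<open>The completion of X, realised by Cauchy sequences in X (with respect to Xnorm),
  modulo the equivalence of null difference; the norm of a class is the limit of norms.\<close>
definition Xcompl :: "(nat \<Rightarrow> seq) set" where
  "Xcompl = {s. (\<forall>n. s n \<in> Xset) \<and>
     (\<forall>e>0. \<exists>N. \<forall>m\<ge>N. \<forall>n\<ge>N. Xnorm (\<lambda>i. s m i - s n i) < e)}"

definition Xequiv :: "(nat \<Rightarrow> seq) \<Rightarrow> (nat \<Rightarrow> seq) \<Rightarrow> bool" where
  "Xequiv s t \<longleftrightarrow> (\<lambda>n. Xnorm (\<lambda>i. s n i - t n i)) \<longlonglongrightarrow> 0"

definition Xcnorm :: "(nat \<Rightarrow> seq) \<Rightarrow> real" where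
  "Xcnorm s = lim (\<lambda>n. Xnorm (s n))"

end

theory Submission
  imports "HOL-Analysis.Analysis" "HOL-Computational_Algebra.Primes" Defs
begin

text \<open>
  Multiplying a symbol by a completely multiplicative weight \<open>w\<close> with values in \<open>[0, 1]\<close>
  compresses the Hankel form by the diagonal contraction with entries \<open>w n\<close>, so it does not increase
  the norm. The weights \<open>weight j\<close> supported on \<open>j\<close>-smooth numbers are moreover summable, so the damped
  symbol is a norm limit of finitely supported ones, and they tend to 1 pointwise. Hence every bounded
  symbol is the pointwise limit of compact ones of no larger norm, which together with the
  Hahn--Banach theorem gives that \<open>L\<close> is isometric.

  Everything else rests on one estimate (\<open>hle_add_diff_damp\<close>): adding \<open>\<beta> - damp j \<beta>\<close> with
  \<open>\<parallel>\<beta>\<parallel> \<le> G\<close> and \<open>j\<close> large to a finitely supported symbol of norm \<open>C\<close> yields norm at most about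
  \<open>C + G\<^sup>2 / C\<close>. A gliding hump argument then shows that functionals on the compact symbols are norm
  limits of their damped versions, so \<open>L\<close> has dense range. The same estimate determines \<open>U\<close>: let
  \<open>\<beta>\<close> be the symbol that represents \<open>\<Phi>\<close> through \<open>L\<close> and \<open>\<delta> = U \<Phi> - \<beta>\<close>. Since \<open>U\<close> is isometric
  and fixes the compact symbols, \<open>\<parallel>x + \<delta>\<parallel> \<le> \<parallel>x\<parallel> + \<parallel>\<beta>\<parallel>\<^sup>2 / \<parallel>x\<parallel>\<close> for every finitely supported \<open>x\<close>;
  taking \<open>x\<close> close to a large multiple of \<open>\<delta>\<close> forces \<open>\<delta> = 0\<close>.
\<close>

section \<open>Finitely supported sequences and the Hankel form\<close>

text \<open>Cutting a symbol off at a finite set does not act on the two vectors of the form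
  separately, so it brings no norm bound by itself. A weight with
  \<open>w (n * m) = w n * w m\<close> splits over both slots. Cut-offs are applied only after such
  damping, when the coefficients are absolutely summable and the l1 norm of the tail bounds the
  error. The hypotheses on \<open>U\<close> contain no weak-star continuity, and the image of
  \<open>M0\<close> in the bidual is not known to be norm dense, so \<open>U\<close> cannot be
  determined by continuity. Linearity, isometry and the values on \<open>iota\<close> give access to
  the numbers \<open>hnorm (\<lambda>n. \<alpha> n + y n)\<close> with \<open>y\<close> in
  \<open>M0\<close>, and the symbol has to be recognised from these norms alone. In both
  applications of the central estimate the triangle inequality, with its excess
  \<open>2 * G\<close>, leads to no contradiction. The excess \<open>G\<^sup>2 / C\<close> shrinks
  as \<open>C\<close> grows, and \<open>C\<close> can be chosen large in both.\<close>

definition unit_seq :: "nat \<Rightarrow> seq" where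
  "unit_seq k = (\<lambda>n. if n = k then 1 else 0)"

definition restr :: "nat set \<Rightarrow> seq \<Rightarrow> seq" where
  "restr A a = (\<lambda>n. if n \<in> A then a n else 0)"

lemma fin_supp_add [simp]: "fin_supp a \<Longrightarrow> fin_supp b \<Longrightarrow> fin_supp (\<lambda>n. a n + b n)"
  by (auto simp: fin_supp_def supp_def intro: finite_subset[of _ "{n. a n \<noteq> 0} \<union> {n. b n \<noteq> 0}"])

lemma fin_supp_mult [simp]: "fin_supp a \<Longrightarrow> fin_supp (\<lambda>n. f n * a n)"
  by (auto simp: fin_supp_def supp_def intro: finite_subset[of _ "{n. a n \<noteq> 0}"])

lemma fin_supp_uminus [simp]: "fin_supp a \<Longrightarrow> fin_supp (\<lambda>n. - a n)"
  by (simp add: fin_supp_def supp_def)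

lemma fin_supp_diff [simp]: "fin_supp a \<Longrightarrow> fin_supp b \<Longrightarrow> fin_supp (\<lambda>n. a n - b n)"
  using fin_supp_add[of a "\<lambda>n. - b n"] by simp

lemma fin_supp_cnj [simp]: "fin_supp a \<Longrightarrow> fin_supp (\<lambda>n. cnj (a n))"
  by (simp add: fin_supp_def supp_def)

lemma fin_supp_zero [simp]: "fin_supp (\<lambda>n. 0)"
  by (simp add: fin_supp_def supp_def)

lemma fin_supp_unit [simp]: "k > 0 \<Longrightarrow> fin_supp (unit_seq k)"
  by (auto simp: fin_supp_def supp_def unit_seq_def intro: finite_subset[of _ "{k}"])

lemma fin_supp_restr [simp]: "fin_supp a \<Longrightarrow> fin_supp (restr A a)"
  by (auto simp: fin_supp_def supp_def restr_def intro: finite_subset[of _ "{n. a n \<noteq> 0}"])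

lemma fin_supp_restr_finite: "finite A \<Longrightarrow> a 0 = 0 \<Longrightarrow> fin_supp (restr A a)"
  by (auto simp: fin_supp_def supp_def restr_def intro: finite_subset[of _ A])

lemma fin_supp_bound: "fin_supp a \<Longrightarrow> \<exists>N. supp a \<subseteq> {..N}"
  unfolding fin_supp_def by (meson finite_nat_set_iff_bounded_le subsetI atMost_iff)

lemma fin_supp_sum_units:
  assumes "fin_supp a"
  shows "a = (\<lambda>i. \<Sum>n\<in>supp a. a n * unit_seq n i)"
proof
  fix i
  have "finite (supp a)" using assms by (simp add: fin_supp_def)
  then have "(\<Sum>n\<in>supp a. a n * unit_seq n i) = (if i \<in> supp a then a i else 0)"
    by (simp add: unit_seq_def if_distrib cong: if_cong)
  then show "a i = (\<Sum>n\<in>supp a. a n * unit_seq n i)" by (simp add: supp_def)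
qed

text \<open>Reduces additive and homogeneous statements to unit vectors. Since \<open>x\<close> may
  already be nonzero at \<open>n\<close>, the step never has to separate supports.\<close>

lemma fin_supp_induct [consumes 1, case_names zero step]:
  assumes "fin_supp a" and "P (\<lambda>n. 0)"
    and step: "\<And>x k n. fin_supp x \<Longrightarrow> P x \<Longrightarrow> n > 0 \<Longrightarrow> P (\<lambda>i. x i + k * unit_seq n i)"
  shows "P a"
proof -
  have fin: "finite (supp a)" and pos: "0 \<notin> supp a"
    using assms by (auto simp: fin_supp_def supp_def)
  have "fin_supp (\<lambda>i. \<Sum>n\<in>F. a n * unit_seq n i) \<and> P (\<lambda>i. \<Sum>n\<in>F. a n * unit_seq n i)"
    if "finite F" "0 \<notin> F" for F
    using that
  proof (induction F)
    case empty
    then show ?case using assms(2) by simp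
  next
    case (insert n F)
    then have n: "n > 0" by auto
    have eq: "(\<lambda>i. \<Sum>m\<in>insert n F. a m * unit_seq m i)
        = (\<lambda>i. (\<Sum>m\<in>F. a m * unit_seq m i) + a n * unit_seq n i)"
      using insert by (simp add: add.commute)
    show ?case unfolding eq using insert n step by simp
  qed
  from this[OF fin pos] show ?thesis using fin_supp_sum_units[OF assms(1)] by simp
qed

lemma fnorm_eq_L2_set:
  assumes "finite A" "supp a \<subseteq> A"
  shows "fnorm a = L2_set (\<lambda>n. cmod (a n)) A"
  unfolding fnorm_def L2_set_def using assms
  by (intro arg_cong[where f=sqrt] sum.mono_neutral_left) (auto simp: supp_def)

lemma fnorm_nonneg [simp]: "0 \<le> fnorm a"
  by (simp add: fnorm_def sum_nonneg)

lemma fnorm_sq: "finite A \<Longrightarrow> supp a \<subseteq> A \<Longrightarrow> (fnorm a)\<^sup>2 = (\<Sum>n\<in>A. (cmod (a n))\<^sup>2)"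
  by (simp add: fnorm_eq_L2_set L2_set_def sum_nonneg)

lemma fnorm_mult: "fnorm (\<lambda>n. k * a n) = cmod k * fnorm a"
proof (cases "k = 0")
  case True
  then show ?thesis by (simp add: fnorm_def supp_def)
next
  case False
  then have "supp (\<lambda>n. k * a n) = supp a" by (simp add: supp_def)
  then show ?thesis
    by (simp add: fnorm_def norm_mult power_mult_distrib real_sqrt_mult flip: sum_distrib_left)
qed

lemma fnorm_cnj [simp]: "fnorm (\<lambda>n. cnj (a n)) = fnorm a"
  by (simp add: fnorm_def supp_def)

lemma fnorm_unit [simp]: "fnorm (unit_seq k) = 1"
  by (subst fnorm_eq_L2_set[of "{k}"]) (auto simp: supp_def unit_seq_def L2_set_def)

lemma fnorm_zero [simp]: "fnorm (\<lambda>n. 0) = 0"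
  by (simp add: fnorm_def supp_def)

lemma fnorm_mono:
  assumes "fin_supp b" "\<And>n. cmod (a n) \<le> cmod (b n)"
  shows "fnorm a \<le> fnorm b"
proof -
  have "supp a \<subseteq> supp b"
    using assms(2) by (auto simp: supp_def) (metis norm_le_zero_iff norm_zero)
  moreover have "finite (supp b)" using assms by (simp add: fin_supp_def)
  ultimately show ?thesis
    by (simp add: fnorm_eq_L2_set[of "supp b"] L2_set_mono assms(2))
qed

lemma fnorm_triangle:
  assumes "fin_supp a" "fin_supp b"
  shows "fnorm (\<lambda>n. a n + b n) \<le> fnorm a + fnorm b"
proof -
  let ?A = "supp a \<union> supp b"
  have A: "finite ?A" using assms by (simp add: fin_supp_def)
  have "fnorm (\<lambda>n. a n + b n) = L2_set (\<lambda>n. cmod (a n + b n)) ?A"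
    using A by (intro fnorm_eq_L2_set) (auto simp: supp_def)
  also have "\<dots> \<le> L2_set (\<lambda>n. cmod (a n) + cmod (b n)) ?A"
    by (intro L2_set_mono norm_triangle_ineq) auto
  also have "\<dots> \<le> L2_set (\<lambda>n. cmod (a n)) ?A + L2_set (\<lambda>n. cmod (b n)) ?A"
    by (rule L2_set_triangle_ineq)
  finally show ?thesis using A by (simp add: fnorm_eq_L2_set[of ?A])
qed

text \<open>Pythagoras for a splitting of the coordinates; it supplies the hypotheses on squares in
  \<open>block_inequality\<close>.\<close>

lemma fnorm_restr_split:
  assumes "fin_supp a"
  shows "(fnorm a)\<^sup>2 = (fnorm (restr A a))\<^sup>2 + (fnorm (restr (- A) a))\<^sup>2"
proof -
  have fin: "finite (supp a)" using assms by (simp add: fin_supp_def)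
  have "(fnorm (restr A a))\<^sup>2 + (fnorm (restr (- A) a))\<^sup>2
      = (\<Sum>n\<in>supp a. (cmod (restr A a n))\<^sup>2) + (\<Sum>n\<in>supp a. (cmod (restr (- A) a n))\<^sup>2)"
    using fin by (intro arg_cong2[where f="(+)"] fnorm_sq) (auto simp: supp_def restr_def)
  also have "\<dots> = (\<Sum>n\<in>supp a. (cmod (a n))\<^sup>2)"
    unfolding sum.distrib[symmetric] by (intro sum.cong) (auto simp: restr_def)
  finally show ?thesis using fnorm_sq[OF fin] by simp
qed

lemma hform_eq:
  assumes "finite A" "supp a \<subseteq> A" "finite B" "supp b \<subseteq> B"
  shows "hform \<alpha> a b = (\<Sum>n\<in>A. \<Sum>m\<in>B. a n * cnj (b m) * \<alpha> (n * m))"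
proof -
  have "hform \<alpha> a b = (\<Sum>n\<in>supp a. \<Sum>m\<in>B. a n * cnj (b m) * \<alpha> (n * m))"
    unfolding hform_def using assms
    by (intro sum.cong refl sum.mono_neutral_left) (auto simp: supp_def)
  also have "\<dots> = (\<Sum>n\<in>A. \<Sum>m\<in>B. a n * cnj (b m) * \<alpha> (n * m))"
    using assms by (intro sum.mono_neutral_left) (auto simp: supp_def)
  finally show ?thesis .
qed

lemma hform_add_symbol: "hform (\<lambda>n. \<alpha> n + \<beta> n) a b = hform \<alpha> a b + hform \<beta> a b"
  by (simp add: hform_def ring_distribs sum.distrib)

lemma hform_diff_symbol: "hform (\<lambda>n. \<alpha> n - \<beta> n) a b = hform \<alpha> a b - hform \<beta> a b"
  by (simp add: hform_def ring_distribs sum_subtractf)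

lemma hform_mult_symbol: "hform (\<lambda>n. k * \<alpha> n) a b = k * hform \<alpha> a b"
  by (simp add: hform_def sum_distrib_left mult_ac)

lemma hform_diff_left:
  assumes "fin_supp a" "fin_supp a'" "fin_supp b"
  shows "hform \<alpha> (\<lambda>n. a n - a' n) b = hform \<alpha> a b - hform \<alpha> a' b"
proof -
  let ?A = "supp a \<union> supp a'"
  have "finite ?A" "finite (supp b)" using assms by (simp_all add: fin_supp_def)
  moreover have "supp (\<lambda>n. a n - a' n) \<subseteq> ?A" by (auto simp: supp_def)
  ultimately show ?thesis
    by (simp add: hform_eq[of ?A _ "supp b" b] ring_distribs sum_subtractf)
qed

text \<open>The symbol is evaluated at \<open>n * m\<close>, which is symmetric, so conjugating both
  vectors exchanges the slots. Statements about one slot carry over to the other in this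
  way.\<close>

lemma hform_cnj_swap:
  assumes "fin_supp a" "fin_supp b"
  shows "hform \<alpha> a b = hform \<alpha> (\<lambda>n. cnj (b n)) (\<lambda>n. cnj (a n))"
proof -
  have "supp (\<lambda>n. cnj (b n)) = supp b" "supp (\<lambda>n. cnj (a n)) = supp a" by (auto simp: supp_def)
  then have "hform \<alpha> (\<lambda>n. cnj (b n)) (\<lambda>n. cnj (a n))
      = (\<Sum>m\<in>supp b. \<Sum>n\<in>supp a. cnj (b m) * a n * \<alpha> (m * n))"
    by (simp add: hform_def)
  also have "\<dots> = hform \<alpha> a b"
    unfolding hform_def by (subst sum.swap) (simp add: mult.commute)
  finally show ?thesis by simp
qed

lemma hform_diff_right:
  assumes "fin_supp a" "fin_supp b" "fin_supp b'"
  shows "hform \<alpha> a (\<lambda>n. b n - b' n) = hform \<alpha> a b - hform \<alpha> a b'"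
  using hform_diff_left[of "\<lambda>n. cnj (b n)" "\<lambda>n. cnj (b' n)" "\<lambda>n. cnj (a n)" \<alpha>] assms
  by (simp add: hform_cnj_swap[of a])

lemma hform_unit: "hform \<alpha> (unit_seq n) (unit_seq m) = \<alpha> (n * m)"
  by (subst hform_eq[of "{n}" _ "{m}"]) (auto simp: supp_def unit_seq_def)

lemma hform_tendsto:
  assumes "\<And>n. (\<lambda>j. f j n) \<longlonglongrightarrow> \<alpha> n"
  shows "(\<lambda>j. hform (f j) a b) \<longlonglongrightarrow> hform \<alpha> a b"
  unfolding hform_def by (intro tendsto_sum tendsto_mult tendsto_const assms)

text \<open>An explicit bound is easier to add, scale and pass to limits than the infimum
  \<open>hnorm\<close>, which enters only through \<open>hnorm_le\<close> and
  \<open>hle_hnorm\<close>.\<close>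

definition hle :: "seq \<Rightarrow> real \<Rightarrow> bool" where
  "hle \<alpha> C \<longleftrightarrow> (\<forall>a b. fin_supp a \<longrightarrow> fin_supp b \<longrightarrow> cmod (hform \<alpha> a b) \<le> C * fnorm a * fnorm b)"

lemma hleD: "hle \<alpha> C \<Longrightarrow> fin_supp a \<Longrightarrow> fin_supp b \<Longrightarrow> cmod (hform \<alpha> a b) \<le> C * fnorm a * fnorm b"
  by (simp add: hle_def)

lemma hle_mono: "hle \<alpha> C \<Longrightarrow> C \<le> D \<Longrightarrow> hle \<alpha> D"
  unfolding hle_def by (meson fnorm_nonneg mult_right_mono order_trans)

text \<open>The unit vectors at 1 and \<open>n\<close> pick out the coefficient at
  \<open>1 * n\<close>. Test vectors vanish at 0, so a bound on the form says nothing about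
  \<open>\<alpha> 0\<close>.\<close>

lemma hle_coeff:
  assumes "hle \<alpha> C" "n > 0"
  shows "cmod (\<alpha> n) \<le> C"
  using hleD[OF assms(1), of "unit_seq 1" "unit_seq n"] assms(2) by (simp add: hform_unit)

lemma hle_nonneg: "hle \<alpha> C \<Longrightarrow> 0 \<le> C"
  using hle_coeff[of \<alpha> C 1] by (smt (verit) norm_ge_zero zero_less_one)

lemma hle_add: "hle \<alpha> C \<Longrightarrow> hle \<beta> D \<Longrightarrow> hle (\<lambda>n. \<alpha> n + \<beta> n) (C + D)"
  unfolding hle_def hform_add_symbol ring_distribs by (meson add_mono norm_triangle_mono)

lemma hle_mult: "hle \<alpha> C \<Longrightarrow> hle (\<lambda>n. k * \<alpha> n) (cmod k * C)"
  unfolding hle_def hform_mult_symbol norm_mult by (simp add: mult.assoc mult_left_mono)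

lemma hle_diff: "hle \<alpha> C \<Longrightarrow> hle \<beta> D \<Longrightarrow> hle (\<lambda>n. \<alpha> n - \<beta> n) (C + D)"
  using hle_add[of \<alpha> C "\<lambda>n. - 1 * \<beta> n" D] hle_mult[of \<beta> D "-1"] by simp

text \<open>For fixed finitely supported vectors the form is a finite sum, so pointwise convergence
  of symbols is enough. This semicontinuity recovers bounds on non-compact symbols from bounds on
  approximants.\<close>

lemma hle_tendsto:
  assumes "\<And>n. (\<lambda>j. f j n) \<longlonglongrightarrow> \<alpha> n" and "C \<longlonglongrightarrow> c"
    and "\<forall>\<^sub>F j in sequentially. hle (f j) (C j)"
  shows "hle \<alpha> c"
  unfolding hle_def
proof (intro allI impI)
  fix a b assume ab: "fin_supp a" "fin_supp b"
  have "(\<lambda>j. cmod (hform (f j) a b)) \<longlonglongrightarrow> cmod (hform \<alpha> a b)"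
    by (intro tendsto_norm hform_tendsto assms(1))
  moreover have "(\<lambda>j. C j * fnorm a * fnorm b) \<longlonglongrightarrow> c * fnorm a * fnorm b"
    by (intro tendsto_mult tendsto_const assms(2))
  moreover have "\<forall>\<^sub>F j in sequentially. cmod (hform (f j) a b) \<le> C j * fnorm a * fnorm b"
    using assms(3) by eventually_elim (simp add: hleD ab)
  ultimately show "cmod (hform \<alpha> a b) \<le> c * fnorm a * fnorm b"
    by (intro tendsto_le[OF sequentially_bot])
qed

lemma hle_epsilon:
  assumes "\<And>\<eta>. \<eta> > 0 \<Longrightarrow> hle \<alpha> (C + \<eta>)"
  shows "hle \<alpha> C"
proof (rule hle_tendsto[of "\<lambda>_. \<alpha>"])
  show "(\<lambda>n. C + inverse (real (Suc n))) \<longlonglongrightarrow> C"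
    using tendsto_add[OF tendsto_const LIMSEQ_inverse_real_of_nat, of C] by simp
  show "\<forall>\<^sub>F n in sequentially. hle \<alpha> (C + inverse (real (Suc n)))"
    by (intro always_eventually allI assms) simp
qed simp

lemma Mb_iff: "\<alpha> \<in> Mb \<longleftrightarrow> \<alpha> 0 = 0 \<and> (\<exists>C. hle \<alpha> C)"
  by (simp add: Mb_def hbounded_def hle_def)

lemma hnorm_eq_Inf: "hnorm \<alpha> = Inf {C. hle \<alpha> C}"
proof -
  have "{C. 0 \<le> C \<and> (\<forall>a b. fin_supp a \<longrightarrow> fin_supp b \<longrightarrow>
      cmod (hform \<alpha> a b) \<le> C * fnorm a * fnorm b)} = {C. hle \<alpha> C}"
    using hle_nonneg[of \<alpha>] unfolding hle_def by blast
  then show ?thesis by (simp add: hnorm_def)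
qed

lemma hnorm_le: "hle \<alpha> C \<Longrightarrow> hnorm \<alpha> \<le> C"
  unfolding hnorm_eq_Inf using hle_nonneg by (intro cInf_lower) (auto simp: bdd_below_def)

text \<open>The admissible bounds form a closed set, so their infimum is itself admissible.\<close>

lemma hle_hnorm:
  assumes "\<alpha> \<in> Mb"
  shows "hle \<alpha> (hnorm \<alpha>)"
proof -
  have ne: "{C. hle \<alpha> C} \<noteq> {}" using assms by (auto simp: Mb_iff)
  show ?thesis
  proof (rule hle_epsilon)
    fix \<eta> :: real assume "\<eta> > 0"
    then have "\<exists>C. hle \<alpha> C \<and> C < hnorm \<alpha> + \<eta>"
      using cInf_lessD[OF ne, of "hnorm \<alpha> + \<eta>"] unfolding hnorm_eq_Inf by auto
    then show "hle \<alpha> (hnorm \<alpha> + \<eta>)" by (meson hle_mono less_imp_le)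
  qed
qed

lemma hnorm_nonneg: "\<alpha> \<in> Mb \<Longrightarrow> 0 \<le> hnorm \<alpha>"
  using hle_hnorm hle_nonneg by blast

lemma Mb_coeff_le: "\<alpha> \<in> Mb \<Longrightarrow> cmod (\<alpha> n) \<le> hnorm \<alpha>"
  by (cases "n = 0") (use hle_coeff[OF hle_hnorm] hnorm_nonneg in \<open>auto simp: Mb_iff\<close>)

lemma hle_0_imp_zero: "hle \<alpha> 0 \<Longrightarrow> n > 0 \<Longrightarrow> \<alpha> n = 0"
  using hle_coeff by fastforce

lemma Mb_add: "\<alpha> \<in> Mb \<Longrightarrow> \<beta> \<in> Mb \<Longrightarrow> (\<lambda>n. \<alpha> n + \<beta> n) \<in> Mb"
  unfolding Mb_iff by (auto intro: hle_add)

lemma Mb_mult: "\<alpha> \<in> Mb \<Longrightarrow> (\<lambda>n. k * \<alpha> n) \<in> Mb"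
  unfolding Mb_iff by (auto intro: hle_mult)

lemma Mb_diff: "\<alpha> \<in> Mb \<Longrightarrow> \<beta> \<in> Mb \<Longrightarrow> (\<lambda>n. \<alpha> n - \<beta> n) \<in> Mb"
  unfolding Mb_iff by (auto intro: hle_diff)

lemma hnorm_mult:
  assumes "\<alpha> \<in> Mb"
  shows "hnorm (\<lambda>n. k * \<alpha> n) \<le> cmod k * hnorm \<alpha>"
  by (intro hnorm_le hle_mult hle_hnorm assms)

text \<open>On the fibre \<open>n m = i\<close> the form is a partial permutation of coordinates, hence a
  contraction; this sums to the bound by the l1 norm of the symbol.\<close>
lemma hle_l1:
  assumes \<gamma>0: "\<gamma> 0 = 0" and sum: "summable (\<lambda>n. cmod (\<gamma> n))"
  shows "hle \<gamma> (\<Sum>n. cmod (\<gamma> n))"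
  unfolding hle_def
proof (intro allI impI)
  fix a b assume ab: "fin_supp a" "fin_supp b"
  have fin: "finite (supp a)" "finite (supp b)" using ab by (auto simp: fin_supp_def)
  let ?S = "supp a \<times> supp b"
  let ?I = "(\<lambda>(n, m). n * m) ` ?S"
  have pos: "n > 0" if "n \<in> supp a \<or> n \<in> supp b" for n
    using that ab by (cases n) (auto simp: fin_supp_def supp_def)
  have fibre: "(\<Sum>(n, m)\<in>{x \<in> ?S. (\<lambda>(n, m). n * m) x = i}. cmod (a n) * cmod (b m)) \<le> fnorm a * fnorm b"
    for i
  proof -
    let ?F = "{x \<in> ?S. (\<lambda>(n, m). n * m) x = i}"
    have fF: "finite ?F" using fin by simp
    have "(\<Sum>(n, m)\<in>?F. cmod (a n) * cmod (b m))
        \<le> L2_set (\<lambda>x. cmod (a (fst x))) ?F * L2_set (\<lambda>x. cmod (b (snd x))) ?F"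
      using L2_set_mult_ineq[of "\<lambda>x. cmod (a (fst x))" "\<lambda>x. cmod (b (snd x))" ?F]
      by (simp add: case_prod_beta)
    also have "L2_set (\<lambda>x. cmod (a (fst x))) ?F = L2_set (\<lambda>n. cmod (a n)) (fst ` ?F)"
    proof -
      \<comment> \<open>All indices in the supports are positive, so on the fibre over
        \<open>i\<close> either factor determines the other.\<close>
      have "inj_on fst ?F" using pos by (fastforce simp: inj_on_def)
      then show ?thesis by (simp add: L2_set_def sum.reindex)
    qed
    also have "L2_set (\<lambda>x. cmod (b (snd x))) ?F = L2_set (\<lambda>n. cmod (b n)) (snd ` ?F)"
    proof -
      have "inj_on snd ?F" using pos by (fastforce simp: inj_on_def)
      then show ?thesis by (simp add: L2_set_def sum.reindex)
    qed
    also have "L2_set (\<lambda>n. cmod (a n)) (fst ` ?F) \<le> fnorm a"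
      unfolding L2_set_def fnorm_def using fin
      by (intro real_sqrt_le_mono sum_mono2) auto
    also have "L2_set (\<lambda>n. cmod (b n)) (snd ` ?F) \<le> fnorm b"
      unfolding L2_set_def fnorm_def using fin
      by (intro real_sqrt_le_mono sum_mono2) auto
    finally show ?thesis by (simp add: mult_left_mono mult_right_mono)
  qed
  have "cmod (hform \<gamma> a b) \<le> (\<Sum>n\<in>supp a. \<Sum>m\<in>supp b. cmod (a n * cnj (b m) * \<gamma> (n * m)))"
    unfolding hform_def by (intro order_trans[OF norm_sum] sum_mono norm_sum)
  also have "\<dots> = (\<Sum>(n, m)\<in>?S. cmod (\<gamma> (n * m)) * (cmod (a n) * cmod (b m)))"
    unfolding sum.cartesian_product by (intro sum.cong) (auto simp: norm_mult)
  also have "\<dots> = (\<Sum>i\<in>?I. \<Sum>(n, m)\<in>{x \<in> ?S. (\<lambda>(n, m). n * m) x = i}.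
      cmod (\<gamma> (n * m)) * (cmod (a n) * cmod (b m)))"
    using fin by (intro sum.group[symmetric]) auto
  also have "\<dots> = (\<Sum>i\<in>?I. cmod (\<gamma> i) *
      (\<Sum>(n, m)\<in>{x \<in> ?S. (\<lambda>(n, m). n * m) x = i}. cmod (a n) * cmod (b m)))"
    unfolding sum_distrib_left by (intro sum.cong refl) auto
  also have "\<dots> \<le> (\<Sum>i\<in>?I. cmod (\<gamma> i) * (fnorm a * fnorm b))"
    by (intro sum_mono mult_left_mono fibre) auto
  also have "\<dots> \<le> (\<Sum>n. cmod (\<gamma> n)) * (fnorm a * fnorm b)"
    unfolding sum_distrib_right[symmetric] using fin
    by (intro mult_right_mono sum_le_suminf sum) auto
  finally show "cmod (hform \<gamma> a b) \<le> (\<Sum>n. cmod (\<gamma> n)) * fnorm a * fnorm b"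
    by (simp add: mult.assoc)
qed

lemma fin_supp_Mb:
  assumes "fin_supp z"
  shows "z \<in> Mb"
proof -
  have "summable (\<lambda>n. cmod (z n))"
    using assms by (intro summable_finite[of "supp z"]) (auto simp: fin_supp_def supp_def)
  with assms show ?thesis unfolding Mb_iff using hle_l1[of z] by (auto simp: fin_supp_def)
qed

section \<open>Completely multiplicative weights\<close>

text \<open>For \<open>n > 0\<close> this is \<open>s\<close> to the number of prime factors of
  \<open>n\<close> with multiplicity if all of them are at most \<open>K\<close>, and 0 otherwise.
  Index 0 needs its own clause because \<open>prime_factorization 0\<close> is empty and would give
  the value 1.\<close>

definition smooth_weight :: "real \<Rightarrow> nat \<Rightarrow> nat \<Rightarrow> real" where
  "smooth_weight s K n = (if n = 0 then 0 else
     \<Prod>p\<in>#prime_factorization n. if p \<le> K then s else 0)"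

lemma smooth_weight_mult:
  "smooth_weight s K (m * n) = smooth_weight s K m * smooth_weight s K n"
  by (cases "m = 0 \<or> n = 0") (auto simp: smooth_weight_def prime_factorization_mult)

lemma prod_mset_unit_interval:
  fixes f :: "'a \<Rightarrow> real"
  assumes "\<And>x. 0 \<le> f x" "\<And>x. f x \<le> 1"
  shows "0 \<le> (\<Prod>x\<in>#M. f x) \<and> (\<Prod>x\<in>#M. f x) \<le> 1"
  by (induction M) (auto simp: assms mult_le_one)

lemma smooth_weight_bounds:
  assumes "0 \<le> s" "s \<le> 1"
  shows "0 \<le> smooth_weight s K n" "smooth_weight s K n \<le> 1"
  using prod_mset_unit_interval[of "\<lambda>p. if p \<le> K then s else 0" "prime_factorization n"] assms
  by (auto simp: smooth_weight_def)

lemma smooth_weight_Suc_eq: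
  assumes "n > 0" "\<not> (prime (Suc K) \<and> Suc K dvd n)"
  shows "smooth_weight s (Suc K) n = smooth_weight s K n"
proof -
  have "image_mset (\<lambda>p. if p \<le> Suc K then s else 0) (prime_factorization n)
      = image_mset (\<lambda>p. if p \<le> K then s else 0) (prime_factorization n)"
    using assms by (intro image_mset_cong) (auto simp: prime_factors_dvd le_Suc_eq)
  then show ?thesis by (simp add: smooth_weight_def)
qed

lemma smooth_weight_prime_power:
  assumes "prime p" "p \<le> K"
  shows "smooth_weight s K (p ^ i) = s ^ i"
  using assms by (simp add: smooth_weight_def prime_factorization_prime_power)

text \<open>Euler product: each prime contributes one geometric series.\<close>
lemma sum_smooth_weight_le:
  assumes s: "0 \<le> s" "s < 1" and "finite F" "0 \<notin> F"
  shows "(\<Sum>n\<in>F. smooth_weight s K n) \<le> (1 / (1 - s)) ^ K"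
  using assms(3,4)
proof (induction K arbitrary: F)
  case 0
  \<comment> \<open>No prime is at most 0, so only the empty product at \<open>n = 1\<close>
    survives.\<close>
  have "smooth_weight s 0 n = (if n = 1 then 1 else 0)" if "n \<in> F" for n
  proof (cases "n = 1")
    case False
    with that 0 have "n > 1" by (metis less_one linorder_neqE_nat)
    then obtain p where p: "p \<in># prime_factorization n"
      using prime_factor_nat[of n] by (auto simp: in_prime_factors_iff)
    then have "prime p" by blast
    then have "p > 0" by (rule prime_gt_0_nat)
    from multi_member_split[OF p] obtain M where "prime_factorization n = add_mset p M" by blast
    with \<open>p > 0\<close> False \<open>n > 1\<close> show ?thesis by (simp add: smooth_weight_def)
  qed (simp add: smooth_weight_def)
  then have "(\<Sum>n\<in>F. smooth_weight s 0 n) = (\<Sum>n\<in>F. if n = 1 then 1 else 0)" by simp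
  also have "\<dots> \<le> 1" using 0 by simp
  finally show ?case by simp
next
  case (Suc K)
  \<comment> \<open>The bound spends one factor on every integer up to \<open>K\<close>, prime or
    not; for a composite \<open>Suc K\<close> the additional factor is at least 1 and does no
    harm.\<close>
  have geq1: "1 \<le> 1 / (1 - s)" using s by simp
  show ?case
  proof (cases "prime (Suc K)")
    case False
    then have "(\<Sum>n\<in>F. smooth_weight s (Suc K) n) = (\<Sum>n\<in>F. smooth_weight s K n)"
      using Suc by (intro sum.cong refl smooth_weight_Suc_eq) (auto intro: gr0I)
    also have "\<dots> \<le> (1 / (1 - s)) ^ K" using Suc by auto
    also have "\<dots> \<le> (1 / (1 - s)) ^ Suc K" using geq1 by (intro power_increasing) auto
    finally show ?thesis .
  next
    case True
    let ?q = "Suc K"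
    define e where "e n = multiplicity ?q n" for n
    define c where "c n = n div ?q ^ e n" for n
    have pos: "n > 0" if "n \<in> F" for n using that Suc by (auto intro: gr0I)
    have dec: "n = ?q ^ e n * c n" for n
      unfolding e_def c_def by (simp add: multiplicity_dvd)
    have cop: "\<not> ?q dvd c n" if "n \<in> F" for n
      unfolding e_def c_def using pos[OF that] True
      by (intro multiplicity_decompose) (auto dest: prime_gt_1_nat)
    have cpos: "c n > 0" if "n \<in> F" for n
      using dec[of n] pos[OF that] by (metis gr0I mult_0_right)
    have w: "smooth_weight s ?q n = s ^ e n * smooth_weight s K (c n)" if "n \<in> F" for n
      by (subst dec[of n])
        (simp only: smooth_weight_mult smooth_weight_prime_power[OF True order_refl]
          smooth_weight_Suc_eq[OF cpos[OF that]] cop[OF that] simp_thms)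
    obtain I where I: "e ` F \<subseteq> {..<I}"
      using Suc.prems by (metis finite_imageI finite_nat_iff_bounded)
    \<comment> \<open>The exponent of \<open>?q\<close> and the remaining cofactor recover
      \<open>n\<close>. The sum thus embeds into a full rectangle of pairs, where it factors into a
      geometric sum and a sum for \<open>K\<close>.\<close>
    have inj: "inj_on (\<lambda>n. (e n, c n)) F"
      by (rule inj_onI) (metis dec prod.inject)
    have "(\<Sum>n\<in>F. smooth_weight s ?q n) = (\<Sum>(i, m)\<in>(\<lambda>n. (e n, c n)) ` F. s ^ i * smooth_weight s K m)"
      using w by (simp add: sum.reindex[OF inj])
    also have "\<dots> \<le> (\<Sum>(i, m)\<in>{..<I} \<times> c ` F. s ^ i * smooth_weight s K m)"
      using I Suc.prems s by (intro sum_mono2) (auto simp: smooth_weight_bounds)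
    also have "\<dots> = (\<Sum>i<I. s ^ i) * (\<Sum>m\<in>c ` F. smooth_weight s K m)"
      by (simp add: sum_product sum.cartesian_product)
    also have "\<dots> \<le> (1 / (1 - s)) * (1 / (1 - s)) ^ K"
    proof (intro mult_mono)
      have "(\<Sum>i<I. s ^ i) \<le> (\<Sum>i. s ^ i)"
        using s by (intro sum_le_suminf summable_geometric) auto
      then show "(\<Sum>i<I. s ^ i) \<le> 1 / (1 - s)" using s by (simp add: suminf_geometric)
      show "(\<Sum>m\<in>c ` F. smooth_weight s K m) \<le> (1 / (1 - s)) ^ K"
        using Suc.prems by (intro Suc.IH) (auto dest!: cpos)
    qed (use s in \<open>auto intro!: sum_nonneg simp: smooth_weight_bounds\<close>)
    finally show ?thesis by simp
  qed
qed

definition weight :: "nat \<Rightarrow> nat \<Rightarrow> real" where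
  "weight j = smooth_weight (real j / real (Suc j)) j"

lemma weight_0 [simp]: "weight j 0 = 0"
  by (simp add: weight_def smooth_weight_def)

lemma weight_mult: "weight j (m * n) = weight j m * weight j n"
  by (simp add: weight_def smooth_weight_mult)

lemma weight_nonneg [simp]: "0 \<le> weight j n" and weight_le_1 [simp]: "weight j n \<le> 1"
  unfolding weight_def by (intro smooth_weight_bounds; simp)+

lemma summable_weight: "summable (weight j)"
proof (rule summableI_nonneg_bounded)
  fix N
  let ?s = "real j / real (Suc j)"
  have "(\<Sum>n<N. weight j n) = (\<Sum>n\<in>{..<N} - {0}. smooth_weight ?s j n)"
    unfolding weight_def by (intro sum.mono_neutral_right) (auto simp: smooth_weight_def)
  also have "\<dots> \<le> (1 / (1 - ?s)) ^ j"
    by (intro sum_smooth_weight_le) auto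
  finally show "(\<Sum>n<N. weight j n) \<le> (1 / (1 - ?s)) ^ j" .
qed simp

lemma weight_tendsto:
  assumes "n > 0"
  shows "(\<lambda>j. weight j n) \<longlonglongrightarrow> 1"
proof -
  let ?k = "size (prime_factorization n)"
  have "(\<lambda>j. (real j / real (Suc j)) ^ ?k) \<longlonglongrightarrow> 1 ^ ?k"
    by (intro tendsto_power LIMSEQ_n_over_Suc_n)
  moreover have "\<forall>\<^sub>F j in sequentially. (real j / real (Suc j)) ^ ?k = weight j n"
    using eventually_ge_at_top[of n]
  proof eventually_elim
    case (elim j)
    have "image_mset (\<lambda>p. if p \<le> j then real j / real (Suc j) else 0) (prime_factorization n)
        = image_mset (\<lambda>p. real j / real (Suc j)) (prime_factorization n)"
      using elim assms by (intro image_mset_cong) (auto simp: prime_factors_dvd dest: dvd_imp_le)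
    then show ?case using assms unfolding weight_def smooth_weight_def by (simp del: of_nat_Suc)
  qed
  ultimately show ?thesis by (simp add: filterlim_cong)
qed

section \<open>Damping of sequences and symbols\<close>

definition damp :: "nat \<Rightarrow> seq \<Rightarrow> seq" where
  "damp j a = (\<lambda>n. of_real (weight j n) * a n)"

lemma fin_supp_damp [simp]: "fin_supp a \<Longrightarrow> fin_supp (damp j a)"
  by (simp add: damp_def)

lemma fnorm_damp_le: "fin_supp a \<Longrightarrow> fnorm (damp j a) \<le> fnorm a"
  by (rule fnorm_mono) (auto simp: damp_def norm_mult mult_left_le_one_le)

lemma cmod_diff_damp_le: "cmod (a n - damp j a n) \<le> cmod (a n)"
proof -
  have "a n - damp j a n = of_real (1 - weight j n) * a n"
    by (simp add: damp_def algebra_simps)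
  then have "cmod (a n - damp j a n) = \<bar>1 - weight j n\<bar> * cmod (a n)"
    by (simp only: norm_mult norm_of_real)
  also have "\<dots> \<le> 1 * cmod (a n)"
    by (intro mult_right_mono) (auto simp: abs_le_iff intro: order_trans[OF weight_le_1])
  finally show ?thesis by simp
qed

lemma damp_tendsto:
  assumes "a 0 = 0"
  shows "(\<lambda>j. damp j a n) \<longlonglongrightarrow> a n"
proof (cases "n = 0")
  case False
  then have "(\<lambda>j. of_real (weight j n) * a n) \<longlonglongrightarrow> of_real 1 * a n"
    by (intro tendsto_mult tendsto_of_real weight_tendsto) auto
  then show ?thesis by (simp add: damp_def)
qed (simp add: damp_def assms)

text \<open>This is where complete multiplicativity of the weight is used.\<close>
lemma hform_damp:
  assumes "fin_supp a" "fin_supp b"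
  shows "hform (damp j \<alpha>) a b = hform \<alpha> (damp j a) (damp j b)"
proof -
  have "finite (supp a)" "finite (supp b)" using assms by (auto simp: fin_supp_def)
  moreover have "supp (damp j a) \<subseteq> supp a" "supp (damp j b) \<subseteq> supp b"
    by (auto simp: supp_def damp_def)
  ultimately have "hform \<alpha> (damp j a) (damp j b)
      = (\<Sum>n\<in>supp a. \<Sum>m\<in>supp b. damp j a n * cnj (damp j b m) * \<alpha> (n * m))"
    by (intro hform_eq)
  also have "\<dots> = hform (damp j \<alpha>) a b"
    unfolding hform_def by (intro sum.cong refl) (simp add: damp_def weight_mult mult_ac)
  finally show ?thesis by simp
qed

lemma hle_damp:
  assumes "hle \<alpha> C"
  shows "hle (damp j \<alpha>) C"
  unfolding hle_def
proof (intro allI impI)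
  fix a b assume ab: "fin_supp a" "fin_supp b"
  have "cmod (hform (damp j \<alpha>) a b) \<le> C * fnorm (damp j a) * fnorm (damp j b)"
    unfolding hform_damp[OF ab] by (intro hleD[OF assms]) (simp_all add: ab)
  also have "\<dots> \<le> C * fnorm a * fnorm b"
    using hle_nonneg[OF assms] by (intro mult_mono fnorm_damp_le ab) auto
  finally show "cmod (hform (damp j \<alpha>) a b) \<le> C * fnorm a * fnorm b" .
qed

lemma damp_Mb: "\<alpha> \<in> Mb \<Longrightarrow> damp j \<alpha> \<in> Mb"
  unfolding Mb_iff using hle_damp by (auto simp: damp_def)

text \<open>Damping the symbol damps both vectors, and the difference telescopes one slot at a time.
  Each term then contains a vector \<open>x - damp j x\<close>, which is small on low
  indices.\<close>

lemma hform_diff_damp: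
  assumes "fin_supp a" "fin_supp b"
  shows "hform (\<lambda>n. \<alpha> n - damp j \<alpha> n) a b
    = hform \<alpha> (\<lambda>n. a n - damp j a n) b + hform \<alpha> (damp j a) (\<lambda>n. b n - damp j b n)"
  using assms by (simp add: hform_diff_symbol hform_damp hform_diff_left hform_diff_right)

text \<open>The factor \<open>1 - weight j n\<close> is at most \<open>\<epsilon>\<close> up to
  \<open>N\<close> and at most 1 beyond.\<close>

lemma fnorm_diff_damp_le:
  assumes a: "fin_supp a" and "0 \<le> \<epsilon>" and w: "\<And>n. n \<le> N \<Longrightarrow> n > 0 \<Longrightarrow> 1 - weight j n \<le> \<epsilon>"
  shows "fnorm (\<lambda>n. a n - damp j a n) \<le> \<epsilon> * fnorm a + fnorm (restr (- {..N}) a)"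
proof -
  have eq: "a n - damp j a n = of_real (1 - weight j n) * a n" for n
    by (simp add: damp_def algebra_simps)
  let ?d = "\<lambda>n. a n - damp j a n"
  have "?d = (\<lambda>n. restr {..N} ?d n + restr (- {..N}) ?d n)" by (auto simp: restr_def)
  then have "fnorm ?d \<le> fnorm (restr {..N} ?d) + fnorm (restr (- {..N}) ?d)"
    using fnorm_triangle[of "restr {..N} ?d" "restr (- {..N}) ?d"] a by simp
  also have "fnorm (restr {..N} ?d) \<le> fnorm (\<lambda>n. of_real \<epsilon> * a n)"
  proof (rule fnorm_mono)
    fix n
    show "cmod (restr {..N} ?d n) \<le> cmod (of_real \<epsilon> * a n)"
    proof (cases "n > 0 \<and> n \<le> N")
      case True
      then have "\<bar>1 - weight j n\<bar> * cmod (a n) \<le> \<epsilon> * cmod (a n)"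
        using w[of n] by (intro mult_right_mono) auto
      moreover have "restr {..N} ?d n = of_real (1 - weight j n) * a n"
        using True eq[of n] by (simp add: restr_def)
      ultimately show ?thesis using assms(2) by (simp only: norm_mult norm_of_real abs_of_nonneg)
    qed (use a in \<open>auto simp: restr_def damp_def fin_supp_def\<close>)
  qed (simp add: a)
  also have "\<dots> = \<epsilon> * fnorm a" using assms(2) by (simp add: fnorm_mult)
  also have "fnorm (restr (- {..N}) ?d) \<le> fnorm (restr (- {..N}) a)"
    by (rule fnorm_mono[OF fin_supp_restr[OF a]]) (simp add: restr_def cmod_diff_damp_le)
  finally show ?thesis by simp
qed

section \<open>Perturbing a finitely supported symbol by a damped difference\<close>

text \<open>Normalise to \<open>A = B = 1\<close>. Then \<open>u * v\<close> is at most the mean of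
  the squares, which leaves \<open>C\<close> minus \<open>C / 2\<close> times the squares of
  \<open>u'\<close> and \<open>v'\<close>. This loss pays for the linear terms: completing the
  square bounds each of \<open>G * u'\<close> and \<open>G * v'\<close> by its share of the loss
  plus \<open>G\<^sup>2 / (2 * C)\<close>.\<close>

lemma block_inequality:
  fixes A B :: real
  assumes "C > 0" "0 \<le> A" "0 \<le> B" "0 \<le> A1" "0 \<le> A2" "0 \<le> B1" "0 \<le> B2"
    and A: "A\<^sup>2 = A1\<^sup>2 + A2\<^sup>2" and B: "B\<^sup>2 = B1\<^sup>2 + B2\<^sup>2"
  shows "C * A1 * B1 + G * A2 * B + G * A * B2 \<le> (C + G\<^sup>2 / C) * A * B"
proof (cases "A = 0 \<or> B = 0")
  case True
  then have "A1 = 0 \<and> A2 = 0 \<and> A = 0 \<or> B1 = 0 \<and> B2 = 0 \<and> B = 0"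
    using A B by (auto simp: sum_power2_eq_zero_iff)
  then show ?thesis by auto
next
  case False
  then have pos: "A > 0" "B > 0" using assms by auto
  define u u' v v' where "u = A1 / A" and "u' = A2 / A" and "v = B1 / B" and "v' = B2 / B"
  have eqs: "A1 = u * A" "A2 = u' * A" "B1 = v * B" "B2 = v' * B"
    using pos by (simp_all add: u_def u'_def v_def v'_def)
  have u: "u\<^sup>2 = 1 - u'\<^sup>2" and v: "v\<^sup>2 = 1 - v'\<^sup>2"
    using pos unfolding u_def u'_def v_def v'_def power_divide eq_diff_eq add_divide_distrib[symmetric]
      A[symmetric] B[symmetric] by simp_all
  have "2 * (u * v) \<le> u\<^sup>2 + v\<^sup>2" using sum_squares_bound[of u v] by simp
  then have "C * (u * v) \<le> C * ((u\<^sup>2 + v\<^sup>2) / 2)"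
    using assms(1) by (intro mult_left_mono) auto
  moreover have "G * w \<le> C / 2 * w\<^sup>2 + G\<^sup>2 / (2 * C)" for w
  proof -
    have "0 \<le> (C * w - G)\<^sup>2 / (2 * C)" using assms(1) by simp
    also have "\<dots> = C / 2 * w\<^sup>2 + G\<^sup>2 / (2 * C) - G * w"
      using assms(1) by (simp add: power2_eq_square field_simps)
    finally show ?thesis by simp
  qed
  note this[of u'] this[of v']
  ultimately have "C * (u * v) + G * u' + G * v' \<le> C + G\<^sup>2 / C"
    unfolding u v by (simp add: field_simps)
  then have "(C * (u * v) + G * u' + G * v') * (A * B) \<le> (C + G\<^sup>2 / C) * (A * B)"
    using pos by (intro mult_right_mono) auto
  then show ?thesis unfolding eqs by (simp add: algebra_simps)
qed

text \<open>The central estimate. For large \<open>j\<close> the perturbation \<open>\<beta> - damp j \<beta>\<close> barely sees the block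
  carrying \<open>y\<close>: up to a small error its form is bounded by the part of \<open>a\<close> or of \<open>b\<close> outside that
  block, so by orthogonality it raises the bound \<open>C\<close> only by \<open>G\<^sup>2 / C\<close> rather than by \<open>2 G\<close>.\<close>
lemma hle_add_diff_damp:
  assumes y: "fin_supp y" "hle y C" and C: "C > 0" and G: "0 \<le> G" and \<eta>: "\<eta> > 0"
  shows "\<forall>\<^sub>F j in sequentially. \<forall>\<beta>. hle \<beta> G \<longrightarrow>
    hle (\<lambda>n. y n + (\<beta> n - damp j \<beta> n)) (C + G\<^sup>2 / C + \<eta>)"
proof -
  obtain N where N: "supp y \<subseteq> {..N}" using fin_supp_bound[OF y(1)] by blast
  \<comment> \<open>Each of the two slots produces an error \<open>G * \<epsilon>\<close>; together
    they must not exceed \<open>\<eta>\<close>. The 1 covers \<open>G = 0\<close>.\<close>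
  define \<epsilon> where "\<epsilon> = \<eta> / (2 * (G + 1))"
  have \<epsilon>: "0 < \<epsilon>" "2 * G * \<epsilon> \<le> \<eta>" using G \<eta> by (auto simp: \<epsilon>_def field_simps)
  have "\<forall>\<^sub>F j in sequentially. 1 - weight j n \<le> \<epsilon>" if "n > 0" for n
  proof -
    have "\<forall>\<^sub>F j in sequentially. 1 - \<epsilon> < weight j n"
      using \<epsilon> by (intro order_tendstoD(1)[OF weight_tendsto[OF that]]) auto
    then show ?thesis by eventually_elim auto
  qed
  \<comment> \<open>How large \<open>j\<close> must be depends on \<open>N\<close> and
    \<open>\<epsilon>\<close> but not on \<open>\<beta>\<close>. The gliding hump relies on this
    order, since there the hump is chosen only after \<open>j\<close>.\<close>
  then have "\<forall>\<^sub>F j in sequentially. \<forall>n\<in>{0<..N}. 1 - weight j n \<le> \<epsilon>"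
    by (intro eventually_ball_finite) auto
  then show ?thesis
  proof eventually_elim
    case (elim j)
    show ?case unfolding hle_def[of _ "C + G\<^sup>2 / C + \<eta>"]
    proof (intro allI impI)
      fix \<beta> a b assume \<beta>: "hle \<beta> G" and ab: "fin_supp a" "fin_supp b"
      let ?r = "restr {..N}" and ?t = "restr (- {..N})"
      have d: "fnorm (\<lambda>n. x n - damp j x n) \<le> \<epsilon> * fnorm x + fnorm (?t x)" if "fin_supp x" for x
        using elim \<epsilon> that by (intro fnorm_diff_damp_le) auto
      \<comment> \<open>If \<open>n * m\<close> is at most \<open>N\<close> and both factors are
        positive, each factor is at most \<open>N\<close>; hence \<open>y\<close> sees only the
        block up to \<open>N\<close> in either vector.\<close>
      have "hform y a b = hform y (?r a) (?r b)"
      proof -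
        let ?A = "supp a" and ?B = "supp b"
        have fin: "finite ?A" "finite ?B" using ab by (auto simp: fin_supp_def)
        have "hform y (?r a) (?r b) = (\<Sum>n\<in>?A. \<Sum>m\<in>?B. ?r a n * cnj (?r b m) * y (n * m))"
          using fin by (intro hform_eq) (auto simp: supp_def restr_def)
        also have "\<dots> = hform y a b"
          unfolding hform_def
        proof (intro sum.cong refl)
          fix n m assume "n \<in> ?A" "m \<in> ?B"
          then have "n > 0" "m > 0" using ab by (auto simp: fin_supp_def supp_def intro: gr0I)
          moreover have "y (n * m) = 0" if "n * m > N" using that N by (force simp: supp_def)
          ultimately show "?r a n * cnj (?r b m) * y (n * m) = a n * cnj (b m) * y (n * m)"
            by (cases "n * m > N") (auto simp: restr_def not_less intro: order_trans[of _ "n * m" N])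
        qed
        finally show ?thesis by simp
      qed
      then have "cmod (hform y a b) \<le> C * fnorm (?r a) * fnorm (?r b)"
        using hleD[OF y(2)] ab by simp
      moreover have "cmod (hform \<beta> (\<lambda>n. a n - damp j a n) b) \<le> G * (\<epsilon> * fnorm a + fnorm (?t a)) * fnorm b"
        using ab G by (intro order_trans[OF hleD[OF \<beta>]] mult_right_mono mult_left_mono d) simp_all
      moreover have "cmod (hform \<beta> (damp j a) (\<lambda>n. b n - damp j b n)) \<le> G * fnorm a * (\<epsilon> * fnorm b + fnorm (?t b))"
        using ab G \<epsilon>
        by (intro order_trans[OF hleD[OF \<beta>]] mult_mono d fnorm_damp_le) simp_all
      ultimately have "cmod (hform (\<lambda>n. y n + (\<beta> n - damp j \<beta> n)) a b)
          \<le> C * fnorm (?r a) * fnorm (?r b) + G * (\<epsilon> * fnorm a + fnorm (?t a)) * fnorm b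
            + G * fnorm a * (\<epsilon> * fnorm b + fnorm (?t b))"
        unfolding hform_add_symbol hform_diff_damp[OF ab] add.assoc
        by (intro norm_triangle_mono)
      also have "\<dots> = C * fnorm (?r a) * fnorm (?r b) + G * fnorm (?t a) * fnorm b
            + G * fnorm a * fnorm (?t b) + (2 * G * \<epsilon>) * (fnorm a * fnorm b)"
        by (simp add: algebra_simps)
      also have "\<dots> \<le> (C + G\<^sup>2 / C) * fnorm a * fnorm b + \<eta> * (fnorm a * fnorm b)"
        using \<epsilon> by (intro add_mono mult_right_mono block_inequality C fnorm_restr_split ab) auto
      finally show "cmod (hform (\<lambda>n. y n + (\<beta> n - damp j \<beta> n)) a b)
          \<le> (C + G\<^sup>2 / C + \<eta>) * fnorm a * fnorm b"
        by (simp add: algebra_simps)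
    qed
  qed
qed

text \<open>Coefficients of \<open>\<beta>\<close> are at most \<open>hnorm \<beta>\<close>, so the
  tail of \<open>damp j \<beta>\<close> has l1 norm at most \<open>hnorm \<beta>\<close> times the
  tail of the weight. The cut-off \<open>N\<close> is thus uniform in \<open>\<beta>\<close>, as
  \<open>Lmap_dense\<close> requires.\<close>

lemma damp_approx_fin_supp:
  assumes e: "e > 0"
  shows "\<forall>\<^sub>F N in sequentially. \<forall>\<beta>\<in>Mb.
    hle (\<lambda>n. damp j \<beta> n - restr {..N} (damp j \<beta>) n) (e * hnorm \<beta>)"
proof -
  have "\<forall>\<^sub>F N in sequentially. (\<Sum>n. weight j (n + N)) < e"
  proof -
    have "(\<lambda>N. \<Sum>n. weight j (n + N)) \<longlonglongrightarrow> 0"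
      by (rule suminf_exist_split2[OF summable_weight])
    then show ?thesis using e by (rule order_tendstoD)
  qed
  then show ?thesis
  proof eventually_elim
    case (elim N)
    show ?case
    proof
      fix \<beta> assume \<beta>: "\<beta> \<in> Mb"
      let ?\<gamma> = "\<lambda>n. damp j \<beta> n - restr {..N} (damp j \<beta>) n"
      \<comment> \<open>The majorant already starts at \<open>N\<close>, although the cut-off keeps
        that index. The overestimate is harmless and matches the tail series shifted by
        \<open>N\<close>.\<close>
      let ?g = "\<lambda>n. (if n < N then 0 else weight j n) * hnorm \<beta>"
      have h: "0 \<le> hnorm \<beta>" using hnorm_nonneg[OF \<beta>] .
      have le: "cmod (?\<gamma> n) \<le> ?g n" for n
        using Mb_coeff_le[OF \<beta>, of n] h by (auto simp: restr_def damp_def norm_mult intro: mult_left_mono)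
      have shift: "summable (\<lambda>n. weight j (n + N))"
        using summable_weight summable_iff_shift by blast
      have s1: "summable (\<lambda>n. if n < N then 0 else weight j n)"
        using summable_iff_shift[of "\<lambda>n. if n < N then 0 else weight j n" N] shift by simp
      then have sg: "summable ?g" by (rule summable_mult2)
      have s\<gamma>: "summable (\<lambda>n. cmod (?\<gamma> n))"
        using le by (intro summable_comparison_test'[OF sg]) auto
      have "(\<Sum>n. cmod (?\<gamma> n)) \<le> (\<Sum>n. ?g n)" by (intro suminf_le le s\<gamma> sg)
      also have "\<dots> = (\<Sum>n. if n < N then 0 else weight j n) * hnorm \<beta>"
        by (rule suminf_mult2[OF s1, symmetric])
      also have "(\<Sum>n. if n < N then 0 else weight j n) = (\<Sum>n. weight j (n + N))"
        using suminf_split_initial_segment[OF s1, of N] by simp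
      also have "\<dots> * hnorm \<beta> \<le> e * hnorm \<beta>" using elim h by (intro mult_right_mono) auto
      finally show "hle ?\<gamma> (e * hnorm \<beta>)"
        using hle_mono[OF hle_l1[OF _ s\<gamma>]] by (simp add: restr_def damp_def)
    qed
  qed
qed

section \<open>Compact symbols\<close>

lemma L2_set_le_l2norm:
  assumes "a \<in> l2" "finite A"
  shows "L2_set (\<lambda>n. cmod (a n)) A \<le> l2norm a"
  unfolding L2_set_def l2norm_def using assms
  by (intro real_sqrt_le_mono sum_le_suminf) (auto simp: l2_def)

lemma l2_bounded_partial_sums:
  assumes "v 0 = 0" "0 \<le> C" and le: "\<And>N. L2_set (\<lambda>n. cmod (v n)) {..<N} \<le> C"
  shows "v \<in> l2" "l2norm v \<le> C"
proof -
  have le': "(\<Sum>n<N. (cmod (v n))\<^sup>2) \<le> C\<^sup>2" for N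
    using le[of N] unfolding L2_set_def by (rule sqrt_le_D)
  then have s: "summable (\<lambda>n. (cmod (v n))\<^sup>2)" by (intro summableI_nonneg_bounded) auto
  then show "v \<in> l2" by (simp add: l2_def assms(1))
  have "(\<Sum>n. (cmod (v n))\<^sup>2) \<le> C\<^sup>2" by (intro suminf_le_const s le')
  then show "l2norm v \<le> C" unfolding l2norm_def using assms(2) by (intro real_le_lsqrt) auto
qed

lemma l2norm_nonneg: "a \<in> l2 \<Longrightarrow> 0 \<le> l2norm a"
  unfolding l2norm_def l2_def by (simp add: suminf_nonneg)

lemma l2_add:
  assumes "a \<in> l2" "b \<in> l2"
  shows "(\<lambda>n. a n + b n) \<in> l2" "l2norm (\<lambda>n. a n + b n) \<le> l2norm a + l2norm b"
proof -
  have "L2_set (\<lambda>n. cmod (a n + b n)) {..<N} \<le> l2norm a + l2norm b" for N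
  proof -
    have "L2_set (\<lambda>n. cmod (a n + b n)) {..<N} \<le> L2_set (\<lambda>n. cmod (a n) + cmod (b n)) {..<N}"
      by (intro L2_set_mono norm_triangle_ineq) auto
    also have "\<dots> \<le> L2_set (\<lambda>n. cmod (a n)) {..<N} + L2_set (\<lambda>n. cmod (b n)) {..<N}"
      by (rule L2_set_triangle_ineq)
    also have "\<dots> \<le> l2norm a + l2norm b"
      by (intro add_mono L2_set_le_l2norm assms) auto
    finally show ?thesis .
  qed
  moreover have "a 0 + b 0 = 0" using assms by (simp add: l2_def)
  ultimately show "(\<lambda>n. a n + b n) \<in> l2" "l2norm (\<lambda>n. a n + b n) \<le> l2norm a + l2norm b"
    using l2_bounded_partial_sums[of "\<lambda>n. a n + b n" "l2norm a + l2norm b"] assms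
    by (simp_all add: l2norm_nonneg)
qed

lemma l2_diff: "a \<in> l2 \<Longrightarrow> b \<in> l2 \<Longrightarrow> (\<lambda>n. a n - b n) \<in> l2"
  using l2_add(1)[of a "\<lambda>n. - b n"] by (simp add: l2_def)

lemma fin_supp_l2:
  assumes "fin_supp a"
  shows "a \<in> l2" "l2norm a = fnorm a"
proof -
  have fin: "finite (supp a)" using assms by (simp add: fin_supp_def)
  have "(\<lambda>n. (cmod (a n))\<^sup>2) sums (\<Sum>n\<in>supp a. (cmod (a n))\<^sup>2)"
    using fin by (intro sums_finite) (auto simp: supp_def)
  then show "a \<in> l2" "l2norm a = fnorm a"
    using assms by (auto simp: l2_def l2norm_def fnorm_def fin_supp_def sums_iff)
qed

lemma fnorm_restr_le_l2norm:
  assumes "a \<in> l2" "finite A"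
  shows "fnorm (restr A a) \<le> l2norm a"
proof -
  have "fnorm (restr A a) = L2_set (\<lambda>n. cmod (restr A a n)) A"
    using assms(2) by (intro fnorm_eq_L2_set) (auto simp: supp_def restr_def)
  also have "\<dots> = L2_set (\<lambda>n. cmod (a n)) A" by (intro L2_set_cong) (auto simp: restr_def)
  also have "\<dots> \<le> l2norm a" by (intro L2_set_le_l2norm assms)
  finally show ?thesis .
qed

text \<open>Without summability the \<open>suminf\<close> in \<open>Mop\<close> would carry no
  information. Rotating the phases of \<open>a\<close> against those of
  \<open>\<alpha> (n * m)\<close> makes each finite sum of absolute values a single value of the
  form against the unit vector at \<open>m\<close>.\<close>

lemma Mop_summable:
  assumes \<alpha>: "\<alpha> 0 = 0" "hle \<alpha> C" and a: "a \<in> l2"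
  shows "summable (\<lambda>n. \<alpha> (n * m) * a n)"
proof (cases "m = 0")
  case True
  then show ?thesis by (simp add: \<alpha>)
next
  case False
  have "(\<Sum>n<N. norm (\<alpha> (n * m) * a n)) \<le> C * l2norm a" for N
  proof -
    define x where "x = restr {..<N} (\<lambda>n. cnj (sgn (\<alpha> (n * m))) * of_real (cmod (a n)))"
    have a0: "a 0 = 0" using a by (simp add: l2_def)
    have x: "fin_supp x" unfolding x_def by (rule fin_supp_restr_finite) (auto simp: a0)
    have "hform \<alpha> x (unit_seq m) = (\<Sum>n<N. \<Sum>i\<in>{m}. x n * cnj (unit_seq m i) * \<alpha> (n * i))"
      by (intro hform_eq) (auto simp: supp_def x_def restr_def unit_seq_def)
    also have "\<dots> = (\<Sum>n<N. of_real (norm (\<alpha> (n * m) * a n)))"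
    proof (intro sum.cong refl)
      fix n assume "n \<in> {..<N}"
      moreover have "cnj (sgn z) * z = of_real (cmod z)" for z
      proof -
        have "cnj (sgn z) * z = of_real ((cmod z)\<^sup>2) / of_real (cmod z)"
          unfolding complex_norm_square by (simp add: sgn_eq)
        also have "\<dots> = of_real (cmod z)" by (simp add: power2_eq_square)
        finally show ?thesis .
      qed
      ultimately show "(\<Sum>i\<in>{m}. x n * cnj (unit_seq m i) * \<alpha> (n * i)) = of_real (norm (\<alpha> (n * m) * a n))"
        by (simp add: x_def restr_def unit_seq_def norm_mult mult_ac)
    qed
    finally have "(\<Sum>n<N. norm (\<alpha> (n * m) * a n)) = cmod (hform \<alpha> x (unit_seq m))"
      by (simp add: sum_nonneg flip: of_real_sum)
    also have "\<dots> \<le> C * fnorm x"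
      using hleD[OF \<alpha>(2) x fin_supp_unit[of m]] False by simp
    finally have "(\<Sum>n<N. norm (\<alpha> (n * m) * a n)) \<le> C * fnorm x" .
    moreover have "fnorm x \<le> fnorm (restr {..<N} a)"
      by (rule fnorm_mono[OF fin_supp_restr_finite])
        (auto simp: x_def restr_def norm_mult norm_sgn a0)
    moreover have "\<dots> \<le> l2norm a" by (intro fnorm_restr_le_l2norm a) auto
    ultimately show ?thesis using hle_nonneg[OF \<alpha>(2)] by (meson mult_left_mono order_trans)
  qed
  then have "summable (\<lambda>n. norm (\<alpha> (n * m) * a n))" by (intro summableI_nonneg_bounded) auto
  then show ?thesis by (rule summable_norm_cancel)
qed

text \<open>Pairing the truncated image with itself gives its squared norm \<open>S\<^sup>2\<close>,
  while the form bound gives \<open>C * l2norm a * S\<close>; dividing by \<open>S\<close> bounds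
  the truncation. The input cut-off \<open>K\<close> is removed first, then the output cut-off
  \<open>M\<close>.\<close>

lemma Mop_l2:
  assumes \<alpha>: "\<alpha> 0 = 0" "hle \<alpha> C" and a: "a \<in> l2"
  shows "Mop \<alpha> a \<in> l2" "l2norm (Mop \<alpha> a) \<le> C * l2norm a"
proof -
  have C: "0 \<le> C" using hle_nonneg[OF \<alpha>(2)] .
  have a0: "a 0 = 0" using a by (simp add: l2_def)
  have part: "L2_set (\<lambda>m. cmod (\<Sum>n<K. \<alpha> (n * m) * a n)) {..<M} \<le> C * l2norm a" for K M
  proof -
    define v where "v m = (\<Sum>n<K. \<alpha> (n * m) * a n)" for m
    define S where "S = L2_set (\<lambda>m. cmod (v m)) {..<M}"
    have v0: "v 0 = 0" by (simp add: v_def \<alpha>)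
    let ?b = "restr {..<M} v" and ?a = "restr {..<K} a"
    have fin: "fin_supp ?a" "fin_supp ?b" by (auto intro!: fin_supp_restr_finite simp: a0 v0)
    have "fnorm ?b = L2_set (\<lambda>n. cmod (?b n)) {..<M}"
      by (intro fnorm_eq_L2_set) (auto simp: supp_def restr_def)
    also have "\<dots> = S" unfolding S_def by (intro L2_set_cong) (auto simp: restr_def)
    finally have b: "fnorm ?b = S" .
    have "hform \<alpha> ?a ?b = (\<Sum>n<K. \<Sum>m<M. ?a n * cnj (?b m) * \<alpha> (n * m))"
      by (intro hform_eq) (auto simp: supp_def restr_def)
    also have "\<dots> = (\<Sum>m<M. \<Sum>n<K. ?a n * cnj (?b m) * \<alpha> (n * m))" by (rule sum.swap)
    also have "\<dots> = (\<Sum>m<M. of_real ((cmod (v m))\<^sup>2))"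
    proof (intro sum.cong refl)
      fix m assume "m \<in> {..<M}"
      then have "(\<Sum>n<K. ?a n * cnj (?b m) * \<alpha> (n * m)) = cnj (v m) * (\<Sum>n<K. \<alpha> (n * m) * a n)"
        by (auto simp: restr_def sum_distrib_left mult_ac intro!: sum.cong)
      also have "\<dots> = of_real ((cmod (v m))\<^sup>2)"
        by (metis v_def complex_norm_square mult.commute)
      finally show "(\<Sum>n<K. ?a n * cnj (?b m) * \<alpha> (n * m)) = of_real ((cmod (v m))\<^sup>2)" .
    qed
    also have "\<dots> = of_real (S\<^sup>2)" by (simp add: S_def L2_set_def sum_nonneg)
    finally have "cmod (hform \<alpha> ?a ?b) = S\<^sup>2" by (simp add: norm_power)
    moreover have "cmod (hform \<alpha> ?a ?b) \<le> C * fnorm ?a * S"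
      using hleD[OF \<alpha>(2) fin] b by simp
    moreover have "C * fnorm ?a * S \<le> C * l2norm a * S"
      using C by (intro mult_right_mono mult_left_mono fnorm_restr_le_l2norm a) (auto simp: S_def)
    ultimately have "S * S \<le> C * l2norm a * S" by (simp add: power2_eq_square)
    moreover have "0 \<le> S" by (simp add: S_def)
    ultimately have "S \<le> C * l2norm a"
      using C l2norm_nonneg[OF a] by (cases "S = 0") auto
    then show ?thesis by (simp add: S_def v_def)
  qed
  have lim: "(\<lambda>K. \<Sum>n<K. \<alpha> (n * m) * a n) \<longlonglongrightarrow> Mop \<alpha> a m" for m
    unfolding Mop_def by (intro summable_LIMSEQ Mop_summable[OF \<alpha> a])
  have "L2_set (\<lambda>m. cmod (Mop \<alpha> a m)) {..<M} \<le> C * l2norm a" for M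
  proof (rule LIMSEQ_le_const2)
    show "(\<lambda>K. L2_set (\<lambda>m. cmod (\<Sum>n<K. \<alpha> (n * m) * a n)) {..<M}) \<longlonglongrightarrow> L2_set (\<lambda>m. cmod (Mop \<alpha> a m)) {..<M}"
      unfolding L2_set_def by (intro tendsto_intros lim)
  qed (use part in blast)
  moreover have "Mop \<alpha> a 0 = 0" by (simp add: Mop_def \<alpha>)
  ultimately show "Mop \<alpha> a \<in> l2" "l2norm (Mop \<alpha> a) \<le> C * l2norm a"
    using l2_bounded_partial_sums[of "Mop \<alpha> a" "C * l2norm a"] C l2norm_nonneg[OF a] by simp_all
qed

lemma l2_coeff_le: "a \<in> l2 \<Longrightarrow> cmod (a n) \<le> l2norm a"
  using L2_set_le_l2norm[of a "{n}"] by simp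

text \<open>The image lies in the coordinates \<open>{1..N}\<close> and is bounded there, so nets in
  the single coordinates combine to a finite net.\<close>

lemma fin_supp_totally_bounded:
  assumes z: "fin_supp z" and e: "e > 0"
  shows "\<exists>F. finite F \<and> F \<subseteq> l2 \<and>
      (\<forall>a\<in>l2. l2norm a \<le> 1 \<longrightarrow> (\<exists>f\<in>F. l2norm (\<lambda>n. Mop z a n - f n) < e))"
proof -
  obtain N where N: "supp z \<subseteq> {..N}" using fin_supp_bound[OF z] by blast
  \<comment> \<open>The l2 error is estimated by the sum of \<open>N\<close> coordinate errors, and
    the denominator \<open>N + 1\<close> makes the total strictly smaller than
    \<open>e\<close>.\<close>
  define \<delta> where "\<delta> = e / (real N + 1)"
  have \<delta>: "\<delta> > 0" using e by (simp add: \<delta>_def)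
  have zM: "z \<in> Mb" using fin_supp_Mb[OF z] .
  then have z0: "z 0 = 0" by (simp add: Mb_iff)
  obtain G where G: "finite G" "cball (0::complex) (hnorm z) \<subseteq> (\<Union>x\<in>G. ball x \<delta>)"
    using compact_cball[of "0::complex" "hnorm z"] \<delta> unfolding compact_eq_totally_bounded by blast
  define F where "F = {f :: seq. \<forall>x. (x \<in> {1..N} \<longrightarrow> f x \<in> G) \<and> (x \<notin> {1..N} \<longrightarrow> f x = 0)}"
  have fs: "fin_supp f" if "f \<in> F" for f
  proof -
    have "supp f \<subseteq> {1..N}" using that unfolding F_def supp_def by blast
    moreover have "f 0 = 0" using that by (simp add: F_def)
    ultimately show ?thesis by (auto simp: fin_supp_def intro: finite_subset)
  qed
  have "\<exists>f\<in>F. l2norm (\<lambda>n. Mop z a n - f n) < e" if a: "a \<in> l2" "l2norm a \<le> 1" for a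
  proof -
    have M: "Mop z a \<in> l2" "l2norm (Mop z a) \<le> hnorm z * l2norm a"
      using Mop_l2[OF z0 hle_hnorm[OF zM] a(1)] by auto
    have "cmod (Mop z a m) \<le> hnorm z" for m
      using l2_coeff_le[OF M(1), of m] M(2) mult_left_le[OF a(2) hnorm_nonneg[OF zM]] by linarith
    then have "\<exists>g\<in>G. dist g (Mop z a m) < \<delta>" for m
      using G(2) by (force simp: subset_iff)
    then obtain g where g: "\<And>m. g m \<in> G" "\<And>m. dist (g m) (Mop z a m) < \<delta>" by metis
    define f where "f m = (if m \<in> {1..N} then g m else 0)" for m
    have f: "f \<in> F" using g by (auto simp: F_def f_def)
    \<comment> \<open>For \<open>m > N\<close> every positive \<open>n\<close> gives
      \<open>n * m > N\<close>, outside the support of \<open>z\<close>; for \<open>m = 0\<close> or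
      \<open>n = 0\<close> the value \<open>z 0 = 0\<close> enters.\<close>
    have out: "Mop z a m = 0" if "m \<notin> {1..N}" for m
    proof -
      have "z (n * m) * a n = 0" for n
      proof (cases "n = 0 \<or> m = 0")
        case False
        then have "n * m > N" using that by (metis One_nat_def Suc_leI atLeastAtMost_iff
              bot_nat_0.not_eq_extremum leI le_trans mult_le_mono1 nat_mult_1)
        then show ?thesis using N by (force simp: supp_def)
      qed (auto simp: z0)
      then have "(\<lambda>n. z (n * m) * a n) = (\<lambda>n. 0)" by blast
      then show ?thesis by (simp only: Mop_def suminf_zero)
    qed
    let ?d = "\<lambda>n. Mop z a n - f n"
    have "supp ?d \<subseteq> {1..N}" using out by (auto simp: supp_def f_def)
    then have fin: "fin_supp ?d"
      using out[of 0] by (auto simp: fin_supp_def f_def intro: finite_subset)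
    have "l2norm ?d = L2_set (\<lambda>n. cmod (?d n)) {1..N}"
      using fin_supp_l2(2)[OF fin] fnorm_eq_L2_set[OF _ \<open>supp ?d \<subseteq> {1..N}\<close>] by simp
    also have "\<dots> \<le> (\<Sum>n\<in>{1..N}. cmod (?d n))" by (intro L2_set_le_sum) auto
    also have "\<dots> \<le> (\<Sum>n\<in>{1..N}. \<delta>)"
      using g(2) by (intro sum_mono) (auto simp: f_def dist_norm norm_minus_commute less_imp_le)
    also have "\<dots> < e" using e by (simp add: \<delta>_def field_simps)
    finally show ?thesis using f by blast
  qed
  moreover have "finite F" unfolding F_def by (intro finite_set_of_finite_funs) (auto simp: G)
  moreover have "F \<subseteq> l2" using fs fin_supp_l2 by blast
  ultimately show ?thesis by blast
qed

text \<open>A net for a finitely supported approximant at scale \<open>e / 2\<close> serves as a net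
  for \<open>\<alpha>\<close> at scale \<open>e\<close>, because the operators differ by at most
  \<open>e / 2\<close> on the unit ball.\<close>

lemma M0I:
  assumes \<alpha>: "\<alpha> \<in> Mb" and appr: "\<And>e. e > 0 \<Longrightarrow> \<exists>z. fin_supp z \<and> hle (\<lambda>n. \<alpha> n - z n) e"
  shows "\<alpha> \<in> M0"
  unfolding M0_def
proof (intro CollectI conjI \<alpha> allI impI)
  fix e :: real assume e: "e > 0"
  then obtain z where z: "fin_supp z" "hle (\<lambda>n. \<alpha> n - z n) (e / 2)" using appr[of "e / 2"] by auto
  obtain F where F: "finite F" "F \<subseteq> l2"
    "\<And>a. a \<in> l2 \<Longrightarrow> l2norm a \<le> 1 \<Longrightarrow> \<exists>f\<in>F. l2norm (\<lambda>n. Mop z a n - f n) < e / 2"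
    using fin_supp_totally_bounded[OF z(1), of "e / 2"] e by auto
  have zM: "z \<in> Mb" using fin_supp_Mb[OF z(1)] .
  have "\<exists>f\<in>F. l2norm (\<lambda>n. Mop \<alpha> a n - f n) < e" if a: "a \<in> l2" "l2norm a \<le> 1" for a
  proof -
    obtain f where f: "f \<in> F" "l2norm (\<lambda>n. Mop z a n - f n) < e / 2" using F(3)[OF a] by blast
    let ?\<gamma> = "\<lambda>n. \<alpha> n - z n"
    have \<gamma>0: "?\<gamma> 0 = 0" using \<alpha> zM by (simp add: Mb_iff)
    have M\<gamma>: "Mop ?\<gamma> a m = Mop \<alpha> a m - Mop z a m" for m
    proof -
      have "summable (\<lambda>n. \<beta> (n * m) * a n)" if "\<beta> \<in> Mb" for \<beta>
        using that a(1) by (auto simp: Mb_iff intro: Mop_summable)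
      from suminf_diff[OF this[OF \<alpha>] this[OF zM]] show ?thesis
        by (simp add: Mop_def left_diff_distrib)
    qed
    note \<gamma> = Mop_l2[OF \<gamma>0 z(2) a(1)]
    have "Mop z a \<in> l2" using Mop_l2(1)[OF _ hle_hnorm[OF zM] a(1)] zM by (simp add: Mb_iff)
    then have d: "(\<lambda>n. Mop z a n - f n) \<in> l2" using f F(2) by (intro l2_diff) auto
    have "l2norm (\<lambda>n. Mop \<alpha> a n - f n) = l2norm (\<lambda>n. Mop ?\<gamma> a n + (Mop z a n - f n))"
      by (simp add: M\<gamma>)
    also have "\<dots> \<le> l2norm (Mop ?\<gamma> a) + l2norm (\<lambda>n. Mop z a n - f n)"
      by (rule l2_add(2)[OF \<gamma>(1) d])
    also have "\<dots> < e / 2 + e / 2"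
    proof (rule add_le_less_mono[OF _ f(2)])
      have "e / 2 * l2norm a \<le> e / 2" using a e by (intro mult_left_le) auto
      then show "l2norm (Mop ?\<gamma> a) \<le> e / 2" using \<gamma>(2) by linarith
    qed
    finally show ?thesis using f(1) by auto
  qed
  then show "\<exists>F. finite F \<and> F \<subseteq> l2 \<and>
      (\<forall>a\<in>l2. l2norm a \<le> 1 \<longrightarrow> (\<exists>f\<in>F. l2norm (\<lambda>n. Mop \<alpha> a n - f n) < e))"
    using F(1,2) by blast
qed

section \<open>Compact symbols as norm limits of their damped versions\<close>

text \<open>Dominated convergence for series (Tannery), with the squares of \<open>f\<close> as
  majorant: damping tends strongly to the identity on l2.\<close>

lemma l2_diff_damp_small:
  assumes f: "f \<in> l2" and e: "e > 0"
  shows "\<forall>\<^sub>F j in sequentially. \<forall>A. finite A \<longrightarrow> L2_set (\<lambda>n. cmod (f n - damp j f n)) A \<le> e"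
proof -
  let ?d = "\<lambda>j n. (cmod (f n - damp j f n))\<^sup>2"
  have f0: "f 0 = 0" and sf: "summable (\<lambda>n. (cmod (f n))\<^sup>2)" using f by (auto simp: l2_def)
  have le: "?d j n \<le> (cmod (f n))\<^sup>2" for j n
    by (intro power_mono cmod_diff_damp_le) simp
  have sd: "summable (?d j)" for j
    by (rule summable_comparison_test'[OF sf, of 0]) (use le in auto)
  have "(\<lambda>j. \<Sum>n. ?d j n) \<longlonglongrightarrow> (\<Sum>n. (cmod (f n - f n))\<^sup>2)"
  proof -
    have lim: "(\<lambda>j. ?d j n) \<longlonglongrightarrow> (cmod (f n - f n))\<^sup>2" for n
      by (intro tendsto_intros damp_tendsto f0)
    have "\<forall>\<^sub>F (n, j) in sequentially \<times>\<^sub>F sequentially. norm (?d j n) \<le> (cmod (f n))\<^sup>2"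
      using le by (intro always_eventually) auto
    from tannerys_theorem[OF lim this sf sequentially_bot] show ?thesis by blast
  qed
  then have "\<forall>\<^sub>F j in sequentially. (\<Sum>n. ?d j n) < e\<^sup>2"
    using e by (intro order_tendstoD) auto
  then show ?thesis
  proof eventually_elim
    case (elim j)
    have "L2_set (\<lambda>n. cmod (f n - damp j f n)) A \<le> e" if "finite A" for A
    proof -
      have "(\<Sum>n\<in>A. ?d j n) \<le> (\<Sum>n. ?d j n)" using that by (intro sum_le_suminf sd) auto
      then show ?thesis unfolding L2_set_def using elim e by (intro real_le_lsqrt) auto
    qed
    then show ?case by blast
  qed
qed

lemma hform_eq_Mop:
  assumes "fin_supp a" "finite B" "supp b \<subseteq> B"
  shows "hform \<alpha> a b = (\<Sum>m\<in>B. cnj (b m) * Mop \<alpha> a m)"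
proof -
  have fin: "finite (supp a)" using assms by (simp add: fin_supp_def)
  have "Mop \<alpha> a m = (\<Sum>n\<in>supp a. \<alpha> (n * m) * a n)" for m
    unfolding Mop_def by (rule suminf_finite[OF fin]) (auto simp: supp_def)
  then have "(\<Sum>m\<in>B. cnj (b m) * Mop \<alpha> a m)
      = (\<Sum>m\<in>B. \<Sum>n\<in>supp a. a n * cnj (b m) * \<alpha> (n * m))"
    by (simp add: sum_distrib_left mult_ac)
  also have "\<dots> = hform \<alpha> a b"
    by (subst sum.swap) (rule hform_eq[OF fin order_refl assms(2,3), symmetric])
  finally show ?thesis by simp
qed

lemma hform_mult_left:
  assumes "fin_supp a" "fin_supp b"
  shows "hform \<alpha> (\<lambda>n. k * a n) b = k * hform \<alpha> a b"
proof -
  have "finite (supp a)" "finite (supp b)" using assms by (auto simp: fin_supp_def)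
  then show ?thesis
    by (subst (1 2) hform_eq[of "supp a" _ "supp b"]) (auto simp: supp_def sum_distrib_left mult_ac)
qed

lemma cmod_sum_mult_le_L2:
  "cmod (\<Sum>m\<in>B. x m * y m) \<le> L2_set (\<lambda>m. cmod (x m)) B * L2_set (\<lambda>m. cmod (y m)) B"
proof -
  have "cmod (\<Sum>m\<in>B. x m * y m) \<le> (\<Sum>m\<in>B. \<bar>cmod (x m)\<bar> * \<bar>cmod (y m)\<bar>)"
    by (rule order_trans[OF norm_sum]) (simp add: norm_mult)
  also have "\<dots> \<le> L2_set (\<lambda>m. cmod (x m)) B * L2_set (\<lambda>m. cmod (y m)) B" by (rule L2_set_mult_ineq)
  finally show ?thesis .
qed

text \<open>Compactness enters here: \<open>damp j\<close> converges strongly to the identity, hence uniformly on the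
  totally bounded image of the unit ball.\<close>
lemma M0_hform_damp_right:
  assumes x: "x \<in> M0" and e: "e > 0"
  shows "\<forall>\<^sub>F j in sequentially. \<forall>a b. fin_supp a \<longrightarrow> fin_supp b \<longrightarrow>
    cmod (hform x a (\<lambda>n. b n - damp j b n)) \<le> e * fnorm a * fnorm b"
proof -
  have xM: "x \<in> Mb" using x by (simp add: M0_def)
  then have x0: "x 0 = 0" by (simp add: Mb_iff)
  obtain F where F: "finite F" "F \<subseteq> l2"
    "\<And>a. a \<in> l2 \<Longrightarrow> l2norm a \<le> 1 \<Longrightarrow> \<exists>f\<in>F. l2norm (\<lambda>n. Mop x a n - f n) < e / 2"
    using x e unfolding M0_def by (auto dest!: spec[of _ "e / 2"])
  have "\<forall>\<^sub>F j in sequentially. \<forall>f\<in>F. \<forall>A. finite A \<longrightarrow> L2_set (\<lambda>n. cmod (f n - damp j f n)) A \<le> e / 2"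
    using F e by (intro eventually_ball_finite ballI l2_diff_damp_small) auto
  then show ?thesis
  proof eventually_elim
    case (elim j)
    have unit: "cmod (hform x a (\<lambda>n. b n - damp j b n)) \<le> e * fnorm b"
      if a: "fin_supp a" "fnorm a \<le> 1" and b: "fin_supp b" for a b
    proof -
      let ?B = "supp b" and ?b = "\<lambda>n. b n - damp j b n"
      have fin: "finite ?B" using b by (simp add: fin_supp_def)
      have bB: "L2_set (\<lambda>m. cmod (b m)) ?B = fnorm b" using fin by (simp add: fnorm_eq_L2_set)
      have a2: "a \<in> l2" "l2norm a \<le> 1" using fin_supp_l2[OF a(1)] a(2) by auto
      obtain f where f: "f \<in> F" "l2norm (\<lambda>n. Mop x a n - f n) < e / 2" using F(3)[OF a2] by blast
      have d: "(\<lambda>n. Mop x a n - f n) \<in> l2"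
        using f F(2) Mop_l2(1)[OF x0 hle_hnorm[OF xM] a2(1)] by (intro l2_diff) auto
      have "hform x a ?b = (\<Sum>m\<in>?B. cnj (?b m) * Mop x a m)"
        using fin by (intro hform_eq_Mop a) (auto simp: supp_def damp_def)
      \<comment> \<open>Damping is a real diagonal operator, hence self-adjoint, and moves from
        \<open>b\<close> onto the net point \<open>f\<close>. Only finitely many net points then
        have to be damped uniformly.\<close>
      also have "\<dots> = (\<Sum>m\<in>?B. cnj (?b m) * (Mop x a m - f m)) + (\<Sum>m\<in>?B. cnj (b m) * (f m - damp j f m))"
        unfolding sum.distrib[symmetric] by (intro sum.cong refl) (simp add: damp_def algebra_simps)
      finally have "cmod (hform x a ?b) \<le> cmod (\<Sum>m\<in>?B. cnj (?b m) * (Mop x a m - f m))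
          + cmod (\<Sum>m\<in>?B. cnj (b m) * (f m - damp j f m))"
        by (simp add: norm_triangle_ineq)
      also have "cmod (\<Sum>m\<in>?B. cnj (?b m) * (Mop x a m - f m)) \<le> fnorm b * (e / 2)"
      proof (rule order_trans[OF cmod_sum_mult_le_L2 mult_mono])
        have "L2_set (\<lambda>m. cmod (cnj (?b m))) ?B = fnorm ?b"
          unfolding complex_mod_cnj
          using fin by (intro fnorm_eq_L2_set[symmetric]) (auto simp: supp_def damp_def)
        also have "\<dots> \<le> fnorm b"
          by (rule fnorm_mono[OF b]) (rule cmod_diff_damp_le)
        finally show "L2_set (\<lambda>m. cmod (cnj (?b m))) ?B \<le> fnorm b" .
        show "L2_set (\<lambda>m. cmod (Mop x a m - f m)) ?B \<le> e / 2"
          using L2_set_le_l2norm[OF d fin] f(2) by linarith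
      qed auto
      also have "cmod (\<Sum>m\<in>?B. cnj (b m) * (f m - damp j f m)) \<le> fnorm b * (e / 2)"
        using elim f(1) fin bB by (intro order_trans[OF cmod_sum_mult_le_L2 mult_mono]) auto
      finally show ?thesis by (simp add: algebra_simps)
    qed
    show ?case
    proof (intro allI impI)
      fix a b assume ab: "fin_supp a" "fin_supp b"
      show "cmod (hform x a (\<lambda>n. b n - damp j b n)) \<le> e * fnorm a * fnorm b"
      proof (cases "fnorm a = 0")
        case True
        then show ?thesis using hleD[OF hle_hnorm[OF xM] ab(1), of "\<lambda>n. b n - damp j b n"] ab by simp
      next
        case False
        then have pos: "fnorm a > 0" using fnorm_nonneg[of a] by linarith
        let ?k = "complex_of_real (1 / fnorm a)"
        have "fnorm (\<lambda>n. ?k * a n) = 1" using pos by (simp only: fnorm_mult norm_of_real) simp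
        then have "cmod (hform x (\<lambda>n. ?k * a n) (\<lambda>n. b n - damp j b n)) \<le> e * fnorm b"
          using ab by (intro unit) (simp_all only: fin_supp_mult order_refl)
        also have "hform x (\<lambda>n. ?k * a n) (\<lambda>n. b n - damp j b n) = ?k * hform x a (\<lambda>n. b n - damp j b n)"
          using ab by (intro hform_mult_left) auto
        finally show ?thesis using pos by (simp add: norm_divide norm_mult field_simps)
      qed
    qed
  qed
qed

text \<open>The estimate for the right slot carries over to the left one by
  \<open>hform_cnj_swap\<close>; each slot contributes \<open>e / 2\<close>.\<close>

lemma M0_diff_damp_small:
  assumes x: "x \<in> M0" and e: "e > 0"
  shows "\<forall>\<^sub>F j in sequentially. hle (\<lambda>n. x n - damp j x n) e"
proof -
  have "\<forall>\<^sub>F j in sequentially. \<forall>a b. fin_supp a \<longrightarrow> fin_supp b \<longrightarrow>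
    cmod (hform x a (\<lambda>n. b n - damp j b n)) \<le> e / 2 * fnorm a * fnorm b"
    using e by (intro M0_hform_damp_right x) auto
  then show ?thesis
  proof eventually_elim
    case (elim j)
    show ?case unfolding hle_def
    proof (intro allI impI)
      fix a b assume ab: "fin_supp a" "fin_supp b"
      have "hform x (\<lambda>n. a n - damp j a n) b
          = hform x (\<lambda>n. cnj (b n)) (\<lambda>n. cnj (a n) - damp j (\<lambda>n. cnj (a n)) n)"
        using ab by (subst hform_cnj_swap) (simp_all add: damp_def)
      then have "cmod (hform x (\<lambda>n. a n - damp j a n) b) \<le> e / 2 * fnorm a * fnorm b"
        using elim[rule_format, of "\<lambda>n. cnj (b n)" "\<lambda>n. cnj (a n)"] ab by (simp add: mult_ac)
      moreover have "cmod (hform x (damp j a) (\<lambda>n. b n - damp j b n)) \<le> e / 2 * fnorm a * fnorm b"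
      proof -
        have "cmod (hform x (damp j a) (\<lambda>n. b n - damp j b n)) \<le> e / 2 * fnorm (damp j a) * fnorm b"
          using elim ab by simp
        also have "\<dots> \<le> e / 2 * fnorm a * fnorm b"
          using e by (intro mult_right_mono mult_left_mono fnorm_damp_le ab) auto
        finally show ?thesis .
      qed
      ultimately have "cmod (hform (\<lambda>n. x n - damp j x n) a b)
          \<le> e / 2 * fnorm a * fnorm b + e / 2 * fnorm a * fnorm b"
        unfolding hform_diff_damp[OF ab] by (rule norm_triangle_mono)
      then show "cmod (hform (\<lambda>n. x n - damp j x n) a b) \<le> e * fnorm a * fnorm b" by simp
    qed
  qed
qed

lemma damp_fin_supp_approx:
  assumes "\<beta> \<in> Mb" "e > 0"
  shows "\<exists>z. fin_supp z \<and> hle (\<lambda>n. damp j \<beta> n - z n) e"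
proof -
  have "e / (hnorm \<beta> + 1) > 0" using assms hnorm_nonneg[OF assms(1)] by simp
  from eventually_happens'[OF sequentially_bot damp_approx_fin_supp[OF this, of j]]
  obtain N where N: "hle (\<lambda>n. damp j \<beta> n - restr {..N} (damp j \<beta>) n) (e / (hnorm \<beta> + 1) * hnorm \<beta>)"
    using assms(1) by blast
  moreover have "e / (hnorm \<beta> + 1) * hnorm \<beta> \<le> e"
    using assms hnorm_nonneg[OF assms(1)] by (simp add: field_simps)
  moreover have "fin_supp (restr {..N} (damp j \<beta>))"
    by (rule fin_supp_restr_finite) (auto simp: damp_def)
  ultimately show ?thesis using hle_mono by blast
qed

text \<open>From left to right, a compact symbol is close to a damped one, and that to a finite
  cut-off. From here on compactness is used in this form, and total boundedness no longer
  appears.\<close>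

lemma M0_iff: "\<alpha> \<in> M0 \<longleftrightarrow> \<alpha> \<in> Mb \<and> (\<forall>e>0. \<exists>z. fin_supp z \<and> hle (\<lambda>n. \<alpha> n - z n) e)"
proof (intro iffI conjI allI impI)
  assume \<alpha>: "\<alpha> \<in> M0"
  then show M: "\<alpha> \<in> Mb" by (simp add: M0_def)
  fix e :: real assume e: "e > 0"
  obtain j where "hle (\<lambda>n. \<alpha> n - damp j \<alpha> n) (e / 2)"
    using eventually_happens'[OF sequentially_bot M0_diff_damp_small[OF \<alpha>, of "e / 2"]] e by auto
  moreover obtain z where "fin_supp z" "hle (\<lambda>n. damp j \<alpha> n - z n) (e / 2)"
    using damp_fin_supp_approx[OF M, of "e / 2"] e by auto
  ultimately show "\<exists>z. fin_supp z \<and> hle (\<lambda>n. \<alpha> n - z n) e"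
    using hle_add[of "\<lambda>n. \<alpha> n - damp j \<alpha> n" "e / 2" "\<lambda>n. damp j \<alpha> n - z n" "e / 2"] by auto
qed (auto intro: M0I)

lemma M0_Mb: "\<alpha> \<in> M0 \<Longrightarrow> \<alpha> \<in> Mb"
  by (simp add: M0_def)

lemma hle_zero [simp]: "0 \<le> C \<Longrightarrow> hle (\<lambda>n. 0) C"
  by (simp add: hle_def hform_def)

lemma fin_supp_M0: "fin_supp z \<Longrightarrow> z \<in> M0"
  unfolding M0_iff by (auto simp: fin_supp_Mb intro!: exI[of _ z])

lemma damp_M0: "\<beta> \<in> Mb \<Longrightarrow> damp j \<beta> \<in> M0"
  unfolding M0_iff by (auto simp: damp_Mb damp_fin_supp_approx)

lemma M0_add:
  assumes "\<alpha> \<in> M0" "\<beta> \<in> M0"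
  shows "(\<lambda>n. \<alpha> n + \<beta> n) \<in> M0"
  unfolding M0_iff
proof (intro conjI allI impI)
  fix e :: real assume "e > 0"
  then have "e / 2 > 0" by simp
  with assms obtain y z where "fin_supp y" "hle (\<lambda>n. \<alpha> n - y n) (e / 2)"
    "fin_supp z" "hle (\<lambda>n. \<beta> n - z n) (e / 2)"
    unfolding M0_iff by blast
  then show "\<exists>z. fin_supp z \<and> hle (\<lambda>n. \<alpha> n + \<beta> n - z n) e"
    using hle_add[of "\<lambda>n. \<alpha> n - y n" "e / 2" "\<lambda>n. \<beta> n - z n" "e / 2"]
    by (intro exI[of _ "\<lambda>n. y n + z n"]) (auto simp: algebra_simps)
qed (use assms in \<open>auto intro: Mb_add M0_Mb\<close>)

lemma M0_mult:
  assumes "\<alpha> \<in> M0"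
  shows "(\<lambda>n. k * \<alpha> n) \<in> M0"
  unfolding M0_iff
proof (intro conjI allI impI)
  fix e :: real assume e: "e > 0"
  have k: "cmod k + 1 > 0" by (simp add: add_nonneg_pos)
  with e have "e / (cmod k + 1) > 0" by simp
  with assms obtain z where z: "fin_supp z" "hle (\<lambda>n. \<alpha> n - z n) (e / (cmod k + 1))"
    unfolding M0_iff by blast
  have "cmod k * (e / (cmod k + 1)) \<le> e" using e k by (simp add: field_simps)
  then have "hle (\<lambda>n. k * (\<alpha> n - z n)) e" using hle_mono[OF hle_mult[OF z(2), of k]] by blast
  then show "\<exists>z. fin_supp z \<and> hle (\<lambda>n. k * \<alpha> n - z n) e"
    using z(1) by (intro exI[of _ "\<lambda>n. k * z n"]) (simp add: algebra_simps)
qed (use assms in \<open>auto intro: Mb_mult M0_Mb\<close>)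

lemma M0_diff: "\<alpha> \<in> M0 \<Longrightarrow> \<beta> \<in> M0 \<Longrightarrow> (\<lambda>n. \<alpha> n - \<beta> n) \<in> M0"
  using M0_add[of \<alpha> "\<lambda>n. - 1 * \<beta> n"] M0_mult[of \<beta> "-1"] by simp

section \<open>The space X\<close>

lemma pair_eq: "finite A \<Longrightarrow> supp c \<subseteq> A \<Longrightarrow> pair \<alpha> c = (\<Sum>n\<in>A. \<alpha> n * c n)"
  unfolding pair_def by (rule sum.mono_neutral_left) (auto simp: supp_def)

lemma pair_add:
  assumes "fin_supp c" "fin_supp d"
  shows "pair \<alpha> (\<lambda>n. c n + d n) = pair \<alpha> c + pair \<alpha> d"
proof -
  let ?A = "supp c \<union> supp d"
  have "finite ?A" using assms by (simp add: fin_supp_def)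
  moreover have "supp (\<lambda>n. c n + d n) \<subseteq> ?A" by (auto simp: supp_def)
  ultimately show ?thesis by (simp add: pair_eq[of ?A] ring_distribs sum.distrib)
qed

lemma pair_mult:
  assumes "fin_supp c"
  shows "pair \<alpha> (\<lambda>n. k * c n) = k * pair \<alpha> c"
proof -
  have "finite (supp c)" using assms by (simp add: fin_supp_def)
  moreover have "supp (\<lambda>n. k * c n) \<subseteq> supp c" by (auto simp: supp_def)
  ultimately show ?thesis by (simp add: pair_eq[of "supp c"] sum_distrib_left mult_ac)
qed

lemma pair_diff:
  assumes "fin_supp c" "fin_supp d"
  shows "pair \<alpha> (\<lambda>n. c n - d n) = pair \<alpha> c - pair \<alpha> d"
  using pair_add[of c "\<lambda>n. - 1 * d n"] pair_mult[of d \<alpha> "-1"] assms by simp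

lemma pair_add_symbol: "pair (\<lambda>n. \<alpha> n + \<beta> n) c = pair \<alpha> c + pair \<beta> c"
  by (simp add: pair_def ring_distribs sum.distrib)

lemma pair_mult_symbol: "pair (\<lambda>n. k * \<alpha> n) c = k * pair \<alpha> c"
  by (simp add: pair_def sum_distrib_left mult_ac)

lemma pair_tendsto:
  assumes "\<And>n. (\<lambda>j. f j n) \<longlonglongrightarrow> \<alpha> n"
  shows "(\<lambda>j. pair (f j) c) \<longlonglongrightarrow> pair \<alpha> c"
  unfolding pair_def by (intro tendsto_sum tendsto_mult tendsto_const assms)

lemma pair_unit [simp]: "pair \<alpha> (unit_seq n) = \<alpha> n"
  by (subst pair_eq[of "{n}"]) (auto simp: supp_def unit_seq_def)

lemma pair_unit_symbol:
  assumes "fin_supp c"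
  shows "pair (unit_seq i) c = c i"
proof -
  have "pair (unit_seq i) c = (\<Sum>n\<in>insert i (supp c). unit_seq i n * c n)"
    using assms by (intro pair_eq) (auto simp: fin_supp_def)
  also have "\<dots> = (\<Sum>n\<in>{i}. unit_seq i n * c n)"
    using assms by (intro sum.mono_neutral_right) (auto simp: fin_supp_def unit_seq_def)
  finally show ?thesis by (simp add: unit_seq_def)
qed

text \<open>A divisor \<open>k\<close> corresponds to the factor pair \<open>(k, n div k)\<close>;
  divisors with a factor outside the supports contribute 0.\<close>

lemma dconv_eq:
  assumes "fin_supp a" "fin_supp b" "n > 0"
  shows "dconv a b n = (\<Sum>(k, l)\<in>{x \<in> supp a \<times> supp b. (\<lambda>(k, l). k * l) x = n}. a k * cnj (b l))"
proof -
  have fin: "finite {x \<in> supp a \<times> supp b. (\<lambda>(k, l). k * l) x = n}"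
    using assms by (simp add: fin_supp_def)
  have "(\<Sum>k\<in>{k. k dvd n}. a k * cnj (b (n div k)))
      = (\<Sum>(k, l)\<in>{x \<in> supp a \<times> supp b. (\<lambda>(k, l). k * l) x = n}. a k * cnj (b l))"
    by (rule sum.reindex_bij_witness_not_neutral[where i=fst and j="\<lambda>k. (k, n div k)"
          and S'="{k. k dvd n \<and> (k \<notin> supp a \<or> n div k \<notin> supp b)}" and T'="{}"])
      (use assms(3) fin in \<open>auto simp: supp_def\<close>)
  then show ?thesis using assms(3) by (simp add: dconv_def)
qed

lemma supp_dconv:
  assumes "fin_supp a" "fin_supp b"
  shows "supp (dconv a b) \<subseteq> (\<lambda>(k, l). k * l) ` (supp a \<times> supp b)"
proof
  fix n assume n: "n \<in> supp (dconv a b)"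
  then have "n > 0" by (auto simp: supp_def dconv_def intro: gr0I)
  show "n \<in> (\<lambda>(k, l). k * l) ` (supp a \<times> supp b)"
  proof (rule ccontr)
    assume "n \<notin> (\<lambda>(k, l). k * l) ` (supp a \<times> supp b)"
    then have "{x \<in> supp a \<times> supp b. (\<lambda>(k, l). k * l) x = n} = {}" by blast
    then have "dconv a b n = 0" by (simp only: dconv_eq[OF assms \<open>n > 0\<close>] sum.empty)
    with n show False by (simp add: supp_def)
  qed
qed

lemma fin_supp_dconv [simp]:
  assumes "fin_supp a" "fin_supp b"
  shows "fin_supp (dconv a b)"
  using finite_subset[OF supp_dconv[OF assms]] assms by (simp add: fin_supp_def dconv_def)

text \<open>Grouping the double sum of the form by the product \<open>k * l\<close> gives the
  convolution. This identity is the link between bounded forms and bounded functionals on the space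
  normed by \<open>Xnorm\<close>.\<close>

lemma pair_dconv:
  assumes "fin_supp a" "fin_supp b"
  shows "pair \<alpha> (dconv a b) = hform \<alpha> a b"
proof -
  let ?S = "supp a \<times> supp b"
  let ?I = "(\<lambda>(k, l). k * l) ` ?S"
  have fin: "finite ?S" using assms by (simp add: fin_supp_def)
  have pos: "n > 0" if "n \<in> ?I" for n
    using that assms by (auto simp: supp_def fin_supp_def intro!: gr0I)
  have "pair \<alpha> (dconv a b) = (\<Sum>n\<in>?I. \<alpha> n * dconv a b n)"
    using fin by (intro pair_eq supp_dconv assms) auto
  also have "\<dots> = (\<Sum>n\<in>?I. \<Sum>(k, l)\<in>{x \<in> ?S. (\<lambda>(k, l). k * l) x = n}. a k * cnj (b l) * \<alpha> (k * l))"
    by (intro sum.cong refl) (auto simp: dconv_eq[OF assms pos] sum_distrib_left mult_ac intro!: sum.cong)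
  also have "\<dots> = (\<Sum>(k, l)\<in>?S. a k * cnj (b l) * \<alpha> (k * l))"
    using fin by (intro sum.group) auto
  also have "\<dots> = hform \<alpha> a b" by (simp add: hform_def sum.cartesian_product)
  finally show ?thesis .
qed

lemma dconv_unit: "n > 0 \<Longrightarrow> dconv (unit_seq 1) (unit_seq n) = unit_seq n"
proof
  fix i assume n: "n > 0"
  have "dconv (unit_seq 1) (unit_seq n) i = pair (unit_seq i) (dconv (unit_seq 1) (unit_seq n))"
    using n by (intro pair_unit_symbol[symmetric] fin_supp_dconv fin_supp_unit) auto
  also have "\<dots> = unit_seq n i" using n by (simp add: pair_dconv hform_unit) (simp add: unit_seq_def)
  finally show "dconv (unit_seq 1) (unit_seq n) i = unit_seq n i" .
qed

definition conv_sum :: "(seq \<times> seq) list \<Rightarrow> seq" where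
  "conv_sum ps = (\<lambda>n. sum_list (map (\<lambda>(a, b). dconv a b n) ps))"

definition cost :: "(seq \<times> seq) list \<Rightarrow> real" where
  "cost ps = sum_list (map (\<lambda>(a, b). fnorm a * fnorm b) ps)"

lemma rep_iff: "rep ps c \<longleftrightarrow> (\<forall>(a, b)\<in>set ps. fin_supp a \<and> fin_supp b) \<and> c = conv_sum ps"
  by (simp add: rep_def conv_sum_def)

lemma cost_nonneg: "0 \<le> cost ps"
  by (auto simp: cost_def intro!: sum_list_nonneg)

lemma rep_fin_supp_pair:
  assumes "rep ps c"
  shows "fin_supp c \<and> pair \<alpha> c = sum_list (map (\<lambda>(a, b). hform \<alpha> a b) ps)"
  using assms
proof (induction ps arbitrary: c)
  case Nil
  then show ?case by (simp add: rep_def pair_def)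
next
  case (Cons p ps)
  obtain a b where p: "p = (a, b)" by (cases p)
  have ab: "fin_supp a" "fin_supp b" and ps: "rep ps (conv_sum ps)"
    and c: "c = (\<lambda>n. dconv a b n + conv_sum ps n)"
    using Cons.prems p by (auto simp: rep_iff conv_sum_def)
  show ?case unfolding c using Cons.IH[OF ps] ab p by (simp add: pair_add pair_dconv)
qed

lemma rep_append: "rep ps c \<Longrightarrow> rep qs d \<Longrightarrow> rep (ps @ qs) (\<lambda>n. c n + d n)"
  by (auto simp: rep_def)

lemma rep_mult:
  assumes "rep ps c"
  shows "rep (map (\<lambda>(a, b). (\<lambda>n. k * a n, b)) ps) (\<lambda>n. k * c n)"
proof -
  have "dconv (\<lambda>n. k * a n) b n = k * dconv a b n" for a b n
    by (simp add: dconv_def sum_distrib_left mult_ac)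
  then have "(\<lambda>n. k * conv_sum ps n) = conv_sum (map (\<lambda>(a, b). (\<lambda>n. k * a n, b)) ps)"
    unfolding conv_sum_def by (induction ps) (auto simp: fun_eq_iff algebra_simps)
  with assms show ?thesis by (auto simp: rep_iff)
qed

lemma cost_append: "cost (ps @ qs) = cost ps + cost qs"
  by (simp add: cost_def)

lemma cost_mult: "cost (map (\<lambda>(a, b). (\<lambda>n. k * a n, b)) ps) = cmod k * cost ps"
  unfolding cost_def by (induction ps) (auto simp: fnorm_mult algebra_simps)

text \<open>Convolution with the unit vector at 1 reproduces every unit vector, so convolutions
  enlarge only the norm structure and not the set.\<close>

lemma Xset_eq: "Xset = Collect fin_supp"
proof
  show "Xset \<subseteq> Collect fin_supp" using rep_fin_supp_pair by (auto simp: Xset_def)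
  have "c \<in> Xset" if "fin_supp c" for c
    using that
  proof (induction rule: fin_supp_induct)
    case zero
    show ?case unfolding Xset_def by (auto intro!: exI[of _ "[]"] simp: rep_def)
  next
    case (step x k n)
    then obtain ps where "rep ps x" by (auto simp: Xset_def)
    moreover have "rep [(unit_seq 1, unit_seq n)] (unit_seq n)"
      using step dconv_unit[of n] by (auto simp: rep_def)
    ultimately show ?case unfolding Xset_def using rep_append rep_mult by blast
  qed
  then show "Collect fin_supp \<subseteq> Xset" by blast
qed

lemma Xnorm_eq: "Xnorm c = Inf {cost ps | ps. rep ps c}"
  by (simp add: Xnorm_def cost_def)

lemma Xnorm_le: "rep ps c \<Longrightarrow> Xnorm c \<le> cost ps"
  unfolding Xnorm_eq by (rule cInf_lower) (auto simp: bdd_below_def intro: cost_nonneg)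

lemma Xnorm_greatest:
  assumes "fin_supp c" "\<And>ps. rep ps c \<Longrightarrow> C \<le> cost ps"
  shows "C \<le> Xnorm c"
proof -
  obtain ps where "rep ps c" using assms Xset_eq by (auto simp: Xset_def)
  then show ?thesis unfolding Xnorm_eq by (intro cInf_greatest) (use assms in auto)
qed

lemma Xnorm_nonneg: "fin_supp c \<Longrightarrow> 0 \<le> Xnorm c"
  by (intro Xnorm_greatest cost_nonneg)

lemma Xnorm_add:
  assumes "fin_supp c" "fin_supp d"
  shows "Xnorm (\<lambda>n. c n + d n) \<le> Xnorm c + Xnorm d"
proof -
  have "Xnorm (\<lambda>n. c n + d n) - cost qs \<le> Xnorm c" if qs: "rep qs d" for qs
  proof (rule Xnorm_greatest[OF assms(1)])
    fix ps assume "rep ps c"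
    from Xnorm_le[OF rep_append[OF this qs]]
    show "Xnorm (\<lambda>n. c n + d n) - cost qs \<le> cost ps" by (simp add: cost_append)
  qed
  then have "Xnorm (\<lambda>n. c n + d n) - Xnorm c \<le> Xnorm d"
    by (intro Xnorm_greatest assms) (simp add: algebra_simps)
  then show ?thesis by simp
qed

lemma Xnorm_mult:
  assumes "fin_supp c"
  shows "Xnorm (\<lambda>n. k * c n) = cmod k * Xnorm c"
proof -
  have le: "Xnorm (\<lambda>n. k * c n) \<le> cmod k * Xnorm c" if c: "fin_supp c" and k: "k \<noteq> 0" for k c
  proof -
    have "Xnorm (\<lambda>n. k * c n) / cmod k \<le> Xnorm c"
    proof (rule Xnorm_greatest[OF c])
      fix ps assume "rep ps c"
      from Xnorm_le[OF rep_mult[OF this, of k]]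
      show "Xnorm (\<lambda>n. k * c n) / cmod k \<le> cost ps" using k by (simp add: cost_mult field_simps)
    qed
    then show ?thesis using k by (simp add: field_simps)
  qed
  show ?thesis
  proof (cases "k = 0")
    case True
    have "Xnorm (\<lambda>n. 0) \<le> cost []" by (rule Xnorm_le) (simp add: rep_def)
    then show ?thesis using True Xnorm_nonneg[of "\<lambda>n. 0"] by (simp add: cost_def)
  next
    case False
    have "Xnorm c \<le> cmod (inverse k) * Xnorm (\<lambda>n. k * c n)"
      using le[of "\<lambda>n. k * c n" "inverse k"] False assms by (simp add: mult.assoc[symmetric])
    then have "cmod k * Xnorm c \<le> Xnorm (\<lambda>n. k * c n)"
      using False by (simp add: norm_divide field_simps)
    with le[OF assms False] show ?thesis by simp
  qed
qed

lemma Xnorm_dconv: "fin_supp a \<Longrightarrow> fin_supp b \<Longrightarrow> Xnorm (dconv a b) \<le> fnorm a * fnorm b"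
  using Xnorm_le[of "[(a, b)]"] by (simp add: rep_def cost_def)

lemma pair_le_Xnorm:
  assumes \<alpha>: "hle \<alpha> C" and c: "fin_supp c"
  shows "cmod (pair \<alpha> c) \<le> C * Xnorm c"
proof -
  have C: "0 \<le> C" using hle_nonneg[OF \<alpha>] .
  have le: "cmod (pair \<alpha> c) \<le> C * cost ps" if ps: "rep ps c" for ps
  proof -
    have "cmod (sum_list (map (\<lambda>(a, b). hform \<alpha> a b) ps)) \<le> C * cost ps"
      if "\<forall>(a, b)\<in>set ps. fin_supp a \<and> fin_supp b" for ps
      using that
    proof (induction ps)
      case (Cons p ps)
      then show ?case using hleD[OF \<alpha>, of "fst p" "snd p"]
        by (cases p) (auto simp: cost_def ring_distribs mult.assoc intro: norm_triangle_mono)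
    qed (simp add: cost_def)
    then show ?thesis using ps rep_fin_supp_pair[OF ps] by (simp add: rep_def)
  qed
  show ?thesis
  proof (cases "C = 0")
    case True
    obtain ps where "rep ps c" using c Xset_eq by (auto simp: Xset_def)
    from le[OF this] True show ?thesis by simp
  next
    case False
    then have "cmod (pair \<alpha> c) / C \<le> Xnorm c"
      using C le by (intro Xnorm_greatest c) (simp add: field_simps)
    then show ?thesis using False C by (simp add: field_simps)
  qed
qed

section \<open>Sublinear functionals and the Hahn-Banach theorem\<close>

definition sublin :: "(seq \<Rightarrow> real) \<Rightarrow> bool" where
  "sublin q \<longleftrightarrow> (\<forall>x y. fin_supp x \<longrightarrow> fin_supp y \<longrightarrow> q (\<lambda>i. x i + y i) \<le> q x + q y) \<and>
    (\<forall>x t. fin_supp x \<longrightarrow> 0 \<le> t \<longrightarrow> q (\<lambda>i. of_real t * x i) = t * q x)"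

lemma sublin_add: "sublin q \<Longrightarrow> fin_supp x \<Longrightarrow> fin_supp y \<Longrightarrow> q (\<lambda>i. x i + y i) \<le> q x + q y"
  by (simp add: sublin_def)

lemma sublin_mult: "sublin q \<Longrightarrow> fin_supp x \<Longrightarrow> 0 \<le> t \<Longrightarrow> q (\<lambda>i. of_real t * x i) = t * q x"
  by (simp add: sublin_def)

lemma sublin_zero: "sublin q \<Longrightarrow> q (\<lambda>i. 0) = 0"
  using sublin_mult[of q "\<lambda>i. 0" 0] by simp

lemma sublin_neg_le:
  assumes "sublin q" "fin_supp x"
  shows "- q (\<lambda>i. - x i) \<le> q x"
  using sublin_add[OF assms(1), of x "\<lambda>i. - x i"] sublin_zero[OF assms(1)] assms(2) by simp

text \<open>The standard lowering of \<open>q\<close> along the ray of \<open>y\<close>. The result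
  stays sublinear and below \<open>q\<close>, and its value at \<open>- y\<close> is at most
  \<open>- q y\<close>; a linear functional below it must therefore take the value
  \<open>q y\<close> at \<open>y\<close>.\<close>

definition linearize :: "(seq \<Rightarrow> real) \<Rightarrow> seq \<Rightarrow> seq \<Rightarrow> real" where
  "linearize q y x = (INF t\<in>{0..}. q (\<lambda>i. x i + of_real t * y i) - t * q y)"

context
  fixes q :: "seq \<Rightarrow> real" and y :: seq
  assumes q: "sublin q" and y: "fin_supp y"
begin

lemma linearize_bdd:
  assumes x: "fin_supp x"
  shows "bdd_below ((\<lambda>t. q (\<lambda>i. x i + of_real t * y i) - t * q y) ` {0..})"
proof (rule bdd_belowI2[of _ "- q (\<lambda>i. - x i)"])
  fix t :: real assume t: "t \<in> {0..}"
  have "t * q y = q (\<lambda>i. of_real t * y i)" using sublin_mult[OF q y] t by simp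
  also have "\<dots> \<le> q (\<lambda>i. x i + of_real t * y i) + q (\<lambda>i. - x i)"
    using sublin_add[OF q, of "\<lambda>i. x i + of_real t * y i" "\<lambda>i. - x i"] x y by simp
  finally show "- q (\<lambda>i. - x i) \<le> q (\<lambda>i. x i + of_real t * y i) - t * q y" by simp
qed

lemma linearize_lower:
  "fin_supp x \<Longrightarrow> 0 \<le> t \<Longrightarrow> linearize q y x \<le> q (\<lambda>i. x i + of_real t * y i) - t * q y"
  unfolding linearize_def by (rule cINF_lower[OF linearize_bdd]) auto

lemma linearize_greatest:
  "(\<And>t. 0 \<le> t \<Longrightarrow> C \<le> q (\<lambda>i. x i + of_real t * y i) - t * q y) \<Longrightarrow> C \<le> linearize q y x"
  unfolding linearize_def by (rule cINF_greatest) auto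

lemma linearize_le: "fin_supp x \<Longrightarrow> linearize q y x \<le> q x"
  using linearize_lower[of x 0] by simp

lemma linearize_neg: "linearize q y (\<lambda>i. - y i) \<le> - q y"
  using linearize_lower[of "\<lambda>i. - y i" 1] sublin_zero[OF q] y by simp

lemma sublin_linearize: "sublin (linearize q y)"
  unfolding sublin_def
proof (intro conjI allI impI)
  fix x z assume x: "fin_supp x" and z: "fin_supp z"
  \<comment> \<open>The infima are removed one at a time, over \<open>t\<close> for fixed
    \<open>s\<close> and then over \<open>s\<close>; the sum \<open>t + s\<close> is the parameter
    at which the left side is tested.\<close>
  have "linearize q y (\<lambda>i. x i + z i) - (q (\<lambda>i. z i + of_real s * y i) - s * q y) \<le> linearize q y x"
    if s: "0 \<le> s" for s
  proof (rule linearize_greatest)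
    fix t :: real assume t: "0 \<le> t"
    have "linearize q y (\<lambda>i. x i + z i) \<le> q (\<lambda>i. x i + z i + of_real (t + s) * y i) - (t + s) * q y"
      using x z s t by (intro linearize_lower) auto
    also have "(\<lambda>i. x i + z i + of_real (t + s) * y i)
        = (\<lambda>i. (x i + of_real t * y i) + (z i + of_real s * y i))"
      by (simp add: algebra_simps)
    also have "q \<dots> \<le> q (\<lambda>i. x i + of_real t * y i) + q (\<lambda>i. z i + of_real s * y i)"
      using x y z by (intro sublin_add[OF q]) auto
    finally show "linearize q y (\<lambda>i. x i + z i) - (q (\<lambda>i. z i + of_real s * y i) - s * q y)
        \<le> q (\<lambda>i. x i + of_real t * y i) - t * q y"
      by (simp add: algebra_simps)
  qed
  then have "linearize q y (\<lambda>i. x i + z i) - linearize q y x \<le> linearize q y z"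
    by (intro linearize_greatest) (simp add: algebra_simps)
  then show "linearize q y (\<lambda>i. x i + z i) \<le> linearize q y x + linearize q y z" by simp
next
  fix x and t :: real assume x: "fin_supp x" and t: "0 \<le> t"
  have le: "linearize q y (\<lambda>i. of_real t * x i) \<le> t * linearize q y x"
    if x: "fin_supp x" and t: "0 < t" for x t
  proof -
    have "linearize q y (\<lambda>i. of_real t * x i) / t \<le> linearize q y x"
    proof (rule linearize_greatest)
      fix s :: real assume s: "0 \<le> s"
      have "linearize q y (\<lambda>i. of_real t * x i)
          \<le> q (\<lambda>i. of_real t * x i + of_real (t * s) * y i) - (t * s) * q y"
        using x s t by (intro linearize_lower) auto
      also have "(\<lambda>i. of_real t * x i + of_real (t * s) * y i)
          = (\<lambda>i. of_real t * (x i + of_real s * y i))"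
        by (simp add: algebra_simps)
      also have "q \<dots> = t * q (\<lambda>i. x i + of_real s * y i)"
        using x y t by (intro sublin_mult[OF q]) auto
      finally show "linearize q y (\<lambda>i. of_real t * x i) / t
          \<le> q (\<lambda>i. x i + of_real s * y i) - s * q y"
        using t by (simp add: field_simps)
    qed
    then show ?thesis using t by (simp add: field_simps)
  qed
  show "linearize q y (\<lambda>i. of_real t * x i) = t * linearize q y x"
  proof (cases "t = 0")
    case True
    have "linearize q y (\<lambda>i. 0) = 0"
    proof (rule antisym)
      show "linearize q y (\<lambda>i. 0) \<le> 0" using linearize_le[of "\<lambda>i. 0"] sublin_zero[OF q] by simp
      show "0 \<le> linearize q y (\<lambda>i. 0)"
        using sublin_mult[OF q y] by (intro linearize_greatest) simp
    qed
    then show ?thesis using True by simp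
  next
    case False
    then have t: "0 < t" using t by simp
    have "linearize q y x \<le> inverse t * linearize q y (\<lambda>i. of_real t * x i)"
      using le[of "\<lambda>i. of_real t * x i" "inverse t"] x t by (simp add: mult.assoc[symmetric])
    then have "t * linearize q y x \<le> linearize q y (\<lambda>i. of_real t * x i)"
      using t by (simp add: field_simps)
    with le[OF x t] show ?thesis by simp
  qed
qed

end

lemma complex_mult_split: "k * z = of_real (Re k) * z + of_real (Im k) * (\<i> * z)"
  by (simp add: complex_eq_iff)

text \<open>The Hahn--Banach theorem for the space of finitely supported sequences. As that space has
  countable dimension, one can make the sublinear functional linear along one basis vector after
  the other and pass to the limit.\<close>
lemma sublin_dominates_linear:
  assumes p: "sublin p" and c: "fin_supp c"
  obtains u where "\<And>x. fin_supp x \<Longrightarrow> u x \<le> p x" "u c = p c"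
    "\<And>x y. fin_supp x \<Longrightarrow> fin_supp y \<Longrightarrow> u (\<lambda>i. x i + y i) = u x + u y"
    "\<And>x t. fin_supp x \<Longrightarrow> u (\<lambda>i. of_real t * x i) = t * u x"
proof -
  \<comment> \<open>Direction 0 is \<open>c\<close>, so that the value \<open>p c\<close> is fixed
    before anything else is lowered. After that, the odd index \<open>Suc (2 * (n - 1))\<close>
    gives the unit vector at \<open>n\<close> and the even index \<open>2 * n\<close> its multiple
    by \<open>\<i>\<close>: a basis over the reals.\<close>
  define y :: "nat \<Rightarrow> seq" where "y k = (if k = 0 then c else if even k
      then (\<lambda>i. \<i> * unit_seq (k div 2) i) else unit_seq (Suc (k div 2)))" for k
  have fy: "fin_supp (y k)" for k
    using c by (auto simp: y_def elim!: evenE intro!: fin_supp_mult fin_supp_unit)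
  define Q where "Q k = rec_nat p (\<lambda>k q. linearize q (y k)) k" for k
  have Q0: "Q 0 = p" and QS: "Q (Suc k) = linearize (Q k) (y k)" for k by (auto simp: Q_def)
  have sQ: "sublin (Q k)" for k
    by (induction k) (auto simp: Q0 QS p fy intro: sublin_linearize)
  have dec: "Q (Suc k) x \<le> Q k x" if "fin_supp x" for k x
    unfolding QS by (rule linearize_le[OF sQ fy that])
  have decs: "decseq (\<lambda>k. Q k x)" if "fin_supp x" for x
    using dec[OF that] by (intro decseq_SucI)
  define u where "u x = lim (\<lambda>k. Q k x)" for x
  have lb: "- p (\<lambda>i. - x i) \<le> Q k x" if x: "fin_supp x" for k x
  proof -
    have "Q k (\<lambda>i. - x i) \<le> p (\<lambda>i. - x i)"
      using decseqD[OF decs[of "\<lambda>i. - x i"], of 0 k] x by (simp add: Q0)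
    then show ?thesis using sublin_neg_le[OF sQ x, of k] by linarith
  qed
  have lim: "(\<lambda>k. Q k x) \<longlonglongrightarrow> u x" if x: "fin_supp x" for x
  proof -
    obtain L where "(\<lambda>k. Q k x) \<longlonglongrightarrow> L"
      using decseq_convergent[OF decs[OF x], of "- p (\<lambda>i. - x i)"] lb[OF x] by blast
    then show ?thesis unfolding u_def by (simp add: limI)
  qed
  have uQ: "u x \<le> Q k x" if x: "fin_supp x" for x k
    by (rule decseq_ge[OF decs[OF x] lim[OF x]])
  have su: "sublin u"
    unfolding sublin_def
  proof (intro conjI allI impI)
    fix x z assume xz: "fin_supp x" "fin_supp z"
    show "u (\<lambda>i. x i + z i) \<le> u x + u z"
      by (rule LIMSEQ_le[OF lim tendsto_add[OF lim lim]]) (use xz sublin_add[OF sQ] in auto)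
  next
    fix x and t :: real assume x: "fin_supp x" "0 \<le> t"
    have "(\<lambda>k. Q k (\<lambda>i. of_real t * x i)) \<longlonglongrightarrow> t * u x"
      using tendsto_mult[OF tendsto_const lim[OF x(1)], of t] by (simp add: sublin_mult[OF sQ] x)
    then show "u (\<lambda>i. of_real t * x i) = t * u x"
      by (rule LIMSEQ_unique[OF lim[OF fin_supp_mult[OF x(1)]]])
  qed
  \<comment> \<open>The inequality gained at stage \<open>k\<close> survives the later stages
    because these only decrease the functional.\<close>
  have neg: "u (\<lambda>i. - y k i) \<le> - u (y k)" for k
  proof -
    have "u (\<lambda>i. - y k i) \<le> Q (Suc k) (\<lambda>i. - y k i)" by (intro uQ fin_supp_uminus fy)
    also have "\<dots> \<le> - Q k (y k)" unfolding QS by (rule linearize_neg[OF sQ fy])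
    also have "\<dots> \<le> - u (y k)" using uQ[OF fy, of k k] by simp
    finally show ?thesis .
  qed
  have addN: "u (\<lambda>i. x i + z i) = u x + u z"
    if x: "fin_supp x" "u (\<lambda>i. - x i) \<le> - u x" and z: "fin_supp z" for x z
  proof -
    have "u z \<le> u (\<lambda>i. x i + z i) + u (\<lambda>i. - x i)"
      using sublin_add[OF su, of "\<lambda>i. x i + z i" "\<lambda>i. - x i"] x z by simp
    then show ?thesis using x(2) sublin_add[OF su x(1) z] by simp
  qed
  have addP: "u (\<lambda>i. - (x i + z i)) \<le> - u (\<lambda>i. x i + z i)"
    if "fin_supp x" "fin_supp z" "u (\<lambda>i. - x i) \<le> - u x" "u (\<lambda>i. - z i) \<le> - u z" for x z
    using sublin_add[OF su, of "\<lambda>i. - x i" "\<lambda>i. - z i"] addN[OF that(1,3,2)] that by simp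
  have sc: "u (\<lambda>i. - (of_real t * y k i)) \<le> - u (\<lambda>i. of_real t * y k i)" for t k
  proof (cases "0 \<le> t")
    case True
    have "u (\<lambda>i. - (of_real t * y k i)) = t * u (\<lambda>i. - y k i)"
      using sublin_mult[OF su, of "\<lambda>i. - y k i" t] True fy by simp
    then show ?thesis using sublin_mult[OF su fy True, of k] mult_left_mono[OF neg True, of k] by simp
  next
    case False
    then have t: "0 \<le> - t" by simp
    have "u (\<lambda>i. of_real t * y k i) = - t * u (\<lambda>i. - y k i)"
      using sublin_mult[OF su, of "\<lambda>i. - y k i" "- t"] t fy by simp
    moreover have "u (\<lambda>i. - (of_real t * y k i)) = - t * u (y k)"
      using sublin_mult[OF su fy t, of k] by simp
    ultimately show ?thesis using mult_left_mono[OF neg t, of k] by simp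
  qed
  \<comment> \<open>Vectors along which the sublinear \<open>u\<close> is odd are closed under sums,
    and real multiples of the directions \<open>y k\<close> are among them; hence they exhaust the
    space, and oddness yields additivity by \<open>addN\<close>.\<close>
  have N: "u (\<lambda>i. - x i) \<le> - u x" if "fin_supp x" for x
    using that
  proof (induction rule: fin_supp_induct)
    case zero
    then show ?case using sublin_zero[OF su] by simp
  next
    case (step x k n)
    let ?v = "\<lambda>i. of_real (Re k) * y (Suc (2 * (n - 1))) i" and ?w = "\<lambda>i. of_real (Im k) * y (2 * n) i"
    have y1: "y (Suc (2 * (n - 1))) = unit_seq n" using step by (simp add: y_def)
    have y2: "y (2 * n) = (\<lambda>i. \<i> * unit_seq n i)" using step by (simp add: y_def)
    have dec: "k * unit_seq n i = ?v i + ?w i" for i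
      unfolding y1 y2 by (rule complex_mult_split)
    have v: "fin_supp ?v" and w: "fin_supp ?w" by (intro fin_supp_mult fy)+
    have "u (\<lambda>i. - (?v i + ?w i)) \<le> - u (\<lambda>i. ?v i + ?w i)" by (rule addP[OF v w sc sc])
    from addP[OF step.hyps(1) fin_supp_add[OF v w] step.IH this]
    show ?case unfolding dec .
  qed
  show thesis
  proof (rule that)
    show up: "u x \<le> p x" if "fin_supp x" for x using uQ[OF that, of 0] by (simp add: Q0)
    have "u (\<lambda>i. - c i) \<le> Q 1 (\<lambda>i. - c i)" using c by (intro uQ) simp
    also have "\<dots> \<le> - p c" using linearize_neg[OF sQ fy, of 0 0] QS[of 0] by (simp add: Q0 y_def)
    finally show "u c = p c" using sublin_neg_le[OF su c] up[OF c] by linarith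
    show add: "u (\<lambda>i. x i + z i) = u x + u z" if "fin_supp x" "fin_supp z" for x z
      using addN[OF that(1) N that(2)] that by blast
    show "u (\<lambda>i. of_real t * x i) = t * u x" if x: "fin_supp x" for x t
    proof (cases "0 \<le> t")
      case True
      then show ?thesis by (rule sublin_mult[OF su x])
    next
      case False
      then have "u (\<lambda>i. - (of_real t * x i)) = - t * u x"
        using sublin_mult[OF su x, of "- t"] by simp
      then show ?thesis
        using add[of "\<lambda>i. of_real t * x i" "\<lambda>i. - (of_real t * x i)"] sublin_zero[OF su] x by simp
    qed
  qed
qed

text \<open>A norming functional for \<open>c\<close> is read as a symbol through its values at unit
  vectors; \<open>Xnorm_dconv\<close> turns its bound into a bound on the form. The symbol obtained
  is only known to be bounded, so \<open>dnorm_Lmap\<close> still has to damp it into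
  \<open>M0\<close>.\<close>

lemma Xnorm_attained:
  assumes c: "fin_supp c"
  obtains \<alpha> where "\<alpha> \<in> Mb" "hle \<alpha> 1" "Xnorm c \<le> cmod (pair \<alpha> c)"
proof -
  have "sublin Xnorm"
    unfolding sublin_def by (auto simp: Xnorm_add Xnorm_mult)
  obtain u where le: "\<And>x. fin_supp x \<Longrightarrow> u x \<le> Xnorm x" and uc: "u c = Xnorm c"
    and add: "\<And>x y. fin_supp x \<Longrightarrow> fin_supp y \<Longrightarrow> u (\<lambda>i. x i + y i) = u x + u y"
    and mult: "\<And>x t. fin_supp x \<Longrightarrow> u (\<lambda>i. of_real t * x i) = t * u x"
    by (rule sublin_dominates_linear[OF \<open>sublin Xnorm\<close> c]) blast
  \<comment> \<open>The usual complex-linear functional with real part \<open>u\<close>.\<close>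
  define \<psi> where "\<psi> x = Complex (u x) (- u (\<lambda>i. \<i> * x i))" for x
  have \<psi>_add: "\<psi> (\<lambda>i. x i + z i) = \<psi> x + \<psi> z" if "fin_supp x" "fin_supp z" for x z
    using that add[of x z] add[of "\<lambda>i. \<i> * x i" "\<lambda>i. \<i> * z i"]
    by (simp add: \<psi>_def complex_eq_iff ring_distribs)
  have \<psi>_mult: "\<psi> (\<lambda>i. k * x i) = k * \<psi> x" if x: "fin_supp x" for k x
  proof -
    have split: "u (\<lambda>i. w * x i) = Re w * u x + Im w * u (\<lambda>i. \<i> * x i)" for w
    proof -
      have "(\<lambda>i. w * x i) = (\<lambda>i. of_real (Re w) * x i + of_real (Im w) * (\<i> * x i))"
        by (subst complex_mult_split[of w]) (rule refl)
      then show ?thesis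
        using add[of "\<lambda>i. of_real (Re w) * x i" "\<lambda>i. of_real (Im w) * (\<i> * x i)"] mult x by simp
    qed
    show ?thesis
      using split[of k] split[of "\<i> * k"] by (simp add: \<psi>_def complex_eq_iff mult.assoc algebra_simps)
  qed
  define \<alpha> where "\<alpha> n = (if n = 0 then 0 else \<psi> (unit_seq n))" for n
  have pair: "pair \<alpha> x = \<psi> x" if "fin_supp x" for x
    using that
  proof (induction rule: fin_supp_induct)
    case zero
    then show ?case using \<psi>_mult[of "\<lambda>i. 0" 0] by (simp add: pair_def)
  next
    case (step x k n)
    then show ?case by (simp add: pair_add pair_mult \<psi>_add \<psi>_mult \<alpha>_def)
  qed
  have \<psi>_le: "cmod (\<psi> x) \<le> Xnorm x" if x: "fin_supp x" for x
  proof (cases "\<psi> x = 0")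
    case True
    then show ?thesis by (simp add: Xnorm_nonneg x)
  next
    case False
    define w where "w = cnj (\<psi> x) / of_real (cmod (\<psi> x))"
    have w: "cmod w = 1" using False by (simp add: w_def norm_divide)
    have "w * \<psi> x = of_real ((cmod (\<psi> x))\<^sup>2) / of_real (cmod (\<psi> x))"
      unfolding complex_norm_square by (simp add: w_def)
    then have "w * \<psi> x = of_real (cmod (\<psi> x))" using False by (simp add: power2_eq_square)
    then have "cmod (\<psi> x) = Re (\<psi> (\<lambda>i. w * x i))" using \<psi>_mult[OF x] by simp
    also have "\<dots> = u (\<lambda>i. w * x i)" by (simp add: \<psi>_def)
    also have "\<dots> \<le> Xnorm (\<lambda>i. w * x i)" using x by (intro le) simp
    also have "\<dots> = Xnorm x" using x w by (simp add: Xnorm_mult)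
    finally show ?thesis .
  qed
  have "hle \<alpha> 1"
    unfolding hle_def
  proof (intro allI impI)
    fix a b assume ab: "fin_supp a" "fin_supp b"
    have "cmod (hform \<alpha> a b) \<le> Xnorm (dconv a b)"
      using \<psi>_le[of "dconv a b"] pair[of "dconv a b"] pair_dconv[OF ab, of \<alpha>] ab by simp
    also have "\<dots> \<le> fnorm a * fnorm b" by (rule Xnorm_dconv[OF ab])
    finally show "cmod (hform \<alpha> a b) \<le> 1 * fnorm a * fnorm b" by simp
  qed
  moreover from this have "\<alpha> \<in> Mb" by (auto simp: Mb_iff \<alpha>_def)
  moreover have "Xnorm c \<le> cmod (pair \<alpha> c)"
    using pair[OF c] uc complex_Re_le_cmod[of "\<psi> c"] by (simp add: \<psi>_def)
  ultimately show thesis using that by blast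
qed

section \<open>The dual of the compact symbols\<close>

lemma M0dual_add: "\<phi> \<in> M0dual \<Longrightarrow> \<alpha> \<in> M0 \<Longrightarrow> \<beta> \<in> M0 \<Longrightarrow> \<phi> (\<lambda>n. \<alpha> n + \<beta> n) = \<phi> \<alpha> + \<phi> \<beta>"
  by (simp add: M0dual_def)

lemma M0dual_mult: "\<phi> \<in> M0dual \<Longrightarrow> \<alpha> \<in> M0 \<Longrightarrow> \<phi> (\<lambda>n. k * \<alpha> n) = k * \<phi> \<alpha>"
  by (simp add: M0dual_def)

lemma M0dual_diff:
  "\<phi> \<in> M0dual \<Longrightarrow> \<alpha> \<in> M0 \<Longrightarrow> \<beta> \<in> M0 \<Longrightarrow> \<phi> (\<lambda>n. \<alpha> n - \<beta> n) = \<phi> \<alpha> - \<phi> \<beta>"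
  using M0dual_add[of \<phi> \<alpha> "\<lambda>n. - 1 * \<beta> n"] M0dual_mult[of \<phi> \<beta> "-1"] M0_mult[of \<beta> "-1"] by simp

lemma zero_M0: "(\<lambda>n. 0) \<in> M0"
  by (simp add: fin_supp_M0)

lemma hnorm_zero: "hnorm (\<lambda>n. 0) = 0"
  using hnorm_le[OF hle_zero[OF order_refl]] hnorm_nonneg[OF M0_Mb[OF zero_M0]] by simp

lemma M0dual_zero: "\<phi> \<in> M0dual \<Longrightarrow> \<phi> (\<lambda>n. 0) = 0"
  using M0dual_mult[of \<phi> "\<lambda>n. 0" 0] zero_M0 by simp

lemma dnorm_le:
  assumes "0 \<le> C" "\<And>\<alpha>. \<alpha> \<in> M0 \<Longrightarrow> cmod (\<phi> \<alpha>) \<le> C * hnorm \<alpha>"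
  shows "dnorm \<phi> \<le> C"
  unfolding dnorm_def
proof (rule cSup_least)
  show "{cmod (\<phi> \<alpha>) |\<alpha>. \<alpha> \<in> M0 \<and> hnorm \<alpha> \<le> 1} \<noteq> {}"
    using zero_M0 hnorm_zero by force
  fix r assume "r \<in> {cmod (\<phi> \<alpha>) |\<alpha>. \<alpha> \<in> M0 \<and> hnorm \<alpha> \<le> 1}"
  then obtain \<alpha> where \<alpha>: "r = cmod (\<phi> \<alpha>)" "\<alpha> \<in> M0" "hnorm \<alpha> \<le> 1" by blast
  then show "r \<le> C" using assms(2)[of \<alpha>] mult_left_le[of "hnorm \<alpha>" C] assms(1) by simp
qed

lemma dnorm_upper:
  assumes "\<phi> \<in> M0dual" "\<alpha> \<in> M0" "hnorm \<alpha> \<le> 1"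
  shows "cmod (\<phi> \<alpha>) \<le> dnorm \<phi>"
  unfolding dnorm_def
proof (rule cSup_upper)
  obtain C where C: "\<And>\<alpha>. \<alpha> \<in> M0 \<Longrightarrow> cmod (\<phi> \<alpha>) \<le> C * hnorm \<alpha>"
    using assms(1) unfolding M0dual_def by blast
  show "bdd_above {cmod (\<phi> \<alpha>) |\<alpha>. \<alpha> \<in> M0 \<and> hnorm \<alpha> \<le> 1}"
  proof (rule bdd_aboveI)
    fix r assume "r \<in> {cmod (\<phi> \<alpha>) |\<alpha>. \<alpha> \<in> M0 \<and> hnorm \<alpha> \<le> 1}"
    then obtain \<beta> where \<beta>: "r = cmod (\<phi> \<beta>)" "\<beta> \<in> M0" "hnorm \<beta> \<le> 1" by blast
    have "r \<le> C * hnorm \<beta>" using C \<beta> by simp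
    also have "\<dots> \<le> \<bar>C\<bar> * hnorm \<beta>" using hnorm_nonneg[OF M0_Mb[OF \<beta>(2)]] by (intro mult_right_mono) auto
    also have "\<dots> \<le> \<bar>C\<bar>" using \<beta> by (intro mult_left_le) auto
    finally show "r \<le> \<bar>C\<bar>" .
  qed
qed (use assms in blast)

lemma dnorm_nonneg: "\<phi> \<in> M0dual \<Longrightarrow> 0 \<le> dnorm \<phi>"
  by (rule order_trans[OF norm_ge_zero dnorm_upper[OF _ zero_M0]]) (simp_all add: hnorm_zero)

lemma dnorm_bound:
  assumes \<phi>: "\<phi> \<in> M0dual" and \<alpha>: "\<alpha> \<in> M0"
  shows "cmod (\<phi> \<alpha>) \<le> dnorm \<phi> * hnorm \<alpha>"
proof (cases "hnorm \<alpha> = 0")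
  case True
  obtain C where C: "\<And>\<alpha>. \<alpha> \<in> M0 \<Longrightarrow> cmod (\<phi> \<alpha>) \<le> C * hnorm \<alpha>"
    using \<phi> unfolding M0dual_def by blast
  from C[OF \<alpha>] True show ?thesis by simp
next
  case False
  then have pos: "hnorm \<alpha> > 0" using hnorm_nonneg[OF M0_Mb[OF \<alpha>]] by simp
  let ?k = "complex_of_real (1 / hnorm \<alpha>)"
  have k: "cmod ?k = 1 / hnorm \<alpha>" unfolding norm_of_real using pos by simp
  have "hnorm (\<lambda>n. ?k * \<alpha> n) \<le> cmod ?k * hnorm \<alpha>" by (rule hnorm_mult[OF M0_Mb[OF \<alpha>]])
  then have "hnorm (\<lambda>n. ?k * \<alpha> n) \<le> 1" unfolding k using pos by simp
  from dnorm_upper[OF \<phi> M0_mult[OF \<alpha>] this] have "cmod ?k * cmod (\<phi> \<alpha>) \<le> dnorm \<phi>"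
    unfolding M0dual_mult[OF \<phi> \<alpha>] norm_mult .
  then show ?thesis unfolding k using pos by (simp add: field_simps)
qed

lemma M0dualI:
  assumes "\<And>\<alpha> \<beta>. \<alpha> \<in> M0 \<Longrightarrow> \<beta> \<in> M0 \<Longrightarrow> \<phi> (\<lambda>n. \<alpha> n + \<beta> n) = \<phi> \<alpha> + \<phi> \<beta>"
    and "\<And>\<alpha> k. \<alpha> \<in> M0 \<Longrightarrow> \<phi> (\<lambda>n. k * \<alpha> n) = k * \<phi> \<alpha>"
    and "\<And>\<alpha>. \<alpha> \<in> M0 \<Longrightarrow> cmod (\<phi> \<alpha>) \<le> C * hnorm \<alpha>"
  shows "\<phi> \<in> M0dual"
  using assms unfolding M0dual_def by blast

lemma M0dual_functional_mult:
  assumes \<phi>: "\<phi> \<in> M0dual"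
  shows "(\<lambda>\<alpha>. k * \<phi> \<alpha>) \<in> M0dual"
proof (rule M0dualI[where C="cmod k * dnorm \<phi>"])
  fix \<alpha> assume "\<alpha> \<in> M0"
  then show "cmod (k * \<phi> \<alpha>) \<le> cmod k * dnorm \<phi> * hnorm \<alpha>"
    using dnorm_bound[OF \<phi>] by (simp add: norm_mult mult.assoc mult_left_mono)
qed (simp_all add: M0dual_add[OF \<phi>] M0dual_mult[OF \<phi>] algebra_simps)

lemma M0dual_functional_diff:
  assumes \<phi>: "\<phi> \<in> M0dual" and \<psi>: "\<psi> \<in> M0dual"
  shows "(\<lambda>\<alpha>. \<phi> \<alpha> - \<psi> \<alpha>) \<in> M0dual"
proof (rule M0dualI[where C="dnorm \<phi> + dnorm \<psi>"])
  fix \<alpha> assume \<alpha>: "\<alpha> \<in> M0"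
  have "cmod (\<phi> \<alpha> - \<psi> \<alpha>) \<le> cmod (\<phi> \<alpha>) + cmod (\<psi> \<alpha>)" by (rule norm_triangle_ineq4)
  also have "\<dots> \<le> dnorm \<phi> * hnorm \<alpha> + dnorm \<psi> * hnorm \<alpha>"
    by (intro add_mono dnorm_bound \<phi> \<psi> \<alpha>)
  finally show "cmod (\<phi> \<alpha> - \<psi> \<alpha>) \<le> (dnorm \<phi> + dnorm \<psi>) * hnorm \<alpha>" by (simp add: algebra_simps)
qed (simp_all add: M0dual_add[OF \<phi>] M0dual_mult[OF \<phi>] M0dual_add[OF \<psi>] M0dual_mult[OF \<psi>] algebra_simps)

lemma Lmap_bound: "fin_supp c \<Longrightarrow> \<alpha> \<in> Mb \<Longrightarrow> cmod (pair \<alpha> c) \<le> Xnorm c * hnorm \<alpha>"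
  using pair_le_Xnorm[OF hle_hnorm] by (simp add: mult.commute)

lemma Lmap_M0dual: "fin_supp c \<Longrightarrow> Lmap c \<in> M0dual"
  by (rule M0dualI[where C="Xnorm c"])
    (auto simp: Lmap_def pair_add_symbol pair_mult_symbol intro: Lmap_bound M0_Mb)

lemma dnorm_Lmap:
  assumes c: "fin_supp c"
  shows "dnorm (Lmap c) = Xnorm c"
proof (rule antisym)
  show "dnorm (Lmap c) \<le> Xnorm c"
    by (intro dnorm_le Xnorm_nonneg c) (simp add: Lmap_def Lmap_bound c M0_Mb)
  obtain \<alpha> where \<alpha>: "\<alpha> \<in> Mb" "hle \<alpha> 1" "Xnorm c \<le> cmod (pair \<alpha> c)"
    by (rule Xnorm_attained[OF c])
  have "cmod (pair (damp j \<alpha>) c) \<le> dnorm (Lmap c)" for j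
    using dnorm_upper[OF Lmap_M0dual[OF c] damp_M0[OF \<alpha>(1)] hnorm_le[OF hle_damp[OF \<alpha>(2)]]]
    by (simp add: Lmap_def)
  moreover have "(\<lambda>j. cmod (pair (damp j \<alpha>) c)) \<longlonglongrightarrow> cmod (pair \<alpha> c)"
    using \<alpha>(1) by (intro tendsto_norm pair_tendsto damp_tendsto) (simp add: Mb_iff)
  ultimately have "cmod (pair \<alpha> c) \<le> dnorm (Lmap c)"
    by (intro LIMSEQ_le_const2[where X="\<lambda>j. cmod (pair (damp j \<alpha>) c)"]) auto
  with \<alpha>(3) show "Xnorm c \<le> dnorm (Lmap c)" by simp
qed

lemma M0dual_fin_supp:
  assumes \<phi>: "\<phi> \<in> M0dual" and "fin_supp x"
  shows "\<phi> x = pair (\<lambda>n. \<phi> (unit_seq n)) x"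
  using assms(2)
proof (induction rule: fin_supp_induct)
  case zero
  then show ?case by (simp add: M0dual_zero[OF \<phi>] pair_def)
next
  case (step x k n)
  then have "\<phi> (\<lambda>i. x i + k * unit_seq n i) = \<phi> x + k * \<phi> (unit_seq n)"
    by (simp add: M0dual_add[OF \<phi>] M0dual_mult[OF \<phi>] fin_supp_M0)
  with step show ?case by (simp add: pair_add pair_mult)
qed

text \<open>A gliding hump: otherwise one could add up \<open>n\<close> perturbations, each contributing at least
  \<open>e\<close> to the functional but, once the norm exceeds \<open>K\<close>, at most \<open>2 / K\<close> to the norm.\<close>
lemma M0dual_diff_damp_small:
  assumes \<phi>: "\<phi> \<in> M0dual" and e: "e > 0"
  shows "\<exists>j. \<forall>z. fin_supp z \<longrightarrow> cmod (\<phi> (\<lambda>n. z n - damp j z n)) \<le> e * hnorm z"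
proof (rule ccontr)
  assume neg: "\<not> ?thesis"
  have hump: "\<exists>z. fin_supp z \<and> hle z 1 \<and> e \<le> Re (\<phi> (\<lambda>n. z n - damp j z n))" for j
  proof -
    obtain z where z: "fin_supp z" and gt: "e * hnorm z < cmod (\<phi> (\<lambda>n. z n - damp j z n))"
      using neg by (auto simp: not_le)
    have zM: "z \<in> Mb" using fin_supp_Mb[OF z] .
    define w where "w = \<phi> (\<lambda>n. z n - damp j z n)"
    have h: "hnorm z > 0"
    proof (rule ccontr)
      assume "\<not> ?thesis"
      then have h0: "hnorm z = 0" using hnorm_nonneg[OF zM] by simp
      then have "hle z 0" using hle_hnorm[OF zM] by simp
      then have "z n = 0" for n
        using hle_0_imp_zero[of z n] zM by (cases "n = 0") (auto simp: Mb_iff)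
      then have "(\<lambda>n. z n - damp j z n) = (\<lambda>n. 0)" by (simp add: damp_def)
      then show False using gt h0 M0dual_zero[OF \<phi>] by simp
    qed
    have w0: "cmod w > 0" using gt h e unfolding w_def by (meson less_trans mult_pos_pos)
    \<comment> \<open>Besides normalising \<open>z\<close>, the factor rotates the value of the
      functional to the positive axis, so that the contributions of successive humps add without
      cancellation.\<close>
    define k where "k = cnj w / of_real (cmod w * hnorm z)"
    have ck: "cmod k = 1 / hnorm z" using w0 h by (simp add: k_def norm_divide norm_mult)
    have "k * w = of_real ((cmod w)\<^sup>2) / of_real (cmod w * hnorm z)"
      unfolding complex_norm_square by (simp add: k_def)
    also have "\<dots> = of_real (cmod w / hnorm z)"
      using w0 by (simp add: power2_eq_square)
    finally have kw: "Re (k * w) = cmod w / hnorm z" by simp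
    have "\<phi> (\<lambda>n. k * z n - damp j (\<lambda>n. k * z n) n) = \<phi> (\<lambda>n. k * (z n - damp j z n))"
      by (simp add: damp_def algebra_simps)
    also have "\<dots> = k * w"
      unfolding w_def using z by (intro M0dual_mult[OF \<phi>] fin_supp_M0) simp
    finally have "Re (\<phi> (\<lambda>n. k * z n - damp j (\<lambda>n. k * z n) n)) = cmod w / hnorm z"
      using kw by simp
    moreover have "e \<le> cmod w / hnorm z" using gt h by (simp add: w_def field_simps)
    moreover have "hle (\<lambda>n. k * z n) 1"
      using hle_mult[OF hle_hnorm[OF zM], of k] ck h by simp
    ultimately show ?thesis using z by (intro exI[of _ "\<lambda>n. k * z n"]) simp
  qed
  define M where "M = dnorm \<phi>"
  have M: "0 \<le> M" using dnorm_nonneg[OF \<phi>] by (simp add: M_def)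
  \<comment> \<open>With this \<open>K\<close> the norm growth \<open>2 * n / K\<close>, multiplied
    by \<open>M\<close>, uses up at most half of the gain \<open>n * e\<close>; the other half grows
    linearly against the fixed \<open>M * K\<close>.\<close>
  define K where "K = 4 * (M + 1) / e"
  have K: "K > 0" using M e by (simp add: K_def)
  \<comment> \<open>The zero sequence is started with the generous bound \<open>K\<close>, so that
    every later bound \<open>C\<close> is at least \<open>K\<close>. One step then costs
    \<open>1 / C\<close> from the estimate with \<open>G = 1\<close> plus the tolerance
    \<open>1 / K\<close>.\<close>
  have humps: "\<exists>y. fin_supp y \<and> hle y (K + 2 * real n / K) \<and> real n * e \<le> Re (\<phi> y)" for n
  proof (induction n)
    case 0
    show ?case using K by (intro exI[of _ "\<lambda>n. 0"]) (simp add: M0dual_zero[OF \<phi>])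
  next
    case (Suc n)
    then obtain y where y: "fin_supp y" "hle y (K + 2 * real n / K)" "real n * e \<le> Re (\<phi> y)" by blast
    let ?C = "K + 2 * real n / K"
    have C: "?C > 0" "K \<le> ?C" using K by (auto intro: add_pos_nonneg)
    have "1 / K > 0" using K by simp
    from eventually_happens'[OF sequentially_bot hle_add_diff_damp[OF y(1,2) C(1) zero_le_one this]]
    obtain j where j: "\<And>\<beta>. hle \<beta> 1 \<Longrightarrow> hle (\<lambda>n. y n + (\<beta> n - damp j \<beta> n)) (?C + 1\<^sup>2 / ?C + 1 / K)"
      by blast
    obtain z where z: "fin_supp z" "hle z 1" "e \<le> Re (\<phi> (\<lambda>n. z n - damp j z n))" using hump by blast
    have "1 / ?C \<le> 1 / K" by (intro frac_le C(2) K) auto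
    then have "?C + 1\<^sup>2 / ?C + 1 / K \<le> K + 2 * real (Suc n) / K"
      by (simp add: add_divide_distrib)
    then have "hle (\<lambda>n. y n + (z n - damp j z n)) (K + 2 * real (Suc n) / K)"
      using hle_mono j[OF z(2)] by blast
    moreover have "\<phi> (\<lambda>n. y n + (z n - damp j z n)) = \<phi> y + \<phi> (\<lambda>n. z n - damp j z n)"
      using y(1) z(1) by (intro M0dual_add[OF \<phi>] fin_supp_M0) auto
    then have "real (Suc n) * e \<le> Re (\<phi> (\<lambda>n. y n + (z n - damp j z n)))"
      using y(3) z(3) by (simp add: algebra_simps)
    moreover have "fin_supp (\<lambda>n. y n + (z n - damp j z n))" using y(1) z(1) by simp
    ultimately show ?case by blast
  qed
  have le: "real n * e \<le> M * (K + 2 * real n / K)" for n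
  proof -
    obtain y where y: "fin_supp y" "hle y (K + 2 * real n / K)" "real n * e \<le> Re (\<phi> y)"
      using humps by blast
    have "Re (\<phi> y) \<le> M * hnorm y"
      using dnorm_bound[OF \<phi> fin_supp_M0[OF y(1)]] complex_Re_le_cmod[of "\<phi> y"] by (simp add: M_def)
    also have "\<dots> \<le> M * (K + 2 * real n / K)" by (intro mult_left_mono hnorm_le y M)
    finally show ?thesis using y(3) by linarith
  qed
  have half: "M * (2 * real n / K) \<le> real n * e / 2" for n
  proof -
    have "M * (2 * real n / K) = (M / (M + 1)) * (real n * e / 2)"
      using M e by (simp add: K_def field_simps)
    also have "\<dots> \<le> 1 * (real n * e / 2)" using M e by (intro mult_right_mono) auto
    finally show ?thesis by simp
  qed
  have "real n * e / 2 \<le> M * K" for n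
    using le[of n] half[of n] unfolding distrib_left by linarith
  moreover obtain n where "2 * M * K / e < real n" using reals_Archimedean2 by blast
  then have "M * K < real n * e / 2" using e by (simp add: field_simps)
  ultimately show False by (meson not_le)
qed

text \<open>The sequence \<open>c\<close> consists of the damped and cut-off coefficients of
  \<open>\<phi>\<close>. What \<open>c\<close> misses is \<open>\<phi>\<close> on
  \<open>z - damp j z\<close>, small by \<open>M0dual_diff_damp_small\<close>, and
  \<open>\<phi>\<close> on the tail of \<open>damp j z\<close>, small uniformly in
  \<open>z\<close>.\<close>

lemma Lmap_dense:
  assumes \<phi>: "\<phi> \<in> M0dual" and e: "e > 0"
  shows "\<exists>c. fin_supp c \<and> (\<forall>\<alpha>\<in>M0. cmod (\<phi> \<alpha> - pair \<alpha> c) \<le> e * hnorm \<alpha>)"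
proof -
  define M where "M = dnorm \<phi>"
  have M: "0 \<le> M" using dnorm_nonneg[OF \<phi>] by (simp add: M_def)
  obtain j where j: "\<And>z. fin_supp z \<Longrightarrow> cmod (\<phi> (\<lambda>n. z n - damp j z n)) \<le> e / 2 * hnorm z"
    using M0dual_diff_damp_small[OF \<phi>, of "e / 2"] e by auto
  \<comment> \<open>The tail error passes through \<open>\<phi>\<close> with factor \<open>M\<close>
    and may cost at most \<open>e / 2\<close>; the 1 covers \<open>M = 0\<close>.\<close>
  define e' where "e' = e / (2 * (M + 1))"
  have e': "e' > 0" "M * e' \<le> e / 2" using e M by (auto simp: e'_def field_simps)
  from eventually_happens'[OF sequentially_bot damp_approx_fin_supp[OF e'(1), of j]]
  obtain N where N: "\<And>\<beta>. \<beta> \<in> Mb \<Longrightarrow> hle (\<lambda>n. damp j \<beta> n - restr {..N} (damp j \<beta>) n) (e' * hnorm \<beta>)"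
    by blast
  define c where "c = restr {1..N} (damp j (\<lambda>n. \<phi> (unit_seq n)))"
  have c: "fin_supp c" unfolding c_def by (rule fin_supp_restr_finite) (auto simp: damp_def)
  have fin: "cmod (\<phi> z - pair z c) \<le> e * hnorm z" if z: "fin_supp z" for z
  proof -
    let ?r = "restr {..N} (damp j z)"
    have zM: "z \<in> Mb" using fin_supp_Mb[OF z] .
    \<comment> \<open>Weight and cut-off act diagonally, so under the bilinear pairing they can be
      moved from \<open>z\<close> to the coefficients of \<open>\<phi>\<close>.\<close>
    have "\<phi> ?r = pair (\<lambda>n. \<phi> (unit_seq n)) ?r" using z by (intro M0dual_fin_supp[OF \<phi>]) simp
    also have "\<dots> = (\<Sum>n\<in>{..N}. \<phi> (unit_seq n) * ?r n)"
      by (intro pair_eq) (auto simp: supp_def restr_def)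
    also have "\<dots> = (\<Sum>n\<in>{..N}. z n * c n)"
      using z by (intro sum.cong refl) (auto simp: c_def restr_def damp_def not_le fin_supp_def)
    also have "\<dots> = pair z c"
      by (intro pair_eq[symmetric]) (auto simp: supp_def c_def restr_def split: if_splits)
    finally have r: "\<phi> ?r = pair z c" .
    have "\<phi> z - pair z c = \<phi> (\<lambda>n. z n - damp j z n) + \<phi> (\<lambda>n. damp j z n - ?r n)"
      using z by (simp add: r[symmetric] M0dual_diff[OF \<phi>] fin_supp_M0)
    then have "cmod (\<phi> z - pair z c) \<le> cmod (\<phi> (\<lambda>n. z n - damp j z n)) + cmod (\<phi> (\<lambda>n. damp j z n - ?r n))"
      by (simp add: norm_triangle_ineq)
    also have "cmod (\<phi> (\<lambda>n. damp j z n - ?r n)) \<le> M * hnorm (\<lambda>n. damp j z n - ?r n)"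
      unfolding M_def using z by (intro dnorm_bound[OF \<phi>] fin_supp_M0) simp
    also have "\<dots> \<le> M * (e' * hnorm z)" by (intro mult_left_mono hnorm_le N zM M)
    also have "\<dots> \<le> e / 2 * hnorm z"
      using mult_right_mono[OF e'(2) hnorm_nonneg[OF zM]] by (simp add: mult.assoc)
    finally show ?thesis using j[OF z] by (simp add: algebra_simps)
  qed
  have "cmod (\<phi> \<alpha> - pair \<alpha> c) \<le> e * hnorm \<alpha>" if \<alpha>: "\<alpha> \<in> M0" for \<alpha>
  proof (rule field_le_epsilon)
    let ?\<chi> = "\<lambda>\<alpha>. \<phi> \<alpha> - Lmap c \<alpha>"
    have \<chi>: "?\<chi> \<in> M0dual" by (intro M0dual_functional_diff \<phi> Lmap_M0dual c)
    fix \<eta> :: real assume \<eta>: "\<eta> > 0"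
    \<comment> \<open>Passing from finitely supported \<open>z\<close> to \<open>\<alpha>\<close>
      costs \<open>e * \<delta>\<close>, since \<open>hnorm z\<close> may exceed
      \<open>hnorm \<alpha>\<close> by \<open>\<delta>\<close>, and
      \<open>dnorm ?\<chi> * \<delta>\<close> for the remainder \<open>\<alpha> - z\<close>.\<close>
    define \<delta> where "\<delta> = \<eta> / (e + dnorm ?\<chi> + 1)"
    have D: "0 \<le> dnorm ?\<chi>" using dnorm_nonneg[OF \<chi>] .
    have \<delta>: "\<delta> > 0" "(e + dnorm ?\<chi>) * \<delta> \<le> \<eta>"
      using \<eta> e D by (auto simp: \<delta>_def field_simps)
    obtain z where z: "fin_supp z" "hle (\<lambda>n. \<alpha> n - z n) \<delta>" using \<alpha> \<delta>(1) unfolding M0_iff by blast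
    have "hle (\<lambda>n. \<alpha> n - (\<alpha> n - z n)) (hnorm \<alpha> + \<delta>)"
      by (rule hle_diff[OF hle_hnorm[OF M0_Mb[OF \<alpha>]] z(2)])
    then have hz: "hnorm z \<le> hnorm \<alpha> + \<delta>" using hnorm_le by simp
    have "?\<chi> \<alpha> = ?\<chi> z + ?\<chi> (\<lambda>n. \<alpha> n - z n)"
      using M0dual_diff[OF \<chi> \<alpha> fin_supp_M0[OF z(1)]] by simp
    then have "cmod (?\<chi> \<alpha>) \<le> cmod (?\<chi> z) + cmod (?\<chi> (\<lambda>n. \<alpha> n - z n))"
      by (metis norm_triangle_ineq)
    also have "cmod (?\<chi> (\<lambda>n. \<alpha> n - z n)) \<le> dnorm ?\<chi> * hnorm (\<lambda>n. \<alpha> n - z n)"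
      by (intro dnorm_bound[OF \<chi>] M0_diff \<alpha> fin_supp_M0 z)
    also have "\<dots> \<le> dnorm ?\<chi> * \<delta>" by (intro mult_left_mono hnorm_le z D)
    also have "cmod (?\<chi> z) \<le> e * hnorm z" using fin[OF z(1)] by (simp add: Lmap_def)
    also have "\<dots> \<le> e * (hnorm \<alpha> + \<delta>)" using hz e by (intro mult_left_mono) auto
    finally show "cmod (\<phi> \<alpha> - pair \<alpha> c) \<le> e * hnorm \<alpha> + \<eta>"
      using \<delta>(2) by (simp add: Lmap_def algebra_simps)
  qed
  with c show ?thesis by blast
qed

section \<open>Uniqueness of the bidual identification\<close>

text \<open>A one-sided comparison of norms along \<open>M0\<close> already forces equality:
  \<open>M0\<close> contains probes that nearly cancel \<open>\<beta>\<close> on any finite block,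
  and for these the norm on the right is almost that of the block alone.\<close>

lemma Mb_eqI_of_hnorm_le:
  assumes \<alpha>: "\<alpha> \<in> Mb" and \<beta>: "\<beta> \<in> Mb"
    and le: "\<And>y. y \<in> M0 \<Longrightarrow> hnorm (\<lambda>n. \<alpha> n + y n) \<le> hnorm (\<lambda>n. \<beta> n + y n)"
  shows "\<alpha> = \<beta>"
proof -
  define G \<delta> D where "G = hnorm \<beta>" and "\<delta> = (\<lambda>n. \<alpha> n - \<beta> n)" and "D = hnorm \<delta>"
  have \<alpha>0: "\<alpha> 0 = 0" and \<beta>0: "\<beta> 0 = 0" using \<alpha> \<beta> by (auto simp: Mb_iff)
  have G: "0 \<le> G" "hle \<beta> G" using hnorm_nonneg[OF \<beta>] hle_hnorm[OF \<beta>] by (auto simp: G_def)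
  have \<delta>: "\<delta> \<in> Mb" unfolding \<delta>_def by (rule Mb_diff[OF \<alpha> \<beta>])
  \<comment> \<open>The compact probe \<open>x - damp j \<beta>\<close> turns \<open>\<beta>\<close>
    into \<open>x + (\<beta> - damp j \<beta>)\<close>, which the central estimate controls, and
    turns \<open>\<alpha>\<close> into a symbol that tends pointwise to
    \<open>x + \<delta>\<close>.\<close>
  have step1: "hle (\<lambda>n. x n + \<delta> n) (C + G\<^sup>2 / C)" if x: "fin_supp x" "hle x C" "C > 0" for x C
  proof (rule hle_epsilon)
    fix \<eta> :: real assume "\<eta> > 0"
    from hle_add_diff_damp[OF x G(1) this]
    have "\<forall>\<^sub>F j in sequentially. hle (\<lambda>n. \<alpha> n + (x n - damp j \<beta> n)) (C + G\<^sup>2 / C + \<eta>)"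
    proof eventually_elim
      case (elim j)
      have y: "(\<lambda>n. x n - damp j \<beta> n) \<in> M0" by (intro M0_diff fin_supp_M0 x damp_M0 \<beta>)
      have "hle (\<lambda>n. x n + (\<beta> n - damp j \<beta> n)) (C + G\<^sup>2 / C + \<eta>)" using elim G(2) by blast
      then have "hnorm (\<lambda>n. \<beta> n + (x n - damp j \<beta> n)) \<le> C + G\<^sup>2 / C + \<eta>"
        using hnorm_le by (simp add: algebra_simps)
      then have "hnorm (\<lambda>n. \<alpha> n + (x n - damp j \<beta> n)) \<le> C + G\<^sup>2 / C + \<eta>" using le[OF y] by linarith
      then show ?case using hle_mono hle_hnorm[OF Mb_add[OF \<alpha> M0_Mb[OF y]]] by blast
    qed
    moreover have "(\<lambda>j. \<alpha> n + (x n - damp j \<beta> n)) \<longlonglongrightarrow> x n + \<delta> n" for n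
    proof -
      have "(\<lambda>j. \<alpha> n + (x n - damp j \<beta> n)) \<longlonglongrightarrow> \<alpha> n + (x n - \<beta> n)"
        by (intro tendsto_intros damp_tendsto \<beta>0)
      then show ?thesis by (simp add: \<delta>_def algebra_simps)
    qed
    ultimately show "hle (\<lambda>n. x n + \<delta> n) (C + G\<^sup>2 / C + \<eta>)"
      by (intro hle_tendsto[OF _ tendsto_const])
  qed
  have "D = 0"
  proof (rule ccontr)
    assume "D \<noteq> 0"
    then have D: "D > 0" using hnorm_nonneg[OF \<delta>] by (simp add: D_def)
    \<comment> \<open>With \<open>x\<close> in the role of \<open>T * \<delta>\<close> and
      \<open>C = T * D\<close>, the bound reads
      \<open>(T + 1) * D \<le> T * D + G\<^sup>2 / (T * D)\<close>, that is
      \<open>T * D\<^sup>2 \<le> G\<^sup>2\<close>; this \<open>T\<close> makes the left side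
      \<open>G\<^sup>2 + 1\<close>.\<close>
    define T where "T = (G\<^sup>2 + 1) / D\<^sup>2"
    have T: "T > 0" using D by (simp add: T_def add_nonneg_pos)
    define \<gamma> where "\<gamma> = (\<lambda>n. of_real T * \<delta> n)"
    have \<gamma>: "\<gamma> \<in> Mb" "hle \<gamma> (T * D)" "\<gamma> 0 = 0"
      using Mb_mult[OF \<delta>, of "of_real T"] hle_mult[OF hle_hnorm[OF \<delta>], of "of_real T"] T \<alpha>0 \<beta>0
      by (simp_all add: \<gamma>_def D_def \<delta>_def)
    let ?e = "\<lambda>k. inverse (real (Suc k))"
    \<comment> \<open>The multiple \<open>\<gamma>\<close> of \<open>\<delta>\<close> need not be
      finitely supported. Cut-offs of its damped versions converge to it pointwise with bounds
      tending to \<open>T * D\<close>, which suffices for \<open>hle_tendsto\<close>.\<close>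
    have "\<exists>z. fin_supp z \<and> hle (\<lambda>n. damp k \<gamma> n - z n) (?e k)" for k
      by (rule damp_fin_supp_approx[OF \<gamma>(1)]) simp
    then obtain z where z: "\<And>k. fin_supp (z k)" "\<And>k. hle (\<lambda>n. damp k \<gamma> n - z k n) (?e k)"
      by metis
    have z_hle: "hle (z k) (T * D + ?e k)" for k
      using hle_diff[OF hle_damp[OF \<gamma>(2), of k] z(2)[of k]] by simp
    have e0: "?e \<longlonglongrightarrow> 0" by (rule LIMSEQ_inverse_real_of_nat)
    have z_lim: "(\<lambda>k. z k n) \<longlonglongrightarrow> \<gamma> n" for n
    proof (cases "n = 0")
      case True
      then show ?thesis using z(1) \<gamma>(3) by (simp add: fin_supp_def)
    next
      case False
      then have "norm (damp k \<gamma> n - z k n) \<le> ?e k" for k using hle_coeff[OF z(2)] by simp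
      then have "(\<lambda>k. damp k \<gamma> n - z k n) \<longlonglongrightarrow> 0"
        by (intro Lim_null_comparison[OF _ e0] always_eventually) simp
      from tendsto_diff[OF damp_tendsto[where a=\<gamma> and n=n, OF \<gamma>(3)] this] show ?thesis by simp
    qed
    have "hle (\<lambda>n. \<gamma> n + \<delta> n) (T * D + 0 + G\<^sup>2 / (T * D + 0))"
    proof (rule hle_tendsto)
      show "(\<lambda>k. z k n + \<delta> n) \<longlonglongrightarrow> \<gamma> n + \<delta> n" for n by (intro tendsto_intros z_lim)
      show "(\<lambda>k. T * D + ?e k + G\<^sup>2 / (T * D + ?e k)) \<longlonglongrightarrow> T * D + 0 + G\<^sup>2 / (T * D + 0)"
        using T D by (intro tendsto_intros e0) simp
      show "\<forall>\<^sub>F k in sequentially. hle (\<lambda>n. z k n + \<delta> n) (T * D + ?e k + G\<^sup>2 / (T * D + ?e k))"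
        using T D by (intro always_eventually allI step1 z z_hle add_pos_pos mult_pos_pos) auto
    qed
    then have "hle (\<lambda>n. of_real (1 / (T + 1)) * (\<gamma> n + \<delta> n))
        (cmod (of_real (1 / (T + 1))) * (T * D + G\<^sup>2 / (T * D)))"
      by (intro hle_mult) simp
    moreover have "of_real (1 / (T + 1)) * (\<gamma> n + \<delta> n) = \<delta> n" for n
    proof -
      have "\<gamma> n + \<delta> n = of_real (T + 1) * \<delta> n" by (simp add: \<gamma>_def algebra_simps)
      then have "of_real (1 / (T + 1)) * (\<gamma> n + \<delta> n) = of_real (1 / (T + 1) * (T + 1)) * \<delta> n"
        by (simp only: of_real_mult mult.assoc)
      then show ?thesis using T by simp
    qed
    moreover have "cmod (of_real (1 / (T + 1))) = 1 / (T + 1)"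
      unfolding norm_of_real using T by simp
    ultimately have "hle \<delta> (1 / (T + 1) * (T * D + G\<^sup>2 / (T * D)))" by simp
    then have "D \<le> 1 / (T + 1) * (T * D + G\<^sup>2 / (T * D))" unfolding D_def by (rule hnorm_le)
    then have "(T + 1) * D \<le> T * D + G\<^sup>2 / (T * D)" using T by (simp add: field_simps)
    then have "D \<le> G\<^sup>2 / (T * D)" by (simp add: algebra_simps)
    then have "T * D\<^sup>2 \<le> G\<^sup>2" using T D by (simp add: field_simps power2_eq_square)
    then show False using D by (simp add: T_def)
  qed
  then have "hle \<delta> 0" using hle_hnorm[OF \<delta>] by (simp add: D_def)
  then have "\<delta> n = 0" for n
    using hle_0_imp_zero[of \<delta> n] \<alpha>0 \<beta>0 by (cases "n = 0") (auto simp: \<delta>_def)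
  then show ?thesis by (auto simp: \<delta>_def fun_eq_iff)
qed

section \<open>The extension of L to the completion\<close>

text \<open>For \<open>s\<close> in \<open>Xcompl\<close> the limit exists for every
  \<open>\<alpha>\<close> in \<open>Mb\<close>, not only in \<open>M0\<close>. On \<open>M0\<close>
  it extends \<open>L\<close>; at a general bounded symbol it is the value of
  \<open>J \<alpha>\<close> at the class of \<open>s\<close>.\<close>

definition Lext :: "(nat \<Rightarrow> seq) \<Rightarrow> functional" where
  "Lext s = (\<lambda>\<alpha>. lim (\<lambda>n. pair \<alpha> (s n)))"

lemma Xcompl_iff: "s \<in> Xcompl \<longleftrightarrow> (\<forall>n. fin_supp (s n)) \<and>
     (\<forall>e>0. \<exists>N. \<forall>m\<ge>N. \<forall>n\<ge>N. Xnorm (\<lambda>i. s m i - s n i) < e)"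
  by (simp add: Xcompl_def Xset_eq)

lemma Xcompl_fin_supp: "s \<in> Xcompl \<Longrightarrow> fin_supp (s n)"
  by (simp add: Xcompl_iff)

lemma pair_diff_le:
  assumes "\<alpha> \<in> Mb" "fin_supp c" "fin_supp d"
  shows "cmod (pair \<alpha> c - pair \<alpha> d) \<le> Xnorm (\<lambda>i. c i - d i) * hnorm \<alpha>"
  using Lmap_bound[of "\<lambda>i. c i - d i" \<alpha>] pair_diff[of c d \<alpha>] assms by simp

lemma pair_Xcompl_tendsto:
  assumes s: "s \<in> Xcompl" and \<alpha>: "\<alpha> \<in> Mb"
  shows "(\<lambda>n. pair \<alpha> (s n)) \<longlonglongrightarrow> Lext s \<alpha>"
proof -
  have "Cauchy (\<lambda>n. pair \<alpha> (s n))"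
  proof (rule CauchyI)
    fix e :: real assume e: "e > 0"
    have h: "0 \<le> hnorm \<alpha>" using hnorm_nonneg[OF \<alpha>] .
    have "e / (hnorm \<alpha> + 1) > 0" using e h by simp
    then obtain N where N: "\<And>m n. m \<ge> N \<Longrightarrow> n \<ge> N \<Longrightarrow> Xnorm (\<lambda>i. s m i - s n i) < e / (hnorm \<alpha> + 1)"
      using s unfolding Xcompl_iff by blast
    have "cmod (pair \<alpha> (s m) - pair \<alpha> (s n)) < e" if "m \<ge> N" "n \<ge> N" for m n
    proof -
      have "cmod (pair \<alpha> (s m) - pair \<alpha> (s n)) \<le> Xnorm (\<lambda>i. s m i - s n i) * hnorm \<alpha>"
        by (intro pair_diff_le \<alpha> Xcompl_fin_supp s)
      also have "\<dots> \<le> e / (hnorm \<alpha> + 1) * hnorm \<alpha>"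
        using N[OF that] h by (intro mult_right_mono) auto
      also have "\<dots> < e" using e h by (simp add: field_simps)
      finally show ?thesis .
    qed
    then show "\<exists>M. \<forall>m\<ge>M. \<forall>n\<ge>M. norm (pair \<alpha> (s m) - pair \<alpha> (s n)) < e" by blast
  qed
  then show ?thesis
    unfolding Lext_def by (simp add: Cauchy_convergent_iff convergent_LIMSEQ_iff)
qed

text \<open>The Cauchy estimate is uniform in \<open>\<alpha>\<close> after division by
  \<open>hnorm \<alpha>\<close>, and this survives the limit in one index. So
  \<open>Lmap (s n)\<close> converges to \<open>Lext s\<close> in the dual norm.\<close>

lemma Lext_approx:
  assumes s: "s \<in> Xcompl" and e: "e > 0"
  shows "\<forall>\<^sub>F n in sequentially. \<forall>\<alpha>\<in>Mb. cmod (Lext s \<alpha> - pair \<alpha> (s n)) \<le> e * hnorm \<alpha>"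
proof -
  obtain N where N: "\<And>m n. m \<ge> N \<Longrightarrow> n \<ge> N \<Longrightarrow> Xnorm (\<lambda>i. s m i - s n i) < e"
    using s e unfolding Xcompl_iff by blast
  have "cmod (Lext s \<alpha> - pair \<alpha> (s n)) \<le> e * hnorm \<alpha>" if n: "n \<ge> N" and \<alpha>: "\<alpha> \<in> Mb" for n \<alpha>
  proof (rule LIMSEQ_le_const2)
    show "(\<lambda>m. cmod (pair \<alpha> (s m) - pair \<alpha> (s n))) \<longlonglongrightarrow> cmod (Lext s \<alpha> - pair \<alpha> (s n))"
      by (intro tendsto_intros pair_Xcompl_tendsto s \<alpha>)
    have "cmod (pair \<alpha> (s m) - pair \<alpha> (s n)) \<le> e * hnorm \<alpha>" if "m \<ge> N" for m
      using pair_diff_le[OF \<alpha> Xcompl_fin_supp[OF s] Xcompl_fin_supp[OF s], of m n]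
        mult_right_mono[OF less_imp_le[OF N[OF that n]] hnorm_nonneg[OF \<alpha>]] by linarith
    then show "\<exists>M. \<forall>m\<ge>M. cmod (pair \<alpha> (s m) - pair \<alpha> (s n)) \<le> e * hnorm \<alpha>" by blast
  qed
  then show ?thesis unfolding eventually_sequentially by blast
qed

lemma Xnorm_Xcompl_tendsto:
  assumes s: "s \<in> Xcompl"
  shows "(\<lambda>n. Xnorm (s n)) \<longlonglongrightarrow> Xcnorm s"
proof -
  have "Cauchy (\<lambda>n. Xnorm (s n))"
  proof (rule CauchyI)
    fix e :: real assume e: "e > 0"
    then obtain N where N: "\<And>m n. m \<ge> N \<Longrightarrow> n \<ge> N \<Longrightarrow> Xnorm (\<lambda>i. s m i - s n i) < e"
      using s unfolding Xcompl_iff by blast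
    have le: "Xnorm (s m) - Xnorm (s n) \<le> Xnorm (\<lambda>i. s m i - s n i)" for m n
      using Xnorm_add[of "\<lambda>i. s m i - s n i" "s n"] Xcompl_fin_supp[OF s] by simp
    have "norm (Xnorm (s m) - Xnorm (s n)) < e" if "m \<ge> N" "n \<ge> N" for m n
      using le[of m n] le[of n m] N[OF that] N[OF that(2,1)] by (simp add: abs_less_iff)
    then show "\<exists>M. \<forall>m\<ge>M. \<forall>n\<ge>M. norm (Xnorm (s m) - Xnorm (s n)) < e" by blast
  qed
  then show ?thesis
    unfolding Xcnorm_def by (simp add: Cauchy_convergent_iff convergent_LIMSEQ_iff)
qed

lemma Xcnorm_nonneg:
  assumes "s \<in> Xcompl"
  shows "0 \<le> Xcnorm s"
  using Xnorm_Xcompl_tendsto[OF assms] Xnorm_nonneg[OF Xcompl_fin_supp[OF assms]]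
  by (intro LIMSEQ_le_const) auto

lemma Lext_bound:
  assumes s: "s \<in> Xcompl" and \<alpha>: "\<alpha> \<in> Mb"
  shows "cmod (Lext s \<alpha>) \<le> Xcnorm s * hnorm \<alpha>"
proof (rule LIMSEQ_le)
  show "(\<lambda>n. cmod (pair \<alpha> (s n))) \<longlonglongrightarrow> cmod (Lext s \<alpha>)"
    by (intro tendsto_intros pair_Xcompl_tendsto s \<alpha>)
  show "(\<lambda>n. Xnorm (s n) * hnorm \<alpha>) \<longlonglongrightarrow> Xcnorm s * hnorm \<alpha>"
    by (intro tendsto_intros Xnorm_Xcompl_tendsto s)
qed (use Lmap_bound[OF Xcompl_fin_supp[OF s] \<alpha>] in blast)

lemma Lext_M0dual:
  assumes s: "s \<in> Xcompl"
  shows "Lext s \<in> M0dual"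
proof (rule M0dualI[where C="Xcnorm s"])
  fix \<alpha> \<beta> assume "\<alpha> \<in> M0" "\<beta> \<in> M0"
  then have M: "\<alpha> \<in> Mb" "\<beta> \<in> Mb" by (auto intro: M0_Mb)
  have "(\<lambda>n. pair (\<lambda>n. \<alpha> n + \<beta> n) (s n)) \<longlonglongrightarrow> Lext s \<alpha> + Lext s \<beta>"
    unfolding pair_add_symbol by (intro tendsto_add pair_Xcompl_tendsto s M)
  then show "Lext s (\<lambda>n. \<alpha> n + \<beta> n) = Lext s \<alpha> + Lext s \<beta>"
    by (rule LIMSEQ_unique[OF pair_Xcompl_tendsto[OF s Mb_add[OF M]]])
next
  fix \<alpha> k assume "\<alpha> \<in> M0"
  then have M: "\<alpha> \<in> Mb" by (rule M0_Mb)
  have "(\<lambda>n. pair (\<lambda>n. k * \<alpha> n) (s n)) \<longlonglongrightarrow> k * Lext s \<alpha>"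
    unfolding pair_mult_symbol by (intro tendsto_mult tendsto_const pair_Xcompl_tendsto s M)
  then show "Lext s (\<lambda>n. k * \<alpha> n) = k * Lext s \<alpha>"
    by (rule LIMSEQ_unique[OF pair_Xcompl_tendsto[OF s Mb_mult[OF M]]])
qed (intro Lext_bound s M0_Mb)

text \<open>The isometry \<open>dnorm_Lmap\<close> holds along \<open>s\<close> and passes to the
  limit by \<open>Lext_approx\<close>.\<close>

lemma dnorm_Lext:
  assumes s: "s \<in> Xcompl"
  shows "dnorm (Lext s) = Xcnorm s"
proof (rule antisym)
  show "dnorm (Lext s) \<le> Xcnorm s"
    by (intro dnorm_le Xcnorm_nonneg Lext_bound s M0_Mb)
  show "Xcnorm s \<le> dnorm (Lext s)"
  proof (rule field_le_epsilon)
    fix e :: real assume e: "e > 0"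
    have "\<forall>\<^sub>F n in sequentially. Xnorm (s n) \<le> dnorm (Lext s) + e"
      using Lext_approx[OF s e]
    proof eventually_elim
      case (elim n)
      have "dnorm (Lmap (s n)) \<le> dnorm (Lext s) + e"
      proof (rule dnorm_le)
        show "0 \<le> dnorm (Lext s) + e" using dnorm_nonneg[OF Lext_M0dual[OF s]] e by simp
        fix \<alpha> assume \<alpha>: "\<alpha> \<in> M0"
        have "cmod (Lext s \<alpha> - pair \<alpha> (s n)) \<le> e * hnorm \<alpha>" using elim M0_Mb[OF \<alpha>] by blast
        moreover have "cmod (Lext s \<alpha>) \<le> dnorm (Lext s) * hnorm \<alpha>"
          by (rule dnorm_bound[OF Lext_M0dual[OF s] \<alpha>])
        moreover have "cmod (pair \<alpha> (s n)) \<le> cmod (Lext s \<alpha>) + cmod (Lext s \<alpha> - pair \<alpha> (s n))"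
          by (metis norm_minus_commute norm_triangle_sub)
        ultimately show "cmod (Lmap (s n) \<alpha>) \<le> (dnorm (Lext s) + e) * hnorm \<alpha>"
          by (simp add: Lmap_def algebra_simps)
      qed
      then show ?case by (simp add: dnorm_Lmap Xcompl_fin_supp s)
    qed
    then show "Xcnorm s \<le> dnorm (Lext s) + e"
      by (intro tendsto_le[OF sequentially_bot tendsto_const Xnorm_Xcompl_tendsto[OF s]])
  qed
qed

lemma dnorm_cong: "eq_on_M0 \<phi> \<psi> \<Longrightarrow> dnorm \<phi> = dnorm \<psi>"
  unfolding dnorm_def eq_on_M0_def by (intro arg_cong[where f=Sup] Collect_cong ex_cong1) auto

text \<open>Approximants from \<open>Lmap_dense\<close> with errors \<open>1 / (k + 1)\<close> are
  Cauchy for \<open>dnorm\<close>, and the isometry \<open>dnorm_Lmap\<close> turns this into a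
  Cauchy sequence for \<open>Xnorm\<close>.\<close>

lemma Lext_onto:
  assumes \<phi>: "\<phi> \<in> M0dual"
  shows "\<exists>s\<in>Xcompl. eq_on_M0 (Lext s) \<phi>"
proof -
  let ?e = "\<lambda>k. inverse (real (Suc k))"
  have "\<forall>k. \<exists>c. fin_supp c \<and> (\<forall>\<alpha>\<in>M0. cmod (\<phi> \<alpha> - pair \<alpha> c) \<le> ?e k * hnorm \<alpha>)"
    by (intro allI Lmap_dense[OF \<phi>]) simp
  from choice[OF this] obtain s where fs: "\<And>k. fin_supp (s k)"
    and s: "\<And>k \<alpha>. \<alpha> \<in> M0 \<Longrightarrow> cmod (\<phi> \<alpha> - pair \<alpha> (s k)) \<le> ?e k * hnorm \<alpha>"
    by blast
  have e0: "?e \<longlonglongrightarrow> 0" by (rule LIMSEQ_inverse_real_of_nat)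
  have diff: "Xnorm (\<lambda>i. s m i - s n i) \<le> ?e m + ?e n" for m n
  proof -
    have "dnorm (Lmap (\<lambda>i. s m i - s n i)) \<le> ?e m + ?e n"
    proof (rule dnorm_le)
      fix \<alpha> assume \<alpha>: "\<alpha> \<in> M0"
      have "Lmap (\<lambda>i. s m i - s n i) \<alpha> = (\<phi> \<alpha> - pair \<alpha> (s n)) - (\<phi> \<alpha> - pair \<alpha> (s m))"
        by (simp add: Lmap_def pair_diff fs)
      then have "cmod (Lmap (\<lambda>i. s m i - s n i) \<alpha>)
          \<le> cmod (\<phi> \<alpha> - pair \<alpha> (s n)) + cmod (\<phi> \<alpha> - pair \<alpha> (s m))"
        by (simp only: norm_triangle_ineq4)
      then show "cmod (Lmap (\<lambda>i. s m i - s n i) \<alpha>) \<le> (?e m + ?e n) * hnorm \<alpha>"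
        using s[OF \<alpha>, of m] s[OF \<alpha>, of n] unfolding distrib_right by linarith
    qed (simp add: add_nonneg_nonneg)
    then show ?thesis by (simp add: dnorm_Lmap fs)
  qed
  have sX: "s \<in> Xcompl"
    unfolding Xcompl_iff
  proof (intro conjI allI impI fs)
    fix e :: real assume "e > 0"
    then obtain N where N: "\<And>n. n \<ge> N \<Longrightarrow> ?e n < e / 2"
      using order_tendstoD(2)[OF e0, of "e / 2"] unfolding eventually_sequentially by auto
    have "Xnorm (\<lambda>i. s m i - s n i) < e" if "m \<ge> N" "n \<ge> N" for m n
      using diff[of m n] N[OF that(1)] N[OF that(2)] by linarith
    then show "\<exists>N. \<forall>m\<ge>N. \<forall>n\<ge>N. Xnorm (\<lambda>i. s m i - s n i) < e" by blast
  qed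
  have "Lext s \<alpha> = \<phi> \<alpha>" if \<alpha>: "\<alpha> \<in> M0" for \<alpha>
  proof (rule LIMSEQ_unique[OF pair_Xcompl_tendsto[OF sX M0_Mb[OF \<alpha>]]])
    have "(\<lambda>k. ?e k * hnorm \<alpha>) \<longlonglongrightarrow> 0" by (rule tendsto_mult_left_zero[OF e0])
    then have "(\<lambda>k. \<phi> \<alpha> - pair \<alpha> (s k)) \<longlonglongrightarrow> 0"
      by (rule Lim_null_comparison[rotated]) (intro always_eventually allI s \<alpha>)
    from tendsto_diff[OF tendsto_const this, of "\<phi> \<alpha>"] show "(\<lambda>k. pair \<alpha> (s k)) \<longlonglongrightarrow> \<phi> \<alpha>" by simp
  qed
  then show ?thesis using sX by (auto simp: eq_on_M0_def)
qed

section \<open>The bidual and the symbols of its elements\<close>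

lemma M0ddual_cong:
  "\<Phi> \<in> M0ddual \<Longrightarrow> \<phi> \<in> M0dual \<Longrightarrow> \<psi> \<in> M0dual \<Longrightarrow> eq_on_M0 \<phi> \<psi> \<Longrightarrow> \<Phi> \<phi> = \<Phi> \<psi>"
  unfolding M0ddual_def by blast

lemma M0ddual_add:
  "\<Phi> \<in> M0ddual \<Longrightarrow> \<phi> \<in> M0dual \<Longrightarrow> \<psi> \<in> M0dual \<Longrightarrow> \<Phi> (\<lambda>\<alpha>. \<phi> \<alpha> + \<psi> \<alpha>) = \<Phi> \<phi> + \<Phi> \<psi>"
  unfolding M0ddual_def by blast

lemma M0ddual_mult: "\<Phi> \<in> M0ddual \<Longrightarrow> \<phi> \<in> M0dual \<Longrightarrow> \<Phi> (\<lambda>\<alpha>. k * \<phi> \<alpha>) = k * \<Phi> \<phi>"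
  unfolding M0ddual_def by blast

lemma M0ddual_diff:
  "\<Phi> \<in> M0ddual \<Longrightarrow> \<phi> \<in> M0dual \<Longrightarrow> \<psi> \<in> M0dual \<Longrightarrow> \<Phi> (\<lambda>\<alpha>. \<phi> \<alpha> - \<psi> \<alpha>) = \<Phi> \<phi> - \<Phi> \<psi>"
  using M0ddual_add[of \<Phi> \<phi> "\<lambda>\<alpha>. - 1 * \<psi> \<alpha>"] M0ddual_mult[of \<Phi> \<psi> "-1"]
    M0dual_functional_mult[of \<psi> "-1"] by simp

lemma M0ddual_bounded:
  assumes "\<Phi> \<in> M0ddual"
  obtains C where "0 \<le> C" "\<And>\<phi>. \<phi> \<in> M0dual \<Longrightarrow> cmod (\<Phi> \<phi>) \<le> C * dnorm \<phi>"
proof -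
  obtain C where C: "\<And>\<phi>. \<phi> \<in> M0dual \<Longrightarrow> cmod (\<Phi> \<phi>) \<le> C * dnorm \<phi>"
    using assms unfolding M0ddual_def by blast
  have "cmod (\<Phi> \<phi>) \<le> \<bar>C\<bar> * dnorm \<phi>" if "\<phi> \<in> M0dual" for \<phi>
    using C[OF that] mult_right_mono[OF abs_ge_self dnorm_nonneg[OF that], of C] by linarith
  then show thesis using that[of "\<bar>C\<bar>"] by simp
qed

lemma ddnorm_le:
  assumes "0 \<le> C" "\<And>\<phi>. \<phi> \<in> M0dual \<Longrightarrow> cmod (\<Phi> \<phi>) \<le> C * dnorm \<phi>"
  shows "ddnorm \<Phi> \<le> C"
  unfolding ddnorm_def
proof (rule cSup_least)
  have "Lmap (\<lambda>n. 0) \<in> M0dual" "dnorm (Lmap (\<lambda>n. 0)) \<le> 1"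
    using Lmap_M0dual[OF fin_supp_zero] dnorm_Lmap[OF fin_supp_zero] Xnorm_mult[OF fin_supp_zero, of 0]
    by simp_all
  then show "{cmod (\<Phi> \<phi>) |\<phi>. \<phi> \<in> M0dual \<and> dnorm \<phi> \<le> 1} \<noteq> {}" by blast
  fix r assume "r \<in> {cmod (\<Phi> \<phi>) |\<phi>. \<phi> \<in> M0dual \<and> dnorm \<phi> \<le> 1}"
  then obtain \<phi> where \<phi>: "r = cmod (\<Phi> \<phi>)" "\<phi> \<in> M0dual" "dnorm \<phi> \<le> 1" by blast
  then show "r \<le> C" using assms(2)[of \<phi>] mult_left_le[of "dnorm \<phi>" C] assms(1) by simp
qed

text \<open>The candidate for \<open>U \<Phi>\<close>: composing \<open>\<Phi>\<close> with
  \<open>L\<close> gives a functional on finitely supported sequences, and these are its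
  coefficients.\<close>

definition dual_symbol :: "(functional \<Rightarrow> complex) \<Rightarrow> seq" where
  "dual_symbol \<Phi> = (\<lambda>n. if n = 0 then 0 else \<Phi> (Lmap (unit_seq n)))"

lemma M0ddual_Lmap:
  assumes \<Phi>: "\<Phi> \<in> M0ddual" and "fin_supp c"
  shows "\<Phi> (Lmap c) = pair (dual_symbol \<Phi>) c"
  using assms(2)
proof (induction rule: fin_supp_induct)
  case zero
  have "Lmap (\<lambda>n. 0) = (\<lambda>\<alpha>. 0 * Lmap (\<lambda>n. 0) \<alpha>)" by (simp add: Lmap_def pair_def)
  then have "\<Phi> (Lmap (\<lambda>n. 0)) = 0 * \<Phi> (Lmap (\<lambda>n. 0))"
    using M0ddual_mult[OF \<Phi> Lmap_M0dual[OF fin_supp_zero], of 0] by metis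
  then show ?case by (simp add: pair_def)
next
  case (step x k n)
  have "Lmap (\<lambda>i. x i + k * unit_seq n i) = (\<lambda>\<alpha>. Lmap x \<alpha> + k * Lmap (unit_seq n) \<alpha>)"
    using step.hyps by (simp add: Lmap_def pair_add pair_mult del: pair_unit)
  then have "\<Phi> (Lmap (\<lambda>i. x i + k * unit_seq n i)) = \<Phi> (Lmap x) + k * \<Phi> (Lmap (unit_seq n))"
    using step.hyps
    by (simp add: M0ddual_add[OF \<Phi>] M0ddual_mult[OF \<Phi>] Lmap_M0dual M0dual_functional_mult)
  then show ?case using step by (simp add: pair_add pair_mult dual_symbol_def)
qed

lemma dual_symbol_Mb:
  assumes \<Phi>: "\<Phi> \<in> M0ddual"
  shows "dual_symbol \<Phi> \<in> Mb"
proof -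
  obtain C where C: "0 \<le> C" "\<And>\<phi>. \<phi> \<in> M0dual \<Longrightarrow> cmod (\<Phi> \<phi>) \<le> C * dnorm \<phi>"
    by (rule M0ddual_bounded[OF \<Phi>]) blast
  have "hle (dual_symbol \<Phi>) C"
    unfolding hle_def
  proof (intro allI impI)
    fix a b assume ab: "fin_supp a" "fin_supp b"
    have "cmod (hform (dual_symbol \<Phi>) a b) = cmod (\<Phi> (Lmap (dconv a b)))"
      using ab by (simp add: M0ddual_Lmap[OF \<Phi>] pair_dconv)
    also have "\<dots> \<le> C * dnorm (Lmap (dconv a b))" using ab by (intro C Lmap_M0dual) simp
    also have "\<dots> \<le> C * (fnorm a * fnorm b)"
      using ab by (intro mult_left_mono C) (simp add: dnorm_Lmap Xnorm_dconv)
    finally show "cmod (hform (dual_symbol \<Phi>) a b) \<le> C * fnorm a * fnorm b" by (simp add: mult.assoc)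
  qed
  then show ?thesis by (auto simp: Mb_iff dual_symbol_def)
qed

text \<open>In other words, the adjoint of \<open>L\<close> sends \<open>\<Phi>\<close> to
  \<open>J (dual_symbol \<Phi>)\<close>. It holds because \<open>\<Phi>\<close> is continuous and
  \<open>Lmap (s n)\<close> tends to \<open>Lext s\<close> in the dual norm. What then remains is to
  show that \<open>U \<Phi>\<close> is this symbol.\<close>

lemma M0ddual_Lext:
  assumes \<Phi>: "\<Phi> \<in> M0ddual" and s: "s \<in> Xcompl"
  shows "(\<lambda>n. pair (dual_symbol \<Phi>) (s n)) \<longlonglongrightarrow> \<Phi> (Lext s)"
proof -
  obtain C where C: "0 \<le> C" "\<And>\<phi>. \<phi> \<in> M0dual \<Longrightarrow> cmod (\<Phi> \<phi>) \<le> C * dnorm \<phi>"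
    by (rule M0ddual_bounded[OF \<Phi>]) blast
  show ?thesis
  proof (rule tendstoI)
    fix e :: real assume e: "e > 0"
    have e': "e / (C + 1) > 0" using e C(1) by simp
    show "\<forall>\<^sub>F n in sequentially. dist (pair (dual_symbol \<Phi>) (s n)) (\<Phi> (Lext s)) < e"
      using Lext_approx[OF s e']
    proof eventually_elim
      case (elim n)
      let ?d = "\<lambda>\<alpha>. Lext s \<alpha> - Lmap (s n) \<alpha>"
      have d: "?d \<in> M0dual" by (intro M0dual_functional_diff Lext_M0dual Lmap_M0dual Xcompl_fin_supp s)
      have "dnorm ?d \<le> e / (C + 1)"
        using elim e' by (intro dnorm_le) (auto simp: Lmap_def M0_Mb)
      then have "C * dnorm ?d \<le> C * (e / (C + 1))" by (intro mult_left_mono C)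
      also have "\<dots> < e" using C(1) e by (simp add: field_simps)
      finally have "cmod (\<Phi> ?d) < e" using C(2)[OF d] by simp
      moreover have "\<Phi> ?d = \<Phi> (Lext s) - pair (dual_symbol \<Phi>) (s n)"
        using s by (simp add: M0ddual_diff[OF \<Phi>] Lext_M0dual Lmap_M0dual Xcompl_fin_supp M0ddual_Lmap[OF \<Phi>])
      ultimately show ?case by (simp add: dist_norm norm_minus_commute)
    qed
  qed
qed

text \<open>Every functional on \<open>M0\<close> agrees there with some \<open>Lext s\<close> of
  the same norm, and \<open>\<Phi>\<close> acts on \<open>Lext s\<close> as evaluation at its
  symbol. This inequality feeds the comparison required by
  \<open>Mb_eqI_of_hnorm_le\<close>.\<close>

lemma ddnorm_le_hnorm_dual_symbol:
  assumes \<Phi>: "\<Phi> \<in> M0ddual"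
  shows "ddnorm \<Phi> \<le> hnorm (dual_symbol \<Phi>)"
proof (rule ddnorm_le)
  show "0 \<le> hnorm (dual_symbol \<Phi>)" by (rule hnorm_nonneg[OF dual_symbol_Mb[OF \<Phi>]])
  fix \<phi> assume \<phi>: "\<phi> \<in> M0dual"
  obtain s where s: "s \<in> Xcompl" "eq_on_M0 (Lext s) \<phi>" using Lext_onto[OF \<phi>] by blast
  have "\<Phi> (Lext s) = \<Phi> \<phi>" by (rule M0ddual_cong[OF \<Phi> Lext_M0dual[OF s(1)] \<phi> s(2)])
  moreover have "\<Phi> (Lext s) = Lext s (dual_symbol \<Phi>)"
    by (rule LIMSEQ_unique[OF M0ddual_Lext[OF \<Phi> s(1)] pair_Xcompl_tendsto[OF s(1) dual_symbol_Mb[OF \<Phi>]]])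
  moreover have "dnorm \<phi> = Xcnorm s" using dnorm_cong[OF s(2)] dnorm_Lext[OF s(1)] by simp
  ultimately show "cmod (\<Phi> \<phi>) \<le> hnorm (dual_symbol \<Phi>) * dnorm \<phi>"
    using Lext_bound[OF s(1) dual_symbol_Mb[OF \<Phi>]] by (simp add: mult.commute)
qed

lemma iota_M0ddual:
  assumes "\<alpha> \<in> M0"
  shows "iota \<alpha> \<in> M0ddual"
proof -
  have "cmod (iota \<alpha> \<phi>) \<le> hnorm \<alpha> * dnorm \<phi>" if "\<phi> \<in> M0dual" for \<phi>
    using dnorm_bound[OF that assms] by (simp add: iota_def mult.commute)
  moreover have "iota \<alpha> \<phi> = iota \<alpha> \<psi>" if "eq_on_M0 \<phi> \<psi>" for \<phi> \<psi>
    using that assms by (simp add: iota_def eq_on_M0_def)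
  ultimately show ?thesis
    unfolding M0ddual_def
    by (intro CollectI conjI ballI allI impI exI[of _ "hnorm \<alpha>"]) (simp_all add: iota_def)
qed

lemma M0ddual_sum:
  assumes \<Phi>: "\<Phi> \<in> M0ddual" and \<Psi>: "\<Psi> \<in> M0ddual"
  shows "(\<lambda>\<phi>. \<Phi> \<phi> + \<Psi> \<phi>) \<in> M0ddual"
proof -
  obtain C where "0 \<le> C" and C: "\<And>\<phi>. \<phi> \<in> M0dual \<Longrightarrow> cmod (\<Phi> \<phi>) \<le> C * dnorm \<phi>"
    by (rule M0ddual_bounded[OF \<Phi>]) blast
  obtain D where "0 \<le> D" and D: "\<And>\<phi>. \<phi> \<in> M0dual \<Longrightarrow> cmod (\<Psi> \<phi>) \<le> D * dnorm \<phi>"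
    by (rule M0ddual_bounded[OF \<Psi>]) blast
  have "cmod (\<Phi> \<phi> + \<Psi> \<phi>) \<le> (C + D) * dnorm \<phi>" if "\<phi> \<in> M0dual" for \<phi>
    unfolding distrib_right by (rule norm_triangle_mono[OF C[OF that] D[OF that]])
  moreover have "\<Phi> \<phi> + \<Psi> \<phi> = \<Phi> \<psi> + \<Psi> \<psi>"
    if "\<phi> \<in> M0dual" "\<psi> \<in> M0dual" "eq_on_M0 \<phi> \<psi>" for \<phi> \<psi>
    by (simp only: M0ddual_cong[OF \<Phi> that] M0ddual_cong[OF \<Psi> that])
  moreover have "\<Phi> (\<lambda>\<alpha>. \<phi> \<alpha> + \<psi> \<alpha>) + \<Psi> (\<lambda>\<alpha>. \<phi> \<alpha> + \<psi> \<alpha>) = (\<Phi> \<phi> + \<Psi> \<phi>) + (\<Phi> \<psi> + \<Psi> \<psi>)"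
    if "\<phi> \<in> M0dual" "\<psi> \<in> M0dual" for \<phi> \<psi>
    using that by (simp add: M0ddual_add[OF \<Phi>] M0ddual_add[OF \<Psi>])
  moreover have "\<Phi> (\<lambda>\<alpha>. k * \<phi> \<alpha>) + \<Psi> (\<lambda>\<alpha>. k * \<phi> \<alpha>) = k * (\<Phi> \<phi> + \<Psi> \<phi>)"
    if "\<phi> \<in> M0dual" for \<phi> k
    using that by (simp add: M0ddual_mult[OF \<Phi>] M0ddual_mult[OF \<Psi>] distrib_left)
  ultimately show ?thesis
    unfolding M0ddual_def by (intro CollectI conjI ballI allI impI exI[of _ "C + D"])
qed

text \<open>Evaluating \<open>Lmap (unit_seq n)\<close> at \<open>\<alpha>\<close> returns
  \<open>\<alpha> n\<close>, so \<open>iota\<close> has the expected symbol and translations by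
  \<open>M0\<close> match on both sides.\<close>

lemma dual_symbol_iota:
  assumes "\<alpha> \<in> M0"
  shows "dual_symbol (\<lambda>\<phi>. \<Phi> \<phi> + iota \<alpha> \<phi>) = (\<lambda>n. dual_symbol \<Phi> n + \<alpha> n)"
  using M0_Mb[OF assms] by (auto simp: dual_symbol_def iota_def Lmap_def Mb_iff)

text \<open>Elements of the completion and of the dual are given by representatives, so equalities
  are stated modulo \<open>Xequiv\<close> and \<open>eq_on_M0\<close>. The final conjunct encodes
  the identity with \<open>J\<close>: if \<open>U \<Phi> = \<alpha>\<close>, the adjoint of
  \<open>L\<close> applied to the preimage of \<open>\<alpha>\<close> takes the value
  \<open>\<Phi> (Lt s)\<close> at \<open>s\<close>, while \<open>J \<alpha>\<close> there is the
  limit of the pairings along \<open>s\<close>.\<close>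

theorem theorem3:
  fixes U :: "(functional \<Rightarrow> complex) \<Rightarrow> seq"
  assumes U_maps: "\<forall>\<Phi>\<in>M0ddual. U \<Phi> \<in> Mb"
    and U_welldef: "\<forall>\<Phi>\<in>M0ddual. \<forall>\<Psi>\<in>M0ddual. eq_on_M0dual \<Phi> \<Psi> \<longrightarrow> U \<Phi> = U \<Psi>"
    and U_add: "\<forall>\<Phi>\<in>M0ddual. \<forall>\<Psi>\<in>M0ddual.
                  U (\<lambda>\<phi>. \<Phi> \<phi> + \<Psi> \<phi>) = (\<lambda>n. U \<Phi> n + U \<Psi> n)"
    and U_scal: "\<forall>\<Phi>\<in>M0ddual. \<forall>k. U (\<lambda>\<phi>. k * \<Phi> \<phi>) = (\<lambda>n. k * U \<Phi> n)"
    and U_isom: "\<forall>\<Phi>\<in>M0ddual. hnorm (U \<Phi>) = ddnorm \<Phi>"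
    and U_onto: "\<forall>\<alpha>\<in>Mb. \<exists>\<Phi>\<in>M0ddual. U \<Phi> = \<alpha>"
    and U_iota: "\<forall>\<alpha>\<in>M0. U (iota \<alpha>) = \<alpha>"
  shows "\<exists>Lt :: (nat \<Rightarrow> seq) \<Rightarrow> functional.
           (\<forall>s\<in>Xcompl. Lt s \<in> M0dual) \<and>
           (\<forall>s\<in>Xcompl. \<forall>t\<in>Xcompl. Xequiv s t \<longrightarrow> eq_on_M0 (Lt s) (Lt t)) \<and>
           (\<forall>c\<in>Xset. eq_on_M0 (Lt (\<lambda>_. c)) (Lmap c)) \<and>
           (\<forall>s\<in>Xcompl. \<forall>t\<in>Xcompl.
               eq_on_M0 (Lt (\<lambda>n i. s n i + t n i)) (\<lambda>\<alpha>. Lt s \<alpha> + Lt t \<alpha>)) \<and>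
           (\<forall>s\<in>Xcompl. \<forall>k. eq_on_M0 (Lt (\<lambda>n i. k * s n i)) (\<lambda>\<alpha>. k * Lt s \<alpha>)) \<and>
           (\<forall>s\<in>Xcompl. dnorm (Lt s) = Xcnorm s) \<and>
           (\<forall>\<phi>\<in>M0dual. \<exists>s\<in>Xcompl. eq_on_M0 (Lt s) \<phi>) \<and>
           (\<forall>\<alpha>\<in>Mb. \<forall>\<Phi>\<in>M0ddual. U \<Phi> = \<alpha> \<longrightarrow>
               (\<forall>s\<in>Xcompl. (\<lambda>n. pair \<alpha> (s n)) \<longlonglongrightarrow> \<Phi> (Lt s)))"
proof (intro exI[of _ Lext] conjI ballI impI allI)
  show "Lext s \<in> M0dual" if "s \<in> Xcompl" for s by (rule Lext_M0dual[OF that])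
  show "dnorm (Lext s) = Xcnorm s" if "s \<in> Xcompl" for s by (rule dnorm_Lext[OF that])
  show "\<exists>s\<in>Xcompl. eq_on_M0 (Lext s) \<phi>" if "\<phi> \<in> M0dual" for \<phi> by (rule Lext_onto[OF that])
next
  fix s t assume s: "s \<in> Xcompl" and t: "t \<in> Xcompl" and st: "Xequiv s t"
  show "eq_on_M0 (Lext s) (Lext t)"
    unfolding eq_on_M0_def
  proof
    fix \<alpha> assume "\<alpha> \<in> M0"
    then have \<alpha>: "\<alpha> \<in> Mb" by (rule M0_Mb)
    have "(\<lambda>n. Xnorm (\<lambda>i. s n i - t n i) * hnorm \<alpha>) \<longlonglongrightarrow> 0"
      using tendsto_mult[OF st[unfolded Xequiv_def] tendsto_const] by simp
    then have "(\<lambda>n. pair \<alpha> (s n) - pair \<alpha> (t n)) \<longlonglongrightarrow> 0"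
      by (rule Lim_null_comparison[rotated])
        (intro always_eventually allI pair_diff_le \<alpha> Xcompl_fin_supp s t)
    moreover have "(\<lambda>n. pair \<alpha> (s n) - pair \<alpha> (t n)) \<longlonglongrightarrow> Lext s \<alpha> - Lext t \<alpha>"
      by (intro tendsto_diff pair_Xcompl_tendsto s t \<alpha>)
    ultimately have "Lext s \<alpha> - Lext t \<alpha> = 0" by (rule LIMSEQ_unique[rotated])
    then show "Lext s \<alpha> = Lext t \<alpha>" by simp
  qed
next
  fix c assume "c \<in> Xset"
  show "eq_on_M0 (Lext (\<lambda>_. c)) (Lmap c)"
    by (simp add: eq_on_M0_def Lext_def Lmap_def limI)
next
  fix s t assume s: "s \<in> Xcompl" and t: "t \<in> Xcompl"
  show "eq_on_M0 (Lext (\<lambda>n i. s n i + t n i)) (\<lambda>\<alpha>. Lext s \<alpha> + Lext t \<alpha>)"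
    unfolding eq_on_M0_def
  proof
    fix \<alpha> assume "\<alpha> \<in> M0"
    then have "(\<lambda>n. pair \<alpha> (s n) + pair \<alpha> (t n)) \<longlonglongrightarrow> Lext s \<alpha> + Lext t \<alpha>"
      by (intro tendsto_add pair_Xcompl_tendsto s t M0_Mb)
    then show "Lext (\<lambda>n i. s n i + t n i) \<alpha> = Lext s \<alpha> + Lext t \<alpha>"
      unfolding Lext_def[of "\<lambda>n i. s n i + t n i"]
      by (simp add: pair_add Xcompl_fin_supp s t limI)
  qed
next
  fix s k assume s: "s \<in> Xcompl"
  show "eq_on_M0 (Lext (\<lambda>n i. k * s n i)) (\<lambda>\<alpha>. k * Lext s \<alpha>)"
    unfolding eq_on_M0_def
  proof
    fix \<alpha> assume "\<alpha> \<in> M0"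
    then have "(\<lambda>n. k * pair \<alpha> (s n)) \<longlonglongrightarrow> k * Lext s \<alpha>"
      by (intro tendsto_mult tendsto_const pair_Xcompl_tendsto s M0_Mb)
    then show "Lext (\<lambda>n i. k * s n i) \<alpha> = k * Lext s \<alpha>"
      unfolding Lext_def[of "\<lambda>n i. k * s n i"]
      by (simp add: pair_mult Xcompl_fin_supp s limI)
  qed
next
  fix \<alpha> \<Phi> s assume "\<alpha> \<in> Mb" and \<Phi>: "\<Phi> \<in> M0ddual" and U: "U \<Phi> = \<alpha>" and s: "s \<in> Xcompl"
  have "\<alpha> = dual_symbol \<Phi>"
  proof (rule Mb_eqI_of_hnorm_le[OF \<open>\<alpha> \<in> Mb\<close> dual_symbol_Mb[OF \<Phi>]])
    fix y assume y: "y \<in> M0"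
    \<comment> \<open>Translating \<open>\<Phi>\<close> by \<open>iota y\<close> translates both
      \<open>U \<Phi>\<close> and \<open>dual_symbol \<Phi>\<close> by \<open>y\<close>; the
      isometry of \<open>U\<close> then compares the two norms.\<close>
    let ?\<Psi> = "\<lambda>\<phi>. \<Phi> \<phi> + iota y \<phi>"
    have \<Psi>: "?\<Psi> \<in> M0ddual" by (rule M0ddual_sum[OF \<Phi> iota_M0ddual[OF y]])
    have "U ?\<Psi> = (\<lambda>n. U \<Phi> n + U (iota y) n)" using U_add \<Phi> iota_M0ddual[OF y] by blast
    also have "\<dots> = (\<lambda>n. \<alpha> n + y n)" using U U_iota y by simp
    finally have "hnorm (\<lambda>n. \<alpha> n + y n) = ddnorm ?\<Psi>" using U_isom[rule_format, OF \<Psi>] by simp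
    also have "\<dots> \<le> hnorm (\<lambda>n. dual_symbol \<Phi> n + y n)"
      using ddnorm_le_hnorm_dual_symbol[OF \<Psi>] by (simp add: dual_symbol_iota[OF y])
    finally show "hnorm (\<lambda>n. \<alpha> n + y n) \<le> hnorm (\<lambda>n. dual_symbol \<Phi> n + y n)" .
  qed
  then show "(\<lambda>n. pair \<alpha> (s n)) \<longlonglongrightarrow> \<Phi> (Lext s)" using M0ddual_Lext[OF \<Phi> s] by (simp only:)
qed

end
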